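(* Let $K,L,T\ge 1$ be integers, let $N^*=N^*_{\mathrm{GASP}}(K,L,T)$ be the optimal number of servers for the GASP codes, attained at the optimal parameter $r^*$, and let $\mathcal{IS}$ be the interference set of the $\mathrm{GASP}_{r^*}$ code. If $$|LCC(\mathcal{IS})|\ \ge\ \left\lceil \frac{N^*_{\mathrm{GASP}}(K,L,T)}{2}\right\rceil ,$$ then there exists a quantum coding scheme for private distributed matrix multiplication (with parameters $K,L,T$, using $N^*$ servers and computing $m=2$ instances) whose rate is $$R_Q(K,L,T)=\frac{2KL}{N^*_{\mathrm{GASP}}(K,L,T)}=2R_C(K,L,T),$$ where $R_C(K,L,T)=KL/N^*_{\mathrm{GASP}}(K,L,T)$ is the rate of the classical GASP code.
   Context: **GASP exponents.** For integers $K,L,T\ge1$ and $1\le r\le \min\{K,T\}$, the $\mathrm{GASP}_r$ code has exponent vectors $\alpha=(\alpha^{(1)},\alpha^{(2)})\in\mathbb{N}^{K+T}$ and $\beta=(\beta^{(1)},\beta^{(2)})\in\mathbb{N}^{L+T}$ with - $\alpha^{(1)}=(0,1,\dots,K-1)$; - $\alpha^{(2)}$ = the first $T$ terms of the sequence $KL,KL+1,\dots,KL+r-1,\ KL+K,KL+K+1,\dots,KL+K+r-1,\ KL+2K,\dots$ (blocks of $r$ consecutive integers, the $j$-th block starting at $KL+jK$, $j=0,1,2,\dots$); - $\beta^{(1)}=(0,K,2K,\dots,K(L-1))$; - $\beta^{(2)}=(KL,KL+1,\dots,KL+T-1)$. Let $PM\in\mathbb{N}^{(K+T)\times(L+T)}$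 with $PM(i,j)=\alpha_i+\beta_j$, and for a matrix $P$ let $Set(P)$ be the set of its entries. The number of servers of $\mathrm{GASP}_r$ is $N(r)=|Set(PM)|$. The optimal number of servers is $N^*_{\mathrm{GASP}}(K,L,T)=\min_{1\le r\le\min\{K,T\}}N(r)$, and $r^*$ denotes a value of $r$ attaining this minimum. For $r=r^*$ put $\mathcal{UL}=Set(PM(1{:}K,1{:}L))$ (entries in the first $K$ rows and first $L$ columns) and $\mathcal{IS}=Set(PM)\setminus\mathcal{UL}$. For a finite set $\mathcal X\subset\mathbb N$, $LCC(\mathcal X)$ is a longest set of consecutive integers (arithmetic progression with unit difference) contained in $\mathcal X$. **Quantum private distributed matrix multiplication (outer product partitioning).** Let $\mathbb F_q$ be a finite field; a scheme is required to exist whenever $q$ is sufficiently large (depending on $K,L,T$). A user holds $m$ instances $(A^{[1]},B^{[1]}),\dots,(A^{[m]},B^{[m]})$ of pairs of independent uniformly random matrices $A^{[i]}\in\mathbb F_q^{Ks\times\kappa}$, $B^{[i]}\in\mathbb F_q^{\kappa\times \ell L}$, where $A^{[i]}$ is divided into $K$ row blocks $A^{[i]}_1,\dots,A^{[i]}_K\in\mathbb F_q^{s\times\kappa}$ and $B^{[i]}$ into $L$ column blocks $B^{[i]}_1,\dots,B^{[i]}_L\in\mathbb F_q^{\kappa\times\ell}$. Write $A=(A^{[i]})_i$, $B=(B^{[i]})_i$. The user wants all products $A^{[i]}B^{[i]}$, i.e. all blocks $A^{[i]}_kB^{[i]}_{j}$. A scheme with $N$ servers works as follows. 1. The user sends to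 server $n\in[N]$, over a noiseless classical channel, (randomized) encodings $f_n$ of $A$ (an $s\times\kappa$ matrix over $\mathbb F_q$ for each instance) and $g_n$ of $B$ (a $\kappa\times\ell$ matrix over $\mathbb F_q$ for each instance). 2. The servers share in advance an entangled quantum state (not shared with the user and independent of $A,B$ and the encodings), of which server $n$ holds the $n$-th subsystem. That subsystem consists of $s\ell$ qudits of dimension $q$, one for each entry position of an $s\times\ell$ block. Server $n$ applies to its own subsystem a quantum operation depending only on $(f_n,g_n)$, and sends the resulting subsystem to the user over a noiseless quantum channel. 3. The user applies a measurement to all received subsystems, obtaining a classical output $Y$. The scheme must satisfy: - $T$-privacy: $I(f_{\mathcal T_1},g_{\mathcal T_2};A,B)=0$ for all $\mathcal T_1,\mathcal T_2\subset[N]$ with $|\mathcal T_1|,|\mathcal T_2|\le T$, where $f_{\mathcal T}=(f_n)_{n\in\mathcal T}$ and similarly for $g$; - decodability: $H\big(A^{[1]}B^{[1]},\dots,A^{[m]}B^{[m]}\mid Y\big)=0$. Its rate is $R=mKL/N$ (number of computed block products over number of downloaded $q$-dimensional symbols, per entry position). *)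

theory Defs
  imports "HOL-Probability.Probability" "HOL-Algebra.Ring"
begin

section \<open>GASP exponents\<close>

text \<open>All indices start at 0. The term with index \<open>t\<close> of the second part of \<open>\<alpha>\<close> lies
  in block \<open>t div r\<close>, at offset \<open>t mod r\<close>.\<close>

definition gasp_alpha :: "nat \<Rightarrow> nat \<Rightarrow> nat \<Rightarrow> nat \<Rightarrow> nat" where
  "gasp_alpha K L r i =
     (if i < K then i else K * L + ((i - K) div r) * K + (i - K) mod r)"

definition gasp_beta :: "nat \<Rightarrow> nat \<Rightarrow> nat \<Rightarrow> nat" where
  "gasp_beta K L j = (if j < L then K * j else K * L + (j - L))"

definition gasp_PM :: "nat \<Rightarrow> nat \<Rightarrow> nat \<Rightarrow> nat \<Rightarrow> nat \<Rightarrow> nat" where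
  "gasp_PM K L r i j = gasp_alpha K L r i + gasp_beta K L j"

definition entries :: "(nat \<Rightarrow> nat \<Rightarrow> nat) \<Rightarrow> nat \<Rightarrow> nat \<Rightarrow> nat set" where
  "entries P m n = {P i j |i j. i < m \<and> j < n}"

definition gasp_servers :: "nat \<Rightarrow> nat \<Rightarrow> nat \<Rightarrow> nat \<Rightarrow> nat" where
  "gasp_servers K L T r = card (entries (gasp_PM K L r) (K + T) (L + T))"

definition gasp_opt :: "nat \<Rightarrow> nat \<Rightarrow> nat \<Rightarrow> nat" where
  "gasp_opt K L T = Min (gasp_servers K L T ` {1..min K T})"

definition gasp_UL :: "nat \<Rightarrow> nat \<Rightarrow> nat \<Rightarrow> nat set" where
  "gasp_UL K L r = entries (gasp_PM K L r) K L"

definition gasp_IS :: "nat \<Rightarrow> nat \<Rightarrow> nat \<Rightarrow> nat \<Rightarrow> nat set" where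
  "gasp_IS K L T r = entries (gasp_PM K L r) (K + T) (L + T) - gasp_UL K L r"

definition LCC :: "nat set \<Rightarrow> nat set" where
  "LCC X = (ARG_MAX card C. C \<subseteq> X \<and> (\<exists>a k. C = {a..<a + k}))"

definition classical_rate :: "nat \<Rightarrow> nat \<Rightarrow> nat \<Rightarrow> real" where
  "classical_rate K L T = real (K * L) / real (gasp_opt K L T)"


section \<open>Matrices over a finite field\<close>

type_synonym 'a mtx = "nat \<times> nat \<Rightarrow> 'a"

definition fmat :: "'a ring \<Rightarrow> nat \<Rightarrow> nat \<Rightarrow> 'a mtx set" where
  "fmat F m n = ({..<m} \<times> {..<n}) \<rightarrow>\<^sub>E carrier F"

definition fmat_mult ::
    "'a ring \<Rightarrow> nat \<Rightarrow> nat \<Rightarrow> nat \<Rightarrow> 'a mtx \<Rightarrow> 'a mtx \<Rightarrow> 'a mtx" where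
  "fmat_mult F m k n X Y =
     (\<lambda>(i, j)\<in>{..<m} \<times> {..<n}. \<Oplus>\<^bsub>F\<^esub>z\<in>{..<k}. X (i, z) \<otimes>\<^bsub>F\<^esub> Y (z, j))"

text \<open>Tuples of matrices, one for each computed instance.\<close>

type_synonym 'a insts = "nat \<Rightarrow> 'a mtx"

definition fmats :: "'a ring \<Rightarrow> nat \<Rightarrow> nat \<Rightarrow> nat \<Rightarrow> 'a insts set" where
  "fmats F N m n = {..<N} \<rightarrow>\<^sub>E fmat F m n"


section \<open>Finite-dimensional quantum mechanics\<close>

text \<open>The Hilbert space with orthonormal basis labelled by a finite set \<open>B\<close>; an operator is
  given by its matrix entries in that basis, and entries outside \<open>B \<times> B\<close> are ignored.\<close>

type_synonym 'b qop = "'b \<Rightarrow> 'b \<Rightarrow> complex"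

definition qmult :: "'b set \<Rightarrow> 'b qop \<Rightarrow> 'b qop \<Rightarrow> 'b qop" where
  "qmult B X Y = (\<lambda>x y. \<Sum>z\<in>B. X x z * Y z y)"

definition qadj :: "'b qop \<Rightarrow> 'b qop" where
  "qadj X = (\<lambda>x y. cnj (X y x))"

definition qtrace :: "'b set \<Rightarrow> 'b qop \<Rightarrow> complex" where
  "qtrace B X = (\<Sum>x\<in>B. X x x)"

definition qid_on :: "'b set \<Rightarrow> 'b qop \<Rightarrow> bool" where
  "qid_on B X \<longleftrightarrow> (\<forall>x\<in>B. \<forall>y\<in>B. X x y = (if x = y then 1 else 0))"

definition qpos :: "'b set \<Rightarrow> 'b qop \<Rightarrow> bool" where
  "qpos B X \<longleftrightarrow> (\<forall>v. (\<Sum>x\<in>B. \<Sum>y\<in>B. cnj (v x) * X x y * v y) \<in> \<real>\<^sub>\<ge>\<^sub>0)"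

definition density_operator :: "'b set \<Rightarrow> 'b qop \<Rightarrow> bool" where
  "density_operator B \<rho> \<longleftrightarrow> qpos B \<rho> \<and> qtrace B \<rho> = 1"

text \<open>A (trace-preserving) quantum operation in operator-sum form, given by the list of its
  Kraus operators \<open>E\<close>, i.e. \<open>\<rho> \<mapsto> \<Sum>E. E \<rho> E\<^sup>\<dagger>\<close> with \<open>\<Sum>E. E\<^sup>\<dagger> E = 1\<close>.\<close>

definition quantum_operation :: "'b set \<Rightarrow> 'b qop list \<Rightarrow> bool" where
  "quantum_operation B Es \<longleftrightarrow>
     qid_on B (\<lambda>x y. \<Sum>E\<leftarrow>Es. qmult B (qadj E) E x y)"

definition measurement :: "'b set \<Rightarrow> nat \<Rightarrow> (nat \<Rightarrow> 'b qop) \<Rightarrow> bool" where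
  "measurement B k M \<longleftrightarrow>
     (\<forall>y<k. qpos B (M y)) \<and> qid_on B (\<lambda>u v. \<Sum>y<k. M y u v)"

definition born :: "'b set \<Rightarrow> 'b qop \<Rightarrow> 'b qop \<Rightarrow> real" where
  "born B M \<rho> = Re (qtrace B (qmult B M \<rho>))"

text \<open>Composite of \<open>N\<close> subsystems, each with basis labels \<open>B\<close>.\<close>

definition composite :: "nat \<Rightarrow> 'b set \<Rightarrow> (nat \<Rightarrow> 'b) set" where
  "composite N B = {..<N} \<rightarrow>\<^sub>E B"

definition qtensor :: "nat \<Rightarrow> (nat \<Rightarrow> 'b qop) \<Rightarrow> (nat \<Rightarrow> 'b) qop" where
  "qtensor N E = (\<lambda>x y. \<Prod>n<N. E n (x n) (y n))"

text \<open>The tensor product of the operations \<open>Es n\<close> (\<open>n < N\<close>): its Kraus operators are the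
  tensor products of one Kraus operator from each \<open>Es n\<close>, selected by \<open>c\<close>.\<close>

definition apply_local ::
    "nat \<Rightarrow> 'b set \<Rightarrow> (nat \<Rightarrow> 'b qop list) \<Rightarrow> (nat \<Rightarrow> 'b) qop \<Rightarrow> (nat \<Rightarrow> 'b) qop" where
  "apply_local N B Es \<rho> =
     (\<lambda>x y. \<Sum>c\<in>(\<Pi>\<^sub>E n\<in>{..<N}. {..<length (Es n)}).
        let E = qtensor N (\<lambda>n. Es n ! c n); H = composite N B
        in qmult H (qmult H E \<rho>) (qadj E) x y)"


section \<open>Quantum schemes for private distributed matrix multiplication\<close>

text \<open>
  \<open>encA S n A w\<close> and \<open>encB S n B w\<close> are the encodings \<open>f\<^sub>n\<close> and \<open>g\<^sub>n\<close>, where \<open>w\<close> is the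
  private randomness of the user, drawn from \<open>rnd S\<close> independently of the data. The basis
  states of the subsystem of a server, that is of one \<open>q\<close>-dimensional qudit for each entry
  position of an \<open>s \<times> l\<close> block, are labelled by the \<open>s \<times> l\<close> matrices over the field.
\<close>

record 'a qscheme =
  servers :: nat
  instances :: nat
  rnd :: "nat pmf"
  encA :: "nat \<Rightarrow> 'a insts \<Rightarrow> nat \<Rightarrow> 'a insts"
  encB :: "nat \<Rightarrow> 'a insts \<Rightarrow> nat \<Rightarrow> 'a insts"
  shared_state :: "(nat \<Rightarrow> 'a mtx) qop"
  server_op :: "nat \<Rightarrow> 'a insts \<Rightarrow> 'a insts \<Rightarrow> 'a mtx qop list"
  outcomes :: nat
  user_meas :: "nat \<Rightarrow> (nat \<Rightarrow> 'a mtx) qop"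

definition data_A :: "'a ring \<Rightarrow> nat \<Rightarrow> nat \<Rightarrow> nat \<Rightarrow> 'a qscheme \<Rightarrow> 'a insts set" where
  "data_A F s k K S = fmats F (instances S) (K * s) k"

definition data_B :: "'a ring \<Rightarrow> nat \<Rightarrow> nat \<Rightarrow> nat \<Rightarrow> 'a qscheme \<Rightarrow> 'a insts set" where
  "data_B F k l L S = fmats F (instances S) k (l * L)"

definition received_state ::
    "'a ring \<Rightarrow> nat \<Rightarrow> nat \<Rightarrow> 'a qscheme \<Rightarrow> 'a insts \<Rightarrow> 'a insts \<Rightarrow> nat \<Rightarrow> (nat \<Rightarrow> 'a mtx) qop"
where
  "received_state F s l S A B w =
     apply_local (servers S) (fmat F s l)
       (\<lambda>n. server_op S n (encA S n A w) (encB S n B w)) (shared_state S)"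

text \<open>The finite sample space of all \<open>(A, B, w, y)\<close> with the joint law of the data (uniform),
  the private randomness and the measurement outcome (Born rule).\<close>

definition scheme_space ::
    "'a ring \<Rightarrow> nat \<Rightarrow> nat \<Rightarrow> nat \<Rightarrow> nat \<Rightarrow> nat \<Rightarrow> 'a qscheme
      \<Rightarrow> ('a insts \<times> 'a insts \<times> nat \<times> nat) measure" where
  "scheme_space F s k l K L S =
     point_measure
       (data_A F s k K S \<times> data_B F k l L S \<times> set_pmf (rnd S) \<times> {..<outcomes S})
       (\<lambda>(A, B, w, y). ennreal (1 / real (card (data_A F s k K S))
          * (1 / real (card (data_B F k l L S))) * pmf (rnd S) w
          * born (composite (servers S) (fmat F s l)) (user_meas S y)
              (received_state F s l S A B w)))"

text \<open>Information quantities in bits of random variables on a finite sample space; these are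
  the library's \<open>mutual_information_Pow\<close> and \<open>conditional_entropy_Pow\<close>, stated outside their
  locale.\<close>

definition mutual_info :: "'w measure \<Rightarrow> ('w \<Rightarrow> 'x) \<Rightarrow> ('w \<Rightarrow> 'y) \<Rightarrow> real" where
  "mutual_info M X Y = prob_space.mutual_information M 2
     (count_space (X ` space M)) (count_space (Y ` space M)) X Y"

definition cond_entropy :: "'w measure \<Rightarrow> ('w \<Rightarrow> 'x) \<Rightarrow> ('w \<Rightarrow> 'y) \<Rightarrow> real" where
  "cond_entropy M X Y = prob_space.conditional_entropy M 2
     (count_space (X ` space M)) (count_space (Y ` space M)) X Y"

definition wf_scheme ::
    "'a ring \<Rightarrow> nat \<Rightarrow> nat \<Rightarrow> nat \<Rightarrow> nat \<Rightarrow> nat \<Rightarrow> 'a qscheme \<Rightarrow> bool" where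
  "wf_scheme F s k l K L S \<longleftrightarrow>
     finite (set_pmf (rnd S)) \<and>
     (\<forall>n<servers S. \<forall>w\<in>set_pmf (rnd S).
        (\<forall>A\<in>data_A F s k K S. encA S n A w \<in> fmats F (instances S) s k) \<and>
        (\<forall>B\<in>data_B F k l L S. encB S n B w \<in> fmats F (instances S) k l)) \<and>
     density_operator (composite (servers S) (fmat F s l)) (shared_state S) \<and>
     (\<forall>n<servers S. \<forall>f\<in>fmats F (instances S) s k. \<forall>g\<in>fmats F (instances S) k l.
        quantum_operation (fmat F s l) (server_op S n f g)) \<and>
     measurement (composite (servers S) (fmat F s l)) (outcomes S) (user_meas S)"

definition T_private ::
    "'a ring \<Rightarrow> nat \<Rightarrow> nat \<Rightarrow> nat \<Rightarrow> nat \<Rightarrow> nat \<Rightarrow> nat \<Rightarrow> 'a qscheme \<Rightarrow> bool" where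
  "T_private F s k l K L T S \<longleftrightarrow>
     (\<forall>T1 T2. T1 \<subseteq> {..<servers S} \<and> T2 \<subseteq> {..<servers S} \<and> card T1 \<le> T \<and> card T2 \<le> T \<longrightarrow>
        mutual_info (scheme_space F s k l K L S)
          (\<lambda>(A, B, w, y). (\<lambda>n\<in>T1. encA S n A w, \<lambda>n\<in>T2. encB S n B w))
          (\<lambda>(A, B, w, y). (A, B)) = 0)"

definition decodable ::
    "'a ring \<Rightarrow> nat \<Rightarrow> nat \<Rightarrow> nat \<Rightarrow> nat \<Rightarrow> nat \<Rightarrow> 'a qscheme \<Rightarrow> bool" where
  "decodable F s k l K L S \<longleftrightarrow>
     cond_entropy (scheme_space F s k l K L S)
       (\<lambda>(A, B, w, y). \<lambda>i\<in>{..<instances S}. fmat_mult F (K * s) k (l * L) (A i) (B i))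
       (\<lambda>(A, B, w, y). y) = 0"

definition qpdmm_scheme ::
    "'a ring \<Rightarrow> nat \<Rightarrow> nat \<Rightarrow> nat \<Rightarrow> nat \<Rightarrow> nat \<Rightarrow> nat \<Rightarrow> 'a qscheme \<Rightarrow> bool" where
  "qpdmm_scheme F s k l K L T S \<longleftrightarrow>
     wf_scheme F s k l K L S \<and> T_private F s k l K L T S \<and> decodable F s k l K L S"

definition scheme_rate :: "nat \<Rightarrow> nat \<Rightarrow> 'a qscheme \<Rightarrow> real" where
  "scheme_rate K L S = real (instances S * K * L) / real (servers S)"

end

(*
  The servers are indexed by evaluation points x_0, ..., x_{N-1} all of whose generalized Vandermonde
  matrices with exponents up to a bound are invertible; over a large field they can be chosen greedily.
  Server n returns the answer polynomials of the two instances, evaluated at x_n, as the shift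
  and the phase of a Weyl operator applied to its subsystem.  The shared state is the uniform
  superposition over a code V spanned by k1 = ceil(N/2) consecutive interference exponents.  It is
  stabilised by shifts from V and by phases from the dual of V, and the dual is spanned, after
  multiplying column n by a nonzero v_n, by N - k1 of the same consecutive exponents.  Premultiplying the
  second instance by v_n therefore makes the unobservable directions of both instances lie in the
  interference, so a measurement recovers both products with certainty.  Privacy is that of the
  classical GASP code.

  The measurement averages the projectors over all Weyl translates of the shared state instead of
  choosing representatives of the cosets; this makes completeness an orthogonality relation of characters.
*)
theory Submission
  imports Defs "HOL-Algebra.Multiplicative_Group" "HOL-Algebra.Elementary_Groups"
begin

section \<open>Entropy on finite point measures\<close>

text \<open>Consecutive exponents matter because of sumsets. At each server, an exponent of V and
  one of its dual add up, and the multipliers \<open>v\<close> have to be orthogonal to every such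
  sum. N - 1 linear conditions on N coordinates always have a nonzero solution, while N generic ones
  have none. Nonempty sets of k1 and N - k1 exponents have at least N - 1 distinct sums, and two
  runs have exactly that many: \<open>{a..<a + k1}\<close> and \<open>{a..<a + (N - k1)}\<close>
  give \<open>{2 * a..<2 * a + (N - 1)}\<close>. The ceiling of N / 2 is the least k1 with N - k1
  \<le> k1, that is, the least for which the dual exponents lie in the run that spans V.

  The set of all N exponents and the exponents of the masks have gaps. Distinct points are then not
  enough, since a generalized Vandermonde matrix over a finite field can be singular at distinct
  points; this is why genericity is asked for all exponent sets up to a bound. That bound has to
  reach the sums near \<open>2 * a + N\<close> as well as the exponents of the code.\<close>

lemma information_space_point_measure:
  assumes "finite \<Omega>" and "\<And>\<omega>. \<omega> \<in> \<Omega> \<Longrightarrow> 0 \<le> p \<omega>" and "(\<Sum>\<omega>\<in>\<Omega>. p \<omega>) = (1::real)"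
  shows "information_space (point_measure \<Omega> (\<lambda>\<omega>. ennreal (p \<omega>))) 2"
proof -
  have "(\<Sum>\<omega>\<in>\<Omega>. ennreal (p \<omega>)) = 1"
    using assms by (simp add: sum_ennreal)
  then interpret prob_space "point_measure \<Omega> (\<lambda>\<omega>. ennreal (p \<omega>))"
    using assms(1) by (intro prob_space_point_measure) auto
  show ?thesis by unfold_locales simp
qed

text \<open>Laws are kept as sums of weights over fibres, so that privacy becomes a matter of
  counting keys.\<close>

lemma mutual_info_point_measure_eq_0:
  assumes fin: "finite \<Omega>" and nn: "\<And>\<omega>. \<omega> \<in> \<Omega> \<Longrightarrow> 0 \<le> p \<omega>" and one: "(\<Sum>\<omega>\<in>\<Omega>. p \<omega>) = (1::real)"
    and indep: "\<And>x y. (\<Sum>\<omega> | \<omega> \<in> \<Omega> \<and> X \<omega> = x \<and> Y \<omega> = y. p \<omega>)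
      = (\<Sum>\<omega> | \<omega> \<in> \<Omega> \<and> X \<omega> = x. p \<omega>) * (\<Sum>\<omega> | \<omega> \<in> \<Omega> \<and> Y \<omega> = y. p \<omega>)"
  shows "mutual_info (point_measure \<Omega> (\<lambda>\<omega>. ennreal (p \<omega>))) X Y = 0"
proof -
  interpret information_space "point_measure \<Omega> (\<lambda>\<omega>. ennreal (p \<omega>))" 2
    using assms by (intro information_space_point_measure)
  let ?M = "point_measure \<Omega> (\<lambda>\<omega>. ennreal (p \<omega>))"
  have ms: "measure ?M (Z -` {z} \<inter> space ?M) = (\<Sum>\<omega> | \<omega> \<in> \<Omega> \<and> Z \<omega> = z. p \<omega>)" for Z and z :: 'z
    using fin nn by (subst measure_point_measure_finite_if)
      (auto simp: space_point_measure intro!: sum.cong)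
  have sd: "simple_distributed ?M Z (\<lambda>z. \<Sum>\<omega> | \<omega> \<in> \<Omega> \<and> Z \<omega> = z. p \<omega>)" for Z :: "'a \<Rightarrow> 'z"
    using fin nn by (intro simple_distributedI) (auto simp: ms intro!: sum_nonneg)
  have "(\<Sum>\<omega> | \<omega> \<in> \<Omega> \<and> (X \<omega>, Y \<omega>) = xy. p \<omega>) = (\<Sum>\<omega> | \<omega> \<in> \<Omega> \<and> X \<omega> = fst xy. p \<omega>) * (\<Sum>\<omega> | \<omega> \<in> \<Omega> \<and> Y \<omega> = snd xy. p \<omega>)" for xy
    by (subst indep[symmetric]) (auto intro!: sum.cong)
  then show ?thesis
    unfolding mutual_info_def
    by (intro mutual_information_eq_0_simple[OF sd sd sd]) auto
qed

text \<open>When \<open>Y\<close> determines \<open>X\<close> on the support, each joint probability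
  either vanishes or equals the marginal of y, so every term of the entropy sum is 0. The hypothesis
  speaks of positive weights because the sample space also contains outcomes that never
  occur.\<close>

lemma cond_entropy_point_measure_eq_0:
  assumes fin: "finite \<Omega>" and nn: "\<And>\<omega>. \<omega> \<in> \<Omega> \<Longrightarrow> 0 \<le> p \<omega>" and one: "(\<Sum>\<omega>\<in>\<Omega>. p \<omega>) = (1::real)"
    and det: "\<And>\<omega> \<omega>'. \<omega> \<in> \<Omega> \<Longrightarrow> \<omega>' \<in> \<Omega> \<Longrightarrow> 0 < p \<omega> \<Longrightarrow> 0 < p \<omega>' \<Longrightarrow> Y \<omega> = Y \<omega>' \<Longrightarrow> X \<omega> = X \<omega>'"
  shows "cond_entropy (point_measure \<Omega> (\<lambda>\<omega>. ennreal (p \<omega>))) X Y = 0"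
proof -
  interpret information_space "point_measure \<Omega> (\<lambda>\<omega>. ennreal (p \<omega>))" 2
    using assms by (intro information_space_point_measure)
  let ?M = "point_measure \<Omega> (\<lambda>\<omega>. ennreal (p \<omega>))"
  let ?P = "\<lambda>xy. \<Sum>\<omega> | \<omega> \<in> \<Omega> \<and> (X \<omega>, Y \<omega>) = xy. p \<omega>"
  let ?Q = "\<lambda>y. \<Sum>\<omega> | \<omega> \<in> \<Omega> \<and> Y \<omega> = y. p \<omega>"
  have ms: "measure ?M (Z -` {z} \<inter> space ?M) = (\<Sum>\<omega> | \<omega> \<in> \<Omega> \<and> Z \<omega> = z. p \<omega>)" for Z and z :: 'z
    using fin nn by (subst measure_point_measure_finite_if)
      (auto simp: space_point_measure intro!: sum.cong)
  have sd: "simple_distributed ?M Z (\<lambda>z. \<Sum>\<omega> | \<omega> \<in> \<Omega> \<and> Z \<omega> = z. p \<omega>)" for Z :: "'a \<Rightarrow> 'z"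
    using fin nn by (intro simple_distributedI) (auto simp: ms intro!: sum_nonneg)
  have z: "?P (x, y) * log 2 (?P (x, y) / ?Q y) = 0" for x y
  proof (cases "?P (x, y) = 0")
    case False
      then obtain \<omega> where w: "\<omega> \<in> \<Omega>" "X \<omega> = x" "Y \<omega> = y" "0 < p \<omega>"
    proof -
      obtain \<omega> where "\<omega> \<in> {\<omega> \<in> \<Omega>. (X \<omega>, Y \<omega>) = (x, y)}" "p \<omega> \<noteq> 0"
        using False by (rule sum.not_neutral_contains_not_neutral)
      then show thesis
        using that[of \<omega>] nn[of \<omega>] by auto
    qed
    \<comment> \<open>Since \<open>\<omega>\<close> has positive weight, a point with the same y but
      another x has weight 0.\<close>
    have "?P (x, y) = ?Q y"
    proof (intro sum.mono_neutral_left ballI)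
      fix \<omega>' assume w': "\<omega>' \<in> {\<omega> \<in> \<Omega>. Y \<omega> = y} - {\<omega> \<in> \<Omega>. (X \<omega>, Y \<omega>) = (x, y)}"
      then have "\<not> 0 < p \<omega>'"
        using det[of \<omega>' \<omega>] w by auto
      then show "p \<omega>' = 0"
        using nn[of \<omega>'] w' by auto
    qed (use fin in auto)
    then show ?thesis using False by simp
  qed simp
  show ?thesis
    unfolding cond_entropy_def
    using z by (subst conditional_entropy_eq[OF sd sd]) (simp only: case_prod_unfold sum.neutral_const minus_zero)
qed

section \<open>Weyl translates of a code state\<close>

definition pure_state :: "('b \<Rightarrow> complex) \<Rightarrow> 'b qop" where
  "pure_state \<phi> = (\<lambda>x y. \<phi> x * cnj (\<phi> y))"

lemma complex_mult_cnj_nonneg: "z * cnj z \<in> \<real>\<^sub>\<ge>\<^sub>0"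
  by (simp add: complex_nonneg_Reals_iff)

lemma sum_nonneg_Reals: "(\<And>x. x \<in> A \<Longrightarrow> f x \<in> \<real>\<^sub>\<ge>\<^sub>0) \<Longrightarrow> sum f A \<in> (\<real>\<^sub>\<ge>\<^sub>0 :: complex set)"
  by (induction A rule: infinite_finite_induct) (auto intro: nonneg_Reals_add_I)

lemma pure_state_quadratic_form:
  "(\<Sum>x\<in>B. \<Sum>y\<in>B. cnj (v x) * pure_state \<phi> x y * v y)
    = (\<Sum>x\<in>B. cnj (v x) * \<phi> x) * cnj (\<Sum>x\<in>B. cnj (v x) * \<phi> x)"
  unfolding pure_state_def cnj_sum sum_product
  by (intro sum.cong refl) (simp add: mult_ac)

lemma qpos_pure_state: "qpos B (pure_state \<phi>)"
  unfolding qpos_def pure_state_quadratic_form by (intro allI complex_mult_cnj_nonneg)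

lemma born_pure_states:
  "qtrace B (qmult B (pure_state \<psi>) (pure_state \<phi>))
    = (\<Sum>x\<in>B. cnj (\<psi> x) * \<phi> x) * cnj (\<Sum>x\<in>B. cnj (\<psi> x) * \<phi> x)"
  unfolding qtrace_def qmult_def pure_state_def cnj_sum sum_product
  by (subst sum.swap) (intro sum.cong refl, simp add: mult_ac)

lemma sum_rotate:
  "(\<Sum>u\<in>A. \<Sum>w\<in>B. \<Sum>i\<in>I. f u w i) = (\<Sum>i\<in>I. \<Sum>u\<in>A. \<Sum>w\<in>B. f u w i)"
  by (simp add: sum.swap[of _ I B] sum.swap[of _ I A])

lemma (in comm_group) diff_diff_cancel:
  assumes "a \<in> carrier G" "b \<in> carrier G" "c \<in> carrier G"
  shows "(a \<otimes> inv c) \<otimes> inv (b \<otimes> inv c) = a \<otimes> inv b"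
proof -
  have "(a \<otimes> inv c) \<otimes> inv (b \<otimes> inv c) = a \<otimes> (inv b \<otimes> (inv c \<otimes> c))"
    using assms by (simp add: inv_mult m_assoc m_lcomm[of "inv c" "inv b"])
  then show ?thesis using assms by simp
qed

text \<open>The notation is multiplicative, but the group stands for an additive group of basis
  labels. \<open>\<theta> z\<close> is the character with label \<open>z\<close>, and
  \<open>chi_orth\<close> is the column orthogonality of the character table. Characters are
  labelled by the same carrier because a Weyl operator takes its shift and its phase from one
  set.\<close>

locale phase_space = comm_group G for G :: "('b, 'c) monoid_scheme" (structure) +
  fixes \<theta> :: "'b \<Rightarrow> 'b \<Rightarrow> complex" and V :: "'b set"
  assumes fin: "finite (carrier G)"
    and norm_chi: "z \<in> carrier G \<Longrightarrow> b \<in> carrier G \<Longrightarrow> cmod (\<theta> z b) = 1"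
    and chi_mult: "z \<in> carrier G \<Longrightarrow> b \<in> carrier G \<Longrightarrow> c \<in> carrier G \<Longrightarrow>
      \<theta> z (b \<otimes> c) = \<theta> z b * \<theta> z c"
    and chi_orth: "b \<in> carrier G \<Longrightarrow> b \<noteq> \<one> \<Longrightarrow> (\<Sum>z\<in>carrier G. \<theta> z b) = 0"
    and V: "subgroup V G"
begin

text \<open>The normalised indicator of \<open>V\<close> after the phase \<open>z\<close> and then
  the shift \<open>x\<close>; hence the phase is evaluated at the label before the shift,
  \<open>b \<otimes> inv x\<close>.\<close>

definition psi :: "'b \<Rightarrow> 'b \<Rightarrow> 'b \<Rightarrow> complex" where
  "psi x z b = (if b \<otimes> inv x \<in> V then \<theta> z (b \<otimes> inv x) / sqrt (card V) else 0)"

text \<open>All |G|^2 translates are unit vectors in a space of dimension |G|, which explains the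
  factor 1 / |G|. \<open>D\<close> assigns a classical result to each translate, and translates with
  equal results share an outcome.\<close>

definition meas :: "('b \<Rightarrow> 'b \<Rightarrow> nat) \<Rightarrow> nat \<Rightarrow> 'b qop" where
  "meas D y = (\<lambda>u v. \<Sum>(x, z) | x \<in> carrier G \<and> z \<in> carrier G \<and> D x z = y.
     pure_state (psi x z) u v / card (carrier G))"

lemma V_sub: "c \<in> V \<Longrightarrow> c \<in> carrier G"
  using V by (rule subgroup.mem_carrier)

lemma finV: "finite V"
  using fin V_sub by (meson finite_subset subsetI)

lemma card_V_pos: "card V > 0"
  using finV subgroup.one_closed[OF V] by (auto simp: card_gt_0_iff)

lemma sqrt_card_V: "complex_of_real (sqrt (card V)) * complex_of_real (sqrt (card V)) = card V"
  by (simp flip: of_real_mult)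

lemma card_G_pos: "card (carrier G) > 0"
  using fin by (auto simp: card_gt_0_iff)

lemma chi_cnj: "z \<in> carrier G \<Longrightarrow> b \<in> carrier G \<Longrightarrow> \<theta> z b * cnj (\<theta> z b) = 1"
  by (metis complex_norm_square norm_chi of_real_1 one_power2)

lemma chi_nonzero: "z \<in> carrier G \<Longrightarrow> b \<in> carrier G \<Longrightarrow> \<theta> z b \<noteq> 0"
  using norm_chi by fastforce

lemma chi_one: "z \<in> carrier G \<Longrightarrow> \<theta> z \<one> = 1"
  using chi_mult[of z \<one> \<one>] chi_nonzero[of z \<one>] by simp

lemma chi_inv: "z \<in> carrier G \<Longrightarrow> b \<in> carrier G \<Longrightarrow> \<theta> z (inv b) = cnj (\<theta> z b)"
  using chi_mult[of z b "inv b"] chi_one[of z] chi_cnj[of z b] chi_nonzero[of z b]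
  by (metis inv_closed mult_left_cancel r_inv)

lemma diff_in_V_iff: "b \<in> carrier G \<Longrightarrow> x \<in> carrier G \<Longrightarrow>
    b \<otimes> inv x \<in> V \<longleftrightarrow> x \<in> (\<lambda>c. b \<otimes> inv c) ` V"
proof (intro iffI)
  assume b: "b \<in> carrier G" "x \<in> carrier G" and c: "b \<otimes> inv x \<in> V"
  have "x = b \<otimes> inv (b \<otimes> inv x)"
    using b by (simp add: inv_mult m_assoc[symmetric])
  then show "x \<in> (\<lambda>c. b \<otimes> inv c) ` V" using c by blast
next
  assume b: "b \<in> carrier G" "x \<in> carrier G" and "x \<in> (\<lambda>c. b \<otimes> inv c) ` V"
  then obtain c where "c \<in> V" "x = b \<otimes> inv c" by auto
  then show "b \<otimes> inv x \<in> V" using b V_sub[of c]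
    by (simp add: inv_mult m_assoc[symmetric])
qed

lemma card_diff_in_V:
  assumes b: "b \<in> carrier G"
  shows "card {x \<in> carrier G. b \<otimes> inv x \<in> V} = card V"
proof -
  have "{x \<in> carrier G. b \<otimes> inv x \<in> V} = (\<lambda>c. b \<otimes> inv c) ` V"
    using b diff_in_V_iff[OF b] V_sub by auto
  moreover have "inj_on (\<lambda>c. b \<otimes> inv c) V"
    using b V_sub by (intro inj_onI) (metis inv_closed inv_inv Units_eq Units_l_cancel)
  ultimately show ?thesis by (simp add: card_image)
qed

text \<open>When both differences lie in \<open>V\<close>, the sum over \<open>z\<close> is, up to 1
  / |V|, the sum of \<open>\<theta> z (u \<otimes> inv v)\<close>, which orthogonality kills off the
  diagonal. On the diagonal exactly |V| shifts contribute, each of them |G| / |V|.\<close>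

lemma psi_resolution:
  assumes u: "u \<in> carrier G" and v: "v \<in> carrier G"
  shows "(\<Sum>x\<in>carrier G. \<Sum>z\<in>carrier G. pure_state (psi x z) u v)
    = (if u = v then card (carrier G) else 0)"
proof -
  have inner: "(\<Sum>z\<in>carrier G. pure_state (psi x z) u v)
     = (if u = v \<and> u \<otimes> inv x \<in> V then card (carrier G) / card V else 0)"
    if x: "x \<in> carrier G" for x
  proof (cases "u \<otimes> inv x \<in> V \<and> v \<otimes> inv x \<in> V")
    case True
    have eq: "(u \<otimes> inv x) \<otimes> inv (v \<otimes> inv x) = u \<otimes> inv v"
      using u v x by (simp add: diff_diff_cancel)
    have "pure_state (psi x z) u v = \<theta> z (u \<otimes> inv v) / card V" if z: "z \<in> carrier G" for z
    proof -
      have "pure_state (psi x z) u v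
          = \<theta> z (u \<otimes> inv x) * cnj (\<theta> z (v \<otimes> inv x)) / (sqrt (card V) * sqrt (card V))"
        using True by (simp add: pure_state_def psi_def sqrt_card_V)
      also have "\<dots> = \<theta> z (u \<otimes> inv x) * cnj (\<theta> z (v \<otimes> inv x)) / card V"
        by simp
      also have "\<theta> z (u \<otimes> inv x) * cnj (\<theta> z (v \<otimes> inv x)) = \<theta> z (u \<otimes> inv v)"
        using z u v x by (simp add: chi_inv[symmetric] chi_mult[symmetric] eq)
      finally show ?thesis .
    qed
    then have "(\<Sum>z\<in>carrier G. pure_state (psi x z) u v) = (\<Sum>z\<in>carrier G. \<theta> z (u \<otimes> inv v)) / card V"
      by (simp add: sum_divide_distrib)
    moreover have "u \<otimes> inv v = \<one> \<longleftrightarrow> u = v"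
      using u v by (metis inv_closed inv_equality inv_inv r_inv)
    ultimately show ?thesis
      using True chi_orth[of "u \<otimes> inv v"] u v by (auto simp: chi_one)
  qed (auto simp: pure_state_def psi_def)
  show ?thesis
  proof (cases "u = v")
    case True
    have "(\<Sum>x\<in>carrier G. \<Sum>z\<in>carrier G. pure_state (psi x z) u v)
      = (\<Sum>x\<in>{x\<in>carrier G. u \<otimes> inv x \<in> V}. complex_of_real (card (carrier G) / card V))"
      using fin True inner by (intro sum.mono_neutral_cong_right) auto
    then show ?thesis
      using True card_V_pos by (simp add: card_diff_in_V[OF v])
  next
    case False
    then show ?thesis using inner by simp
  qed
qed

lemma psi_norm:
  assumes "x \<in> carrier G" "z \<in> carrier G"
  shows "qtrace (carrier G) (pure_state (psi x z)) = 1"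
proof -
  \<comment> \<open>The difference is reversed because \<open>card_diff_in_V\<close> counts the
    element that is subtracted.\<close>
  have *: "b \<otimes> inv x \<in> V \<longleftrightarrow> x \<otimes> inv b \<in> V" if "b \<in> carrier G" for b
    using subgroup.m_inv_closed[OF V, of "b \<otimes> inv x"] subgroup.m_inv_closed[OF V, of "x \<otimes> inv b"] assms that
    by (auto simp: inv_mult m_comm)
  have "pure_state (psi x z) b b = (if x \<otimes> inv b \<in> V then 1 / card V else 0)" if "b \<in> carrier G" for b
  proof (cases "x \<otimes> inv b \<in> V")
    case True
    then have "pure_state (psi x z) b b
          = \<theta> z (b \<otimes> inv x) * cnj (\<theta> z (b \<otimes> inv x)) / (sqrt (card V) * sqrt (card V))"
      using *[OF that] by (simp add: pure_state_def psi_def sqrt_card_V)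
    also have "\<dots> = 1 / card V"
      using assms that by (simp add: chi_cnj)
    finally show ?thesis using True by simp
  qed (use * that in \<open>auto simp: pure_state_def psi_def\<close>)
  then have "qtrace (carrier G) (pure_state (psi x z))
    = (\<Sum>b\<in>{b\<in>carrier G. x \<otimes> inv b \<in> V}. complex_of_real (1 / card V))"
    unfolding qtrace_def using fin by (intro sum.mono_neutral_cong_right) auto
  then show ?thesis
    using card_V_pos assms by (simp add: card_diff_in_V)
qed

text \<open>Translating the summation variable of the inner product by \<open>c \<in> V\<close> multiplies it by
  \<open>cnj (\<theta> z c) * \<theta> z' c\<close>.\<close>

lemma psi_overlap:
  assumes x: "x \<in> carrier G" "z \<in> carrier G" "x' \<in> carrier G" "z' \<in> carrier G"
    and ne: "(\<Sum>b\<in>carrier G. cnj (psi x z b) * psi x' z' b) \<noteq> 0"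
  shows "x \<otimes> inv x' \<in> V" and "c \<in> V \<Longrightarrow> \<theta> z c = \<theta> z' c"
proof -
  obtain b where b: "b \<in> carrier G" "cnj (psi x z b) * psi x' z' b \<noteq> 0"
    using ne by (rule sum.not_neutral_contains_not_neutral)
  then have V2: "b \<otimes> inv x \<in> V" "b \<otimes> inv x' \<in> V"
    by (auto simp: psi_def split: if_splits)
  have "(b \<otimes> inv x') \<otimes> inv (b \<otimes> inv x) = x \<otimes> inv x'"
    using b x diff_diff_cancel[of "inv x'" "inv x" "inv b"] by (simp add: m_comm)
  then show "x \<otimes> inv x' \<in> V"
    using V2 subgroup.m_closed[OF V] subgroup.m_inv_closed[OF V] by metis
  assume c: "c \<in> V"
  then have cG: "c \<in> carrier G" by (rule V_sub)
  have shift: "psi y w (b \<otimes> c) = \<theta> w c * psi y w b"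
    if "y \<in> carrier G" "w \<in> carrier G" "b \<in> carrier G" for y w b
  proof -
    have eq: "(b \<otimes> c) \<otimes> inv y = (b \<otimes> inv y) \<otimes> c"
      using that cG by (simp add: m_ac)
    have eq': "b \<otimes> inv y = ((b \<otimes> inv y) \<otimes> c) \<otimes> inv c"
      using that cG by (simp add: m_assoc)
    have "(b \<otimes> inv y) \<otimes> c \<in> V \<longleftrightarrow> b \<otimes> inv y \<in> V"
      using c eq' subgroup.m_closed[OF V] subgroup.m_inv_closed[OF V] by metis
    then show ?thesis
      using that cG by (simp add: psi_def eq chi_mult)
  qed
  let ?S = "\<Sum>b\<in>carrier G. cnj (psi x z b) * psi x' z' b"
  have "?S = (\<Sum>b\<in>carrier G. cnj (psi x z (b \<otimes> c)) * psi x' z' (b \<otimes> c))"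
  proof (rule sum.reindex_bij_betw[symmetric])
    show "bij_betw (\<lambda>b. b \<otimes> c) (carrier G) (carrier G)"
      using cG by (intro bij_betw_byWitness[where f' = "\<lambda>b. b \<otimes> inv c"]) (auto simp: m_assoc)
  qed
  also have "\<dots> = (cnj (\<theta> z c) * \<theta> z' c) * ?S"
    using x by (simp add: shift sum_distrib_left mult_ac)
  finally have "cnj (\<theta> z c) * \<theta> z' c = 1"
    using ne by simp
  then show "\<theta> z c = \<theta> z' c"
    using chi_cnj[OF x(2) cG] by (metis mult.commute mult_left_cancel mult_zero_left zero_neq_one)
qed

lemma density_operator_psi:
  "x \<in> carrier G \<Longrightarrow> z \<in> carrier G \<Longrightarrow> density_operator (carrier G) (pure_state (psi x z))"
  by (simp add: density_operator_def qpos_pure_state psi_norm)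

text \<open>The fibres of \<open>D\<close> over the outcomes below \<open>m\<close> partition all
  pairs (x, z), so completeness is \<open>psi_resolution\<close> regrouped; positivity is that of a
  sum of rank-one projectors.\<close>

lemma measurement_meas:
  assumes "\<And>x z. x \<in> carrier G \<Longrightarrow> z \<in> carrier G \<Longrightarrow> D x z < m"
  shows "measurement (carrier G) m (meas D)"
  unfolding measurement_def
proof (intro conjI allI impI)
  fix y
  show "qpos (carrier G) (meas D y)"
    unfolding qpos_def
  proof
    fix v
    let ?I = "{(x, z). x \<in> carrier G \<and> z \<in> carrier G \<and> D x z = y}"
    have "(\<Sum>u\<in>carrier G. \<Sum>w\<in>carrier G. cnj (v u) * meas D y u w * v w)
      = (\<Sum>i\<in>?I. (\<Sum>u\<in>carrier G. \<Sum>w\<in>carrier G.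
            cnj (v u) * pure_state (psi (fst i) (snd i)) u w * v w) / card (carrier G))"
      unfolding meas_def sum_distrib_left sum_distrib_right sum_divide_distrib
      by (subst sum_rotate) (simp add: case_prod_unfold)
    also have "\<dots> \<in> \<real>\<^sub>\<ge>\<^sub>0"
      unfolding pure_state_quadratic_form
      by (intro sum_nonneg_Reals nonneg_Reals_divide_I complex_mult_cnj_nonneg) simp
    finally show "(\<Sum>u\<in>carrier G. \<Sum>w\<in>carrier G. cnj (v u) * meas D y u w * v w) \<in> \<real>\<^sub>\<ge>\<^sub>0" .
  qed
next
  show "qid_on (carrier G) (\<lambda>u v. \<Sum>y<m. meas D y u v)"
    unfolding qid_on_def
  proof (intro ballI)
    fix u v assume uv: "u \<in> carrier G" "v \<in> carrier G"
    have "(\<Sum>y<m. meas D y u v)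
      = (\<Sum>y<m. \<Sum>i | i \<in> carrier G \<times> carrier G \<and> case_prod D i = y.
          pure_state (psi (fst i) (snd i)) u v / card (carrier G))"
      unfolding meas_def by (intro sum.cong) auto
    also have "\<dots> = (\<Sum>i\<in>carrier G \<times> carrier G. pure_state (psi (fst i) (snd i)) u v / card (carrier G))"
      using fin assms by (intro sum.group) auto
    also have "\<dots> = (\<Sum>x\<in>carrier G. \<Sum>z\<in>carrier G. pure_state (psi x z) u v) / card (carrier G)"
      by (simp add: sum.cartesian_product sum_divide_distrib case_prod_unfold)
    also have "\<dots> = (if u = v then 1 else 0)"
      using psi_resolution[OF uv] card_G_pos by auto
    finally show "(\<Sum>y<m. meas D y u v) = (if u = v then 1 else 0)" .
  qed
qed

text \<open>A translate that overlaps the state has the same shift modulo \<open>V\<close> and the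
  same phases on \<open>V\<close>, so \<open>inv\<close> gives it the same label. All other outcomes
  therefore have probability 0, and completeness leaves 1 for the right one without any evaluation
  of its overlaps.\<close>

lemma born_meas:
  assumes D: "\<And>x z. x \<in> carrier G \<Longrightarrow> z \<in> carrier G \<Longrightarrow> D x z < m"
    and inv: "\<And>x z x' z'. x \<in> carrier G \<Longrightarrow> z \<in> carrier G \<Longrightarrow> x' \<in> carrier G \<Longrightarrow> z' \<in> carrier G \<Longrightarrow>
      x \<otimes> inv x' \<in> V \<Longrightarrow> (\<And>c. c \<in> V \<Longrightarrow> \<theta> z c = \<theta> z' c) \<Longrightarrow> D x z = D x' z'"
    and x: "x' \<in> carrier G" "z' \<in> carrier G" and "y < m"
  shows "born (carrier G) (meas D y) (pure_state (psi x' z')) = (if y = D x' z' then 1 else 0)"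
proof -
  let ?\<rho> = "pure_state (psi x' z')"
  have expand: "qtrace (carrier G) (qmult (carrier G) (meas D y) ?\<rho>)
     = (\<Sum>(x, z) | x \<in> carrier G \<and> z \<in> carrier G \<and> D x z = y.
          qtrace (carrier G) (qmult (carrier G) (pure_state (psi x z)) ?\<rho>) / card (carrier G))"
    (is "_ = (\<Sum>(x, z)\<in>?I. _)") for y
    unfolding qtrace_def qmult_def meas_def sum_distrib_right sum_divide_distrib case_prod_unfold
    by (subst sum_rotate) simp
  have zero: "born (carrier G) (meas D y) ?\<rho> = 0" if "y \<noteq> D x' z'" for y
    unfolding born_def expand
  proof (subst sum.neutral, intro ballI, clarify)
    fix x z assume xz: "x \<in> carrier G" "z \<in> carrier G" "y = D x z"
    have "(\<Sum>b\<in>carrier G. cnj (psi x z b) * psi x' z' b) = 0"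
    proof (rule ccontr)
      assume "\<not> ?thesis"
      then show False
        using inv[OF xz(1,2) x] psi_overlap[OF xz(1,2) x] xz that by blast
    qed
    then show "qtrace (carrier G) (qmult (carrier G) (pure_state (psi x z)) ?\<rho>) / card (carrier G) = 0"
      by (simp add: born_pure_states)
  qed simp
  have "(\<Sum>y<m. born (carrier G) (meas D y) ?\<rho>)
    = Re (\<Sum>u\<in>carrier G. \<Sum>w\<in>carrier G. (\<Sum>y<m. meas D y u w) * ?\<rho> w u)"
    unfolding born_def qtrace_def qmult_def sum_distrib_right Re_sum
    by (subst sum_rotate) simp
  also have "\<dots> = Re (\<Sum>u\<in>carrier G. \<Sum>w\<in>carrier G. (if u = w then 1 else 0) * ?\<rho> w u)"
    using measurement_meas[of D m, OF D] unfolding measurement_def qid_on_def by simp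
  also have "\<dots> = Re (qtrace (carrier G) ?\<rho>)"
    using fin by (simp add: qtrace_def if_distrib[of "\<lambda>a. a * _"] cong: if_cong)
  finally have "(\<Sum>y<m. born (carrier G) (meas D y) ?\<rho>) = 1"
    using psi_norm[OF x] by simp
  moreover have "(\<Sum>y<m. born (carrier G) (meas D y) ?\<rho>) = born (carrier G) (meas D (D x' z')) ?\<rho>"
    using D[OF x] zero by (subst sum.remove[of _ "D x' z'"]) auto
  ultimately show ?thesis using zero by auto
qed

end

section \<open>Generic evaluation points\<close>

lemma (in abelian_monoid) finsum_swap:
  assumes "finite A" "finite B" "\<And>i j. i \<in> A \<Longrightarrow> j \<in> B \<Longrightarrow> f i j \<in> carrier G"
  shows "(\<Oplus>i\<in>A. \<Oplus>j\<in>B. f i j) = (\<Oplus>j\<in>B. \<Oplus>i\<in>A. f i j)"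
  using assms(1,3)
proof (induction A)
  case empty
  then show ?case by (simp add: finsum_zero)
next
  case (insert a A)
  then have "(\<Oplus>i\<in>insert a A. \<Oplus>j\<in>B. f i j) = (\<Oplus>j\<in>B. f a j) \<oplus> (\<Oplus>j\<in>B. \<Oplus>i\<in>A. f i j)"
    by (subst finsum_insert) (auto intro!: finsum_closed)
  also have "\<dots> = (\<Oplus>j\<in>B. f a j \<oplus> (\<Oplus>i\<in>A. f i j))"
    using insert.prems by (intro finsum_addf[symmetric]) (auto intro!: finsum_closed)
  also have "\<dots> = (\<Oplus>j\<in>B. \<Oplus>i\<in>insert a A. f i j)"
    using insert by (intro finsum_cong') (auto intro!: finsum_closed)
  finally show ?case .
qed

lemma (in abelian_monoid) finsum_fibres:
  assumes "finite A" "finite B" "\<And>i. i \<in> A \<Longrightarrow> f i \<in> carrier G" "\<And>i. i \<in> A \<Longrightarrow> g i \<in> B"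
  shows "(\<Oplus>i\<in>A. f i) = (\<Oplus>e\<in>B. \<Oplus>i\<in>{i\<in>A. g i = e}. f i)"
proof -
  have "(\<Oplus>i\<in>A. f i) = finsum G f (\<Union>e\<in>B. {i\<in>A. g i = e})"
    using assms(4) by (intro arg_cong[where f = "finsum G f"]) auto
  also have "\<dots> = (\<Oplus>e\<in>B. \<Oplus>i\<in>{i\<in>A. g i = e}. f i)"
    using assms by (intro add.finprod_UN_disjoint) (auto simp: pairwise_def disjnt_def)
  finally show ?thesis .
qed

context cring
begin

lemma add_minus_distrib:
  assumes "a \<in> carrier R" "b \<in> carrier R" "b' \<in> carrier R" "p \<in> carrier R" "p' \<in> carrier R"
  shows "a \<otimes> (b \<ominus> b') \<oplus> (p \<ominus> p') = (a \<otimes> b \<oplus> p) \<ominus> (a \<otimes> b' \<oplus> p')"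
  using assms by (simp add: minus_eq r_distr r_minus minus_add a_ac)

lemma matrix_apply_minus:
  assumes "finite E" "\<And>e. e \<in> E \<Longrightarrow> m e \<in> carrier R" "c \<in> E \<rightarrow> carrier R" "c' \<in> E \<rightarrow> carrier R"
  shows "(\<Oplus>e\<in>E. m e \<otimes> (c e \<ominus> c' e)) = (\<Oplus>e\<in>E. m e \<otimes> c e) \<ominus> (\<Oplus>e\<in>E. m e \<otimes> c' e)"
  using assms
proof (induction E)
  case empty
  then show ?case by (simp add: minus_eq)
next
  case (insert e E)
  have cl: "(\<Oplus>e\<in>E. m e \<otimes> c e) \<in> carrier R" "(\<Oplus>e\<in>E. m e \<otimes> c' e) \<in> carrier R"
    "m e \<in> carrier R" "c e \<in> carrier R" "c' e \<in> carrier R"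
    using insert by (auto intro!: finsum_closed)
  have "(\<Oplus>e\<in>insert e E. m e \<otimes> (c e \<ominus> c' e))
      = m e \<otimes> (c e \<ominus> c' e) \<oplus> ((\<Oplus>e\<in>E. m e \<otimes> c e) \<ominus> (\<Oplus>e\<in>E. m e \<otimes> c' e))"
    using insert by (subst finsum_insert) (auto simp: Pi_def)
  also have "\<dots> = (m e \<otimes> c e \<oplus> (\<Oplus>e\<in>E. m e \<otimes> c e)) \<ominus> (m e \<otimes> c' e \<oplus> (\<Oplus>e\<in>E. m e \<otimes> c' e))"
    using cl by (intro add_minus_distrib)
  also have "\<dots> = (\<Oplus>e\<in>insert e E. m e \<otimes> c e) \<ominus> (\<Oplus>e\<in>insert e E. m e \<otimes> c' e)"
    using insert by (simp add: finsum_insert Pi_def)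
  finally show ?case .
qed

text \<open>Counting replaces determinants: a trivial kernel makes the map injective, and an
  injective map between finite sets of equal size is onto.\<close>

lemma square_matrix_surj:
  assumes fin: "finite (carrier R)" "finite I" "finite E" and card: "card I = card E"
    and m: "\<And>i e. i \<in> I \<Longrightarrow> e \<in> E \<Longrightarrow> m i e \<in> carrier R"
    and ker: "\<And>c. c \<in> E \<rightarrow> carrier R \<Longrightarrow> (\<And>i. i \<in> I \<Longrightarrow> (\<Oplus>e\<in>E. m i e \<otimes> c e) = \<zero>) \<Longrightarrow>
      (\<And>e. e \<in> E \<Longrightarrow> c e = \<zero>)"
    and y: "y \<in> I \<rightarrow> carrier R"
  obtains c where "c \<in> E \<rightarrow> carrier R" "\<And>i. i \<in> I \<Longrightarrow> (\<Oplus>e\<in>E. m i e \<otimes> c e) = y i"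
proof -
  define \<Phi> where "\<Phi> c = (\<lambda>i\<in>I. \<Oplus>e\<in>E. m i e \<otimes> c e)" for c
  let ?X = "E \<rightarrow>\<^sub>E carrier R" and ?Y = "I \<rightarrow>\<^sub>E carrier R"
  have maps: "\<Phi> ` ?X \<subseteq> ?Y"
    using m by (auto simp: \<Phi>_def PiE_def Pi_def intro!: finsum_closed)
  have inj: "inj_on \<Phi> ?X"
  proof (rule inj_onI)
    fix c c' assume c: "c \<in> ?X" "c' \<in> ?X" "\<Phi> c = \<Phi> c'"
    have cl: "c e \<in> carrier R" "c' e \<in> carrier R" if "e \<in> E" for e
      using c that by auto
    have "(\<Oplus>e\<in>E. m i e \<otimes> (c e \<ominus> c' e)) = \<zero>" if i: "i \<in> I" for i
    proof -
      have "(\<Oplus>e\<in>E. m i e \<otimes> c e) = (\<Oplus>e\<in>E. m i e \<otimes> c' e)"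
        using fun_cong[OF c(3), of i] i by (simp add: \<Phi>_def)
      moreover have "(\<Oplus>e\<in>E. m i e \<otimes> c' e) \<in> carrier R"
        using m i cl by (auto intro!: finsum_closed)
      ultimately show ?thesis
        using m i cl fin by (subst matrix_apply_minus) auto
    qed
    then have "c e \<ominus> c' e = \<zero>" if "e \<in> E" for e
      using that cl by (intro ker[of "\<lambda>e. c e \<ominus> c' e"]) auto
    then have "c e = c' e" if "e \<in> E" for e
      using that cl by simp
    then show "c = c'"
      using c by (intro PiE_ext) auto
  qed
  have "card (\<Phi> ` ?X) = card ?Y"
    using inj fin card by (simp add: card_image card_PiE)
  then have "\<Phi> ` ?X = ?Y"
    using maps fin by (intro card_subset_eq finite_PiE) auto
  moreover have "restrict y I \<in> ?Y" using y by auto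
  ultimately have "restrict y I \<in> \<Phi> ` ?X" by simp
  then obtain c where c: "c \<in> ?X" "\<Phi> c = restrict y I" by (elim imageE) simp
  show thesis
  proof
    show "c \<in> E \<rightarrow> carrier R" using c by auto
    show "(\<Oplus>e\<in>E. m i e \<otimes> c e) = y i" if "i \<in> I" for i
      using fun_cong[OF c(2), of i] that by (simp add: \<Phi>_def)
  qed
qed

text \<open>The bilinear form of \<open>m\<close>, evaluated in both orders; it moves the matrix
  from \<open>c\<close> to \<open>d\<close>.\<close>

lemma matrix_swap:
  assumes "finite I" "finite E" "\<And>i e. i \<in> I \<Longrightarrow> e \<in> E \<Longrightarrow> m i e \<in> carrier R"
    "d \<in> I \<rightarrow> carrier R" "c \<in> E \<rightarrow> carrier R"
  shows "(\<Oplus>i\<in>I. d i \<otimes> (\<Oplus>e\<in>E. m i e \<otimes> c e)) = (\<Oplus>e\<in>E. c e \<otimes> (\<Oplus>i\<in>I. m i e \<otimes> d i))"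
proof -
  have cl: "\<And>i. i \<in> I \<Longrightarrow> d i \<in> carrier R" "\<And>e. e \<in> E \<Longrightarrow> c e \<in> carrier R"
    using assms by auto
  have "(\<Oplus>i\<in>I. d i \<otimes> (\<Oplus>e\<in>E. m i e \<otimes> c e)) = (\<Oplus>i\<in>I. \<Oplus>e\<in>E. d i \<otimes> (m i e \<otimes> c e))"
    using assms(1,2,3) cl by (intro finsum_cong' finsum_rdistr) (auto intro!: finsum_closed)
  also have "\<dots> = (\<Oplus>e\<in>E. \<Oplus>i\<in>I. d i \<otimes> (m i e \<otimes> c e))"
    using assms(1,2,3) cl by (intro finsum_swap) auto
  also have "\<dots> = (\<Oplus>e\<in>E. \<Oplus>i\<in>I. c e \<otimes> (m i e \<otimes> d i))"
    using assms(3) cl by (intro finsum_cong') (auto intro!: finsum_closed simp: m_ac)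
  also have "\<dots> = (\<Oplus>e\<in>E. c e \<otimes> (\<Oplus>i\<in>I. m i e \<otimes> d i))"
    using assms(1,2,3) cl by (intro finsum_cong' finsum_rdistr[symmetric]) (auto intro!: finsum_closed)
  finally show ?thesis .
qed

text \<open>\<open>d\<close> is paired with a preimage \<open>c\<close> of the unit vector at
  \<open>j\<close>. By \<open>matrix_swap\<close> the value \<open>d j\<close> equals a sum in which
  every term contains a vanishing coordinate of the transposed product.\<close>

lemma square_matrix_transpose_kernel:
  assumes fin: "finite (carrier R)" "finite I" "finite E" and card: "card I = card E"
    and m: "\<And>i e. i \<in> I \<Longrightarrow> e \<in> E \<Longrightarrow> m i e \<in> carrier R"
    and ker: "\<And>c. c \<in> E \<rightarrow> carrier R \<Longrightarrow> (\<And>i. i \<in> I \<Longrightarrow> (\<Oplus>e\<in>E. m i e \<otimes> c e) = \<zero>) \<Longrightarrow>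
      (\<And>e. e \<in> E \<Longrightarrow> c e = \<zero>)"
    and d: "d \<in> I \<rightarrow> carrier R" "\<And>e. e \<in> E \<Longrightarrow> (\<Oplus>i\<in>I. m i e \<otimes> d i) = \<zero>"
    and j: "j \<in> I"
  shows "d j = \<zero>"
proof -
  have cl: "d i \<in> carrier R" if "i \<in> I" for i using that d by auto
  obtain c where c: "c \<in> E \<rightarrow> carrier R"
      and eq: "\<And>i. i \<in> I \<Longrightarrow> (\<Oplus>e\<in>E. m i e \<otimes> c e) = (if i = j then \<one> else \<zero>)"
    by (rule square_matrix_surj[of I E m "\<lambda>i. if i = j then \<one> else \<zero>"])
      (use fin card m ker in auto)
  have "d j = (\<Oplus>i\<in>I. if i = j then d i else \<zero>)"
    using j fin cl by (subst add.finprod_singleton_swap) auto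
  also have "\<dots> = (\<Oplus>i\<in>I. d i \<otimes> (\<Oplus>e\<in>E. m i e \<otimes> c e))"
    using cl by (intro finsum_cong') (auto simp: eq)
  also have "\<dots> = (\<Oplus>e\<in>E. c e \<otimes> (\<Oplus>i\<in>I. m i e \<otimes> d i))"
    using fin m d(1) c by (intro matrix_swap) auto
  also have "\<dots> = (\<Oplus>e\<in>E. \<zero>)"
    using c d by (intro finsum_cong') (auto simp: Pi_def)
  finally show ?thesis by (simp add: finsum_zero)
qed

end

section \<open>Sparse polynomials and the greedy choice of points\<close>

context domain
begin

text \<open>Padding the coefficients with zeros outside \<open>E\<close> gives a nonzero univariate
  polynomial of degree at most \<open>D\<close>, to which the usual bound on roots applies.\<close>

lemma card_sparse_poly_roots:
  fixes E :: "nat set"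
  assumes fin: "finite (carrier R)" and E: "E \<subseteq> {..D}" and c: "c \<in> E \<rightarrow> carrier R"
    and ne: "e \<in> E" "c e \<noteq> \<zero>"
  shows "card {a \<in> carrier R. (\<Oplus>e\<in>E. a [^] e \<otimes> c e) = \<zero>} \<le> D"
proof -
  interpret P: UP_domain R "UP R" by unfold_locales
  define f where "f i = (if i \<in> E then c i else \<zero>)" for i
  have f: "f \<in> carrier (UP R)"
    using c E by (auto simp: UP_def up_def bound_def f_def intro!: exI[of _ D])
  have coeff: "coeff (UP R) f i = f i" for i
    using f by (simp add: UP_def)
  have deg: "deg R f \<le> D"
    using f E by (intro P.deg_aboveI) (auto simp: coeff f_def)
  have "f \<noteq> \<zero>\<^bsub>UP R\<^esub>"
    using ne P.coeff_zero[of e] coeff[of e] by (auto simp: f_def)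
  then have bd: "card {a \<in> carrier R. eval R R id a f = \<zero>} \<le> deg R f"
    using P.roots_bound[OF f _ fin] by blast
  have "eval R R id a f = (\<Oplus>e\<in>E. a [^] e \<otimes> c e)" if a: "a \<in> carrier R" for a
  proof -
    have finE: "finite E" using E finite_subset by blast
    have fc: "f i \<in> carrier R" for i using c by (auto simp: f_def)
    have "eval R R id a f = (\<Oplus>i\<in>{..deg R f}. f i \<otimes> a [^] i)"
      using P.eval_on_carrier[OF f, of R id a] by (simp add: coeff)
    also have "\<dots> = (\<Oplus>i\<in>{..D}. f i \<otimes> a [^] i)"
      using deg fc a P.deg_aboveD[OF _ f] by (intro add.finprod_mono_neutral_cong_left) (auto simp: coeff)
    also have "\<dots> = (\<Oplus>i\<in>E. a [^] i \<otimes> c i)"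
      using E fc a c by (intro add.finprod_mono_neutral_cong_right) (auto simp: f_def m_comm Pi_def)
    finally show ?thesis .
  qed
  then have "{a \<in> carrier R. eval R R id a f = \<zero>} = {a \<in> carrier R. (\<Oplus>e\<in>E. a [^] e \<otimes> c e) = \<zero>}"
    by auto
  with bd show ?thesis using deg by simp
qed

end

context field
begin

text \<open>\<open>E\<close> may have gaps because the exponents of the code do. \<open>S\<close>
  may be a proper subset because colluding servers, duality and the induction on \<open>n\<close>
  involve only some of the points.\<close>

definition generic_points :: "(nat \<Rightarrow> 'a) \<Rightarrow> nat \<Rightarrow> nat \<Rightarrow> bool" where
  "generic_points x n D \<longleftrightarrow> x \<in> {..<n} \<rightarrow> carrier R \<and>
    (\<forall>S E c e. S \<subseteq> {..<n} \<and> E \<subseteq> {..D} \<and> card S = card E \<and> c \<in> E \<rightarrow> carrier R \<and>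
      (\<forall>i\<in>S. (\<Oplus>e\<in>E. x i [^] e \<otimes> c e) = \<zero>) \<and> e \<in> E \<longrightarrow> c e = \<zero>)"

lemma generic_pointsD:
  assumes "generic_points x n D" "S \<subseteq> {..<n}" "E \<subseteq> {..D}" "card S = card E" "c \<in> E \<rightarrow> carrier R"
    and "\<And>i. i \<in> S \<Longrightarrow> (\<Oplus>e\<in>E. x i [^] e \<otimes> c e) = \<zero>" "e \<in> E"
  shows "c e = \<zero>"
proof -
  have "S \<subseteq> {..<n} \<and> E \<subseteq> {..D} \<and> card S = card E \<and> c \<in> E \<rightarrow> carrier R \<and>
      (\<forall>i\<in>S. (\<Oplus>e\<in>E. x i [^] e \<otimes> c e) = \<zero>) \<and> e \<in> E \<longrightarrow> c e = \<zero>"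
    using assms(1) unfolding generic_points_def by (elim conjE allE)
  moreover have "\<forall>i\<in>S. (\<Oplus>e\<in>E. x i [^] e \<otimes> c e) = \<zero>" using assms(6) ..
  ultimately show ?thesis using assms(2-5,7) by (elim mp) (intro conjI)
qed

text \<open>A kernel vector of the points \<open>S\<close> on one exponent more has no vanishing coordinate, by
  genericity of \<open>S\<close>; hence it is unique up to a scalar.\<close>

lemma generic_kernel_unique:
  assumes gen: "generic_points x n D" and S: "S \<subseteq> {..<n}" and E: "E \<subseteq> {..D}" "card E = Suc (card S)"
    and c: "c \<in> E \<rightarrow> carrier R" "\<And>i. i \<in> S \<Longrightarrow> (\<Oplus>e\<in>E. x i [^] e \<otimes> c e) = \<zero>"
    and c': "c' \<in> E \<rightarrow> carrier R" "\<And>i. i \<in> S \<Longrightarrow> (\<Oplus>e\<in>E. x i [^] e \<otimes> c' e) = \<zero>"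
    and ne: "e0 \<in> E" "c e0 \<noteq> \<zero>" and e: "e \<in> E"
  shows "c' e = c' e0 \<otimes> inv (c e0) \<otimes> c e"
proof -
  have finE: "finite E" using E finite_subset by blast
  have cl: "c e \<in> carrier R" "c' e \<in> carrier R" if "e \<in> E" for e using that c c' by auto
  have x: "x i \<in> carrier R" if "i \<in> S" for i
    using gen S that by (auto simp: generic_points_def)
  let ?a = "c' e0 \<otimes> inv (c e0)"
  have u: "c e0 \<in> Units R" using ne cl field_Units by auto
  have a: "?a \<in> carrier R" using u cl ne by auto
  \<comment> \<open>This combination of the two kernel vectors vanishes at \<open>e0\<close>. It
    lives on \<open>card S\<close> exponents, where genericity forces it to be zero.\<close>
  define b where "b e = c' e \<ominus> ?a \<otimes> c e" for e
  have b: "b \<in> E \<rightarrow> carrier R" using cl a by (auto simp: b_def)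
  have b0: "b e0 = \<zero>"
    using u cl ne by (simp add: b_def m_assoc)
  have "(\<Oplus>e\<in>E - {e0}. x i [^] e \<otimes> b e) = \<zero>" if i: "i \<in> S" for i
  proof -
    have "(\<Oplus>e\<in>E - {e0}. x i [^] e \<otimes> b e) = (\<Oplus>e\<in>E. x i [^] e \<otimes> b e)"
      using finE b b0 x[OF i] by (intro add.finprod_mono_neutral_cong_left) (auto simp: Pi_def)
    also have "\<dots> = (\<Oplus>e\<in>E. x i [^] e \<otimes> c' e) \<ominus> (\<Oplus>e\<in>E. x i [^] e \<otimes> (?a \<otimes> c e))"
      unfolding b_def using finE cl a x[OF i] by (intro matrix_apply_minus) auto
    also have "(\<Oplus>e\<in>E. x i [^] e \<otimes> (?a \<otimes> c e)) = (\<Oplus>e\<in>E. ?a \<otimes> (x i [^] e \<otimes> c e))"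
      using cl a x[OF i] by (intro finsum_cong') (auto simp: m_ac)
    also have "\<dots> = ?a \<otimes> (\<Oplus>e\<in>E. x i [^] e \<otimes> c e)"
      using cl a x[OF i] finE by (intro finsum_rdistr[symmetric]) auto
    finally show ?thesis using i a by (simp add: c(2) c'(2))
  qed
  then have "b e = \<zero>" if "e \<in> E - {e0}"
    using that E ne b finE by (intro generic_pointsD[OF gen S, of "E - {e0}" b e]) auto
  with b0 e have "b e = \<zero>" by blast
  then show ?thesis
    using cl a e unfolding b_def by simp
qed

text \<open>The new point has to avoid, for each pair (S, E) with a nontrivial kernel, the roots of
  one polynomial whose coefficients form a kernel vector. One vector is enough because the kernel is
  a line in the relevant case \<open>card E = Suc (card S)\<close>. There are at most
  \<open>2 ^ n * 2 ^ Suc D\<close> pairs with at most \<open>D\<close> roots each, whence the bound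
  on the field.\<close>

lemma generic_points_extend:
  assumes fin: "finite (carrier R)" and gen: "generic_points x n D"
    and q: "card (carrier R) > 2 ^ n * 2 ^ Suc D * D"
  obtains a where "generic_points (x(n := a)) (Suc n) D"
proof -
  define K :: "nat set \<times> nat set \<Rightarrow> (nat \<Rightarrow> 'a) set" where "K = (\<lambda>(S, E). {c \<in> E \<rightarrow> carrier R. (\<exists>e\<in>E. c e \<noteq> \<zero>) \<and>
    (\<forall>i\<in>S. (\<Oplus>e\<in>E. x i [^] e \<otimes> c e) = \<zero>)})"
  define k where "k p = (SOME c. c \<in> K p)" for p
  define I where "I = {(S, E). S \<subseteq> {..<n} \<and> E \<subseteq> {..D} \<and> K (S, E) \<noteq> {}}"
  define Z where "Z = (\<lambda>(S, E). {a \<in> carrier R. (\<Oplus>e\<in>E. a [^] e \<otimes> k (S, E) e) = \<zero>})"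
  have kK: "k p \<in> K p" if "K p \<noteq> {}" for p
    using that unfolding k_def by (metis someI_ex ex_in_conv)
  have I: "I \<subseteq> Pow {..<n} \<times> Pow {..D}" by (auto simp: I_def)
  then have finI: "finite I" by (rule finite_subset) simp
  have "card (Z p) \<le> D" if p: "p \<in> I" for p
  proof -
    obtain S E where SE: "p = (S, E)" "S \<subseteq> {..<n}" "E \<subseteq> {..D}" "K (S, E) \<noteq> {}" using p by (auto simp: I_def)
    then have "k (S, E) \<in> K (S, E)" using kK by blast
    then show ?thesis
      using card_sparse_poly_roots[OF fin SE(3), of "k (S, E)"] SE(1) by (auto simp: K_def Z_def)
  qed
  then have "card (\<Union>p\<in>I. Z p) \<le> (\<Sum>p\<in>I. D)"
    by (intro order_trans[OF card_UN_le sum_mono]) (auto simp: finI)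
  also have "\<dots> \<le> card (Pow {..<n} \<times> Pow {..D}) * D"
  proof -
    have "card I \<le> card (Pow {..<n} \<times> Pow {..D})"
      using I by (intro card_mono) auto
    then show ?thesis by (simp only: sum_constant of_nat_id mult_right_mono)
  qed
  also have "\<dots> = 2 ^ n * 2 ^ Suc D * D"
    by (simp add: card_cartesian_product card_Pow)
  also have "\<dots> < card (carrier R)" by (rule q)
  finally have "\<not> carrier R \<subseteq> (\<Union>p\<in>I. Z p)"
  proof (rule contrapos_pn)
    assume sub: "carrier R \<subseteq> (\<Union>p\<in>I. Z p)"
    have "(\<Union>p\<in>I. Z p) \<subseteq> carrier R" by (auto simp: Z_def)
    then have "finite (\<Union>p\<in>I. Z p)" using fin finite_subset by blast
    then show "\<not> card (\<Union>p\<in>I. Z p) < card (carrier R)"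
      using card_mono[OF _ sub] by simp
  qed
  then obtain a where "a \<in> carrier R" "a \<notin> (\<Union>p\<in>I. Z p)" by (meson subsetI)
  then have a: "a \<in> carrier R" "\<And>p. p \<in> I \<Longrightarrow> a \<notin> Z p" by simp_all
  show thesis
  proof (rule that[of a], unfold generic_points_def, intro conjI allI impI, goal_cases)
    case 1
    then show ?case using gen a by (auto simp: generic_points_def Pi_def)
  next
    case (2 S E c e)
    then have S: "S \<subseteq> {..<Suc n}" and E: "E \<subseteq> {..D}" "card S = card E" and c: "c \<in> E \<rightarrow> carrier R"
      and ker: "\<And>i. i \<in> S \<Longrightarrow> (\<Oplus>e\<in>E. (x(n := a)) i [^] e \<otimes> c e) = \<zero>" and e: "e \<in> E" by auto
    show ?case
    proof (cases "n \<in> S")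
      case False
      then have S': "S \<subseteq> {..<n}" using S by (auto simp: less_Suc_eq)
      have ker': "(\<Oplus>e\<in>E. x i [^] e \<otimes> c e) = \<zero>" if "i \<in> S" for i
      proof -
        have "i \<noteq> n" using that False by auto
        then show ?thesis using ker[OF that] unfolding fun_upd_other[OF \<open>i \<noteq> n\<close>] by simp
      qed
      show ?thesis
        by (rule generic_pointsD[OF gen S' E c ker' e])
    next
      case True
      show ?thesis
      proof (rule ccontr)
        assume ce: "c e \<noteq> \<zero>"
        let ?S = "S - {n}"
        have S': "?S \<subseteq> {..<n}" using S by (auto simp: less_Suc_eq)
        have finS: "finite S" using S finite_subset by blast
        have cS: "card E = Suc (card ?S)"
          using True finS E by (metis card_Suc_Diff1)
        have ker': "(\<Oplus>e\<in>E. x i [^] e \<otimes> c e) = \<zero>" if "i \<in> ?S" for i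
        proof -
          have "i \<noteq> n" "i \<in> S" using that by auto
          then show ?thesis using ker[of i] unfolding fun_upd_other[OF \<open>i \<noteq> n\<close>] by simp
        qed
        have "c \<in> K (?S, E)" unfolding K_def using c ce e ker' by blast
        then have SI: "(?S, E) \<in> I" using S' E unfolding I_def by blast
        then have "k (?S, E) \<in> K (?S, E)" using kK[of "(?S, E)"] unfolding I_def by blast
        then have k: "k (?S, E) \<in> E \<rightarrow> carrier R" "\<And>i. i \<in> ?S \<Longrightarrow> (\<Oplus>e\<in>E. x i [^] e \<otimes> k (?S, E) e) = \<zero>"
          unfolding K_def by blast+
        have finE: "finite E" using E finite_subset by blast
        have cE: "c e' \<in> carrier R" if "e' \<in> E" for e' using c that by auto
        \<comment> \<open>The factor of proportionality between \<open>c\<close> and the chosen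
          kernel vector, read off at the coordinate \<open>e\<close>, where \<open>c\<close> does
          not vanish.\<close>
        define t where "t = k (?S, E) e \<otimes> inv (c e)"
        have "c e \<in> Units R" using ce e cE field_Units by auto
        then have t: "t \<in> carrier R" using k e by (auto simp: t_def)
        have kt: "k (?S, E) e' = t \<otimes> c e'" if "e' \<in> E" for e'
          unfolding t_def by (rule generic_kernel_unique[OF gen S' E(1) cS c ker' k e ce that])
        \<comment> \<open>The row of the new point annihilates \<open>c\<close>, hence also the
          chosen vector; this makes \<open>a\<close> one of the roots that it was chosen to
          avoid.\<close>
        have "(\<Oplus>e\<in>E. a [^] e \<otimes> k (?S, E) e) = (\<Oplus>e'\<in>E. t \<otimes> (a [^] e' \<otimes> c e'))"
          using a(1) t cE by (intro finsum_cong') (auto simp: kt m_lcomm)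
        also have "\<dots> = t \<otimes> (\<Oplus>e'\<in>E. a [^] e' \<otimes> c e')"
          using a(1) t cE finE by (intro finsum_rdistr[symmetric]) auto
        also have "\<dots> = \<zero>"
          using ker[OF True] t by (simp only: fun_upd_same r_null)
        finally have "a \<in> Z (?S, E)" using a(1) by (simp add: Z_def)
        then show False using a(2)[OF SI] by simp
      qed
    qed
  qed
qed

lemma generic_points_exist:
  assumes fin: "finite (carrier R)" and q: "card (carrier R) > 2 ^ n * 2 ^ Suc D * D"
  shows "\<exists>x. generic_points x n D"
  using q
proof (induction n)
  case 0
  show ?case
    by (auto simp: generic_points_def) (metis card_0_eq finite_atMost finite_subset empty_iff)
next
  case (Suc n)
  have le: "2 ^ n * 2 ^ Suc D * D \<le> 2 ^ Suc n * 2 ^ Suc D * D"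
    by (intro mult_right_mono) auto
  then obtain x where "generic_points x n D" using Suc by fastforce
  then show ?case
    using generic_points_extend[OF fin, of x n D] Suc.prems le by (meson le_less_trans)
qed

end

section \<open>Additive characters of finite fields\<close>

lemma (in ring) add_pow_zero_int: "x \<in> carrier R \<Longrightarrow> [(0::int)] \<cdot> x = \<zero>"
  by (simp add: add.int_pow_eq_id)

context field
begin

text \<open>Multiplication by a nonzero element is injective on the finite prime subring, hence
  onto, and so it reaches \<open>\<one>\<close>.\<close>

lemma finite_prime_subring_inverse:
  assumes fin: "finite (carrier R)" and d: "[(d::int)] \<cdot> \<one> \<noteq> \<zero>"
  obtains i :: int where "[(d * i)] \<cdot> \<one> = \<one>"
proof -
  let ?P = "range (\<lambda>i::int. [i] \<cdot> \<one>)"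
  let ?g = "\<lambda>x. [d] \<cdot> \<one> \<otimes> x"
  have P: "?P \<subseteq> carrier R" by auto
  have g: "?g ([i] \<cdot> \<one>) = [(d * i)] \<cdot> \<one>" for i
    by (simp add: add_pow_rdistr_int add.int_pow_pow mult.commute)
  have "inj_on ?g ?P"
    using P d by (intro inj_onI) (metis add.int_pow_closed m_lcancel one_closed subsetD)
  moreover have "?g ` ?P \<subseteq> ?P" using g by auto
  ultimately have "?g ` ?P = ?P"
    using endo_inj_surj[of ?P ?g] finite_subset[OF P fin] by blast
  moreover have "\<one> \<in> ?P" using rangeI[of "\<lambda>i::int. [i] \<cdot> \<one>" 1] by simp
  ultimately have "\<one> \<in> ?g ` ?P" by simp
  then obtain i where "\<one> = [(d * i)] \<cdot> \<one>" using g by auto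
  then show thesis using that[of i] by simp
qed

text \<open>A maximal additive subgroup avoiding \<open>\<one>\<close> is a complement of the prime subfield.\<close>

lemma prime_subring_complement:
  assumes fin: "finite (carrier R)"
  obtains H where "subgroup H (add_monoid R)" "\<one> \<notin> H"
    "\<forall>a\<in>carrier R. \<exists>k::int. \<exists>h\<in>H. a = h \<oplus> [k] \<cdot> \<one>"
proof -
  let ?\<H> = "{H. subgroup H (add_monoid R) \<and> \<one> \<notin> H}"
  have "?\<H> \<subseteq> Pow (carrier R)" using add.subgroupE(1) by blast
  then have finH: "finite ?\<H>" using fin finite_subset by blast
  have "{\<zero>} \<in> ?\<H>" using add.triv_subgroup by auto
  then obtain H where H: "H \<in> ?\<H>" and max: "\<And>H'. H' \<in> ?\<H> \<Longrightarrow> H \<subseteq> H' \<Longrightarrow> H = H'"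
    using finite_has_maximal[OF finH] by blast
  have sub: "subgroup H (add_monoid R)" and one: "\<one> \<notin> H" using H by auto
  have HC: "h \<in> carrier R" if "h \<in> H" for h using add.subgroupE(1)[OF sub] that by auto
  have "\<exists>k::int. \<exists>h\<in>H. a = h \<oplus> [k] \<cdot> \<one>" if a: "a \<in> carrier R" for a
  proof (cases "a \<in> H")
    case True
    then show ?thesis using HC by (intro exI[of _ 0] bexI[of _ a]) (auto simp: add_pow_zero_int)
  next
    case False
    \<comment> \<open>The subgroup generated by \<open>H\<close> and \<open>a\<close>. It is
      strictly larger than \<open>H\<close>, so maximality can fail for it only by containing
      \<open>\<one>\<close>.\<close>
    let ?H' = "{h \<oplus> [j] \<cdot> a | h j. h \<in> H \<and> j \<in> (UNIV::int set)}"
    have H'C: "?H' \<subseteq> carrier R" using HC a by auto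
    have "subgroup ?H' (add_monoid R)"
    proof (rule add.subgroupI)
      show "?H' \<noteq> {}" using add.subgroupE(2)[OF sub] by auto
      fix x assume "x \<in> ?H'"
      then obtain h and j :: int where h: "h \<in> H" and x: "x = h \<oplus> [j] \<cdot> a" by auto
      have "\<ominus> x = (\<ominus> h) \<oplus> [(- j)] \<cdot> a"
        using a HC[OF h] by (simp add: x minus_add add.int_pow_neg)
      then show "\<ominus> x \<in> ?H'" using add.subgroupE(3)[OF sub h] by blast
      fix y assume "y \<in> ?H'"
      then obtain h' and j' :: int where h': "h' \<in> H" and y: "y = h' \<oplus> [j'] \<cdot> a" by auto
      have "x \<oplus> y = (h \<oplus> h') \<oplus> [(j + j')] \<cdot> a"
        using a HC[OF h] HC[OF h'] by (simp add: x y add.int_pow_mult a_ac)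
      then show "x \<oplus> y \<in> ?H'" using add.subgroupE(4)[OF sub h h'] by blast
    qed (rule H'C)
    moreover have "H \<subset> ?H'"
    proof
      show "H \<subseteq> ?H'"
      proof
        fix h assume h: "h \<in> H"
        have "h = h \<oplus> [(0::int)] \<cdot> a" using HC[OF h] a by (simp add: add_pow_zero_int)
        then show "h \<in> ?H'" using h by blast
      qed
      have "a = \<zero> \<oplus> [(1::int)] \<cdot> a" using a by simp
      then have "a \<in> ?H'" using subgroup.one_closed[OF sub] by auto
      then show "H \<noteq> ?H'" using False by blast
    qed
    ultimately have "\<one> \<in> ?H'"
      using max[of ?H'] by blast
    then obtain h and j :: int where h: "h \<in> H" and eq: "\<one> = h \<oplus> [j] \<cdot> a" by auto
    have la: "[i] \<cdot> a = [i] \<cdot> \<one> \<otimes> a" for i :: int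
      using a by (simp add: add_pow_ldistr_int)
    \<comment> \<open>Otherwise the multiple of \<open>a\<close> would vanish and
      \<open>\<one> = h\<close> would lie in \<open>H\<close>. Inverting this coefficient solves the
      equation for \<open>a\<close>.\<close>
    have "[j] \<cdot> \<one> \<noteq> \<zero>"
      using eq la[of j] one h a HC by auto
    then obtain i where i: "[(j * i)] \<cdot> \<one> = \<one>"
      by (rule finite_prime_subring_inverse[OF fin])
    have "[i] \<cdot> \<one> = [i] \<cdot> h \<oplus> [(j * i)] \<cdot> a"
      using a HC[OF h] by (subst eq) (simp add: add.int_pow_distrib add.int_pow_pow)
    also have "[(j * i)] \<cdot> a = a" using i la a by simp
    finally have "a = [(- i)] \<cdot> h \<oplus> [i] \<cdot> \<one>"
      using a HC[OF h] by (simp add: add.int_pow_neg a_assoc[symmetric] l_neg)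
    moreover have "[(- i)] \<cdot> h \<in> H"
      by (rule add.subgroup_int_pow_closed[OF sub h])
    ultimately show ?thesis by blast
  qed
  with sub one show thesis by (intro that ballI)
qed

text \<open>The character sends \<open>h \<oplus> [k] \<cdot> \<one>\<close> to exp(2 pi i k / p),
  where p is the additive order of \<open>\<one>\<close>. Projection along the complement
  \<open>H\<close> plays the part that the trace to the prime field has in the usual
  construction.\<close>

lemma exists_additive_character:
  assumes fin: "finite (carrier R)"
  obtains \<theta> :: "'a \<Rightarrow> complex" and a where
    "\<And>a b. a \<in> carrier R \<Longrightarrow> b \<in> carrier R \<Longrightarrow> \<theta> (a \<oplus> b) = \<theta> a * \<theta> b"
    "\<And>a. cmod (\<theta> a) = 1" "a \<in> carrier R" "\<theta> a \<noteq> 1"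
proof -
  obtain H where sub: "subgroup H (add_monoid R)" and one: "\<one> \<notin> H"
    and cover: "\<forall>a\<in>carrier R. \<exists>k::int. \<exists>h\<in>H. a = h \<oplus> [k] \<cdot> \<one>"
    by (rule prime_subring_complement[OF fin])
  have HC: "h \<in> carrier R" if "h \<in> H" for h using add.subgroupE(1)[OF sub] that by auto
  define p where "p = add.ord \<one>"
  have p0: "p > 0"
    unfolding p_def using add.ord_ge_1[of \<one>] fin by simp
  have p1: "p \<noteq> 1"
    using add.int_pow_eq_id[of \<one> 1] unfolding p_def by auto
  define \<phi> where "\<phi> k = cis (2 * pi * of_int k / p)" for k :: int
  have \<phi>_add: "\<phi> (j + k) = \<phi> j * \<phi> k" for j k
    by (simp add: \<phi>_def cis_mult add_divide_distrib distrib_left)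
  have \<phi>_p: "\<phi> k = 1" if "int p dvd k" for k
  proof -
    obtain j where "k = int p * j" using \<open>int p dvd k\<close> ..
    then have "2 * pi * of_int k / p = 2 * pi * of_int j"
      using p0 by simp
    then have "\<phi> k = cis (2 * pi * of_int j)"
      by (simp only: \<phi>_def)
    also have "\<dots> = 1" by (rule cis_multiple_2pi) simp
    finally show ?thesis .
  qed
  \<comment> \<open>Two representations of one element differ by a multiple of \<open>\<one>\<close>
    that lies in \<open>H\<close>. If it were nonzero, a further multiple of it would be
    \<open>\<one>\<close> and still lie in \<open>H\<close>.\<close>
  have well: "\<phi> k = \<phi> k'" if "h \<in> H" "h' \<in> H" "h \<oplus> [k] \<cdot> \<one> = h' \<oplus> [k'] \<cdot> \<one>" for h h' k k'
  proof -
    have "[(k - k')] \<cdot> \<one> = h' \<ominus> h"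
    proof -
      have "[k] \<cdot> \<one> = \<ominus> h \<oplus> (h' \<oplus> [k'] \<cdot> \<one>)"
        using that HC by (metis add.int_pow_closed one_closed r_neg1)
      then show ?thesis
        using that HC by (simp add: add.int_pow_diff minus_eq a_ac r_neg)
    qed
    also have "\<dots> \<in> H"
      using that add.subgroupE(3,4)[OF sub] by (simp add: minus_eq)
    finally have inH: "[(k - k')] \<cdot> \<one> \<in> H" .
    have "[(k - k')] \<cdot> \<one> = \<zero>"
    proof (rule ccontr)
      assume "[(k - k')] \<cdot> \<one> \<noteq> \<zero>"
      then obtain i where "[((k - k') * i)] \<cdot> \<one> = \<one>"
        by (rule finite_prime_subring_inverse[OF fin])
      then have "[i] \<cdot> ([(k - k')] \<cdot> \<one>) = \<one>" by (simp add: add.int_pow_pow)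
      then show False using add.subgroup_int_pow_closed[OF sub inH, of i] one by simp
    qed
    then have "int p dvd k - k'" by (simp add: add.int_pow_eq_id p_def)
    then have "\<phi> (k - k') = 1" by (rule \<phi>_p)
    then show ?thesis using \<phi>_add[of "k - k'" k'] by simp
  qed
  \<comment> \<open>Any admissible k gives the same value, by \<open>well\<close>. Outside the
    carrier the choice is arbitrary but the value is still a root of unity, so its modulus is 1
    everywhere.\<close>
  define \<theta> where "\<theta> a = \<phi> (SOME k. \<exists>h\<in>H. a = h \<oplus> [k] \<cdot> \<one>)" for a
  have \<theta>: "\<theta> (h \<oplus> [k] \<cdot> \<one>) = \<phi> k" if h: "h \<in> H" for h k
  proof -
    have "\<exists>h'\<in>H. h \<oplus> [k] \<cdot> \<one> = h' \<oplus> [(SOME k'::int. \<exists>h'\<in>H. h \<oplus> [k] \<cdot> \<one> = h' \<oplus> [k'] \<cdot> \<one>)] \<cdot> \<one>"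
      by (rule someI[of "\<lambda>k'::int. \<exists>h'\<in>H. h \<oplus> [k] \<cdot> \<one> = h' \<oplus> [k'] \<cdot> \<one>" k]) (use h in blast)
    then obtain h' where "h' \<in> H"
      "h \<oplus> [k] \<cdot> \<one> = h' \<oplus> [(SOME k'::int. \<exists>h'\<in>H. h \<oplus> [k] \<cdot> \<one> = h' \<oplus> [k'] \<cdot> \<one>)] \<cdot> \<one>" ..
    from well[OF h this] show ?thesis by (simp only: \<theta>_def)
  qed
  show thesis
  proof (rule that)
    fix a b assume ab: "a \<in> carrier R" "b \<in> carrier R"
    obtain h k where a: "h \<in> H" "a = h \<oplus> [(k::int)] \<cdot> \<one>" using cover ab(1) by blast
    obtain h' k' where b: "h' \<in> H" "b = h' \<oplus> [(k'::int)] \<cdot> \<one>" using cover ab(2) by blast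
    have "a \<oplus> b = (h \<oplus> h') \<oplus> [(k + k')] \<cdot> \<one>"
      using HC[OF a(1)] HC[OF b(1)] by (simp add: a(2) b(2) add.int_pow_mult a_ac)
    then show "\<theta> (a \<oplus> b) = \<theta> a * \<theta> b"
      using a b \<theta>[OF add.subgroupE(4)[OF sub a(1) b(1)]] by (simp add: \<theta> \<phi>_add)
  next
    show "cmod (\<theta> a) = 1" for a by (simp add: \<theta>_def \<phi>_def)
    show "\<one> \<in> carrier R" by simp
    have "\<theta> \<one> = \<phi> 1"
      using \<theta>[of \<zero> 1] subgroup.one_closed[OF sub] by simp
    moreover have "\<phi> 1 \<noteq> 1"
    proof
      assume "\<phi> 1 = 1"
      then have "cos (2 * pi / p) = 1" by (simp add: \<phi>_def complex_eq_iff)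
      then obtain n :: int where "2 * pi / p = n * 2 * pi" using cos_one_2pi_int by auto
      then have "1 = real_of_int n * p" using p0 by (simp add: field_simps)
      then have "1 = n * int p" by (metis of_int_1 of_int_eq_iff of_int_mult of_int_of_nat_eq)
      then show False using p1 p0 by (metis int_dvd_int_iff dvd_triv_right nat_dvd_1_iff_1 of_nat_1)
    qed
    ultimately show "\<theta> \<one> \<noteq> 1" by simp
  qed
qed

end

section \<open>GASP exponents and evaluation codes\<close>

text \<open>The empty interval is a candidate and all candidates have at most \<open>card X\<close>
  elements, so \<open>ARG_MAX\<close> really selects an interval inside \<open>X\<close>.\<close>

lemma LCC_interval:
  assumes "finite X"
  obtains a k where "LCC X = {a..<a + k}" "{a..<a + k} \<subseteq> X"
proof -
  let ?P = "\<lambda>C. C \<subseteq> X \<and> (\<exists>a k :: nat. C = {a..<a + k})"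
  have "?P {0..<0 + 0}" by simp
  then have "?P (LCC X)"
    unfolding LCC_def
    by (rule arg_max_natI[of ?P _ card "Suc (card X)"]) (use assms in \<open>simp add: card_mono less_Suc_eq_le\<close>)
  then show thesis using that by blast
qed

lemma gasp_PM_UL: "i < K \<Longrightarrow> j < L \<Longrightarrow> gasp_PM K L r i j = i + K * j"
  by (simp add: gasp_PM_def gasp_alpha_def gasp_beta_def)

text \<open>Outside the corner one of the two summands already starts at
  \<open>K * L\<close>.\<close>

lemma gasp_PM_interference: "\<not> (i < K \<and> j < L) \<Longrightarrow> K * L \<le> gasp_PM K L r i j"
  by (auto simp: gasp_PM_def gasp_alpha_def gasp_beta_def)

lemma mixed_radix_less: "i < K \<Longrightarrow> j < L \<Longrightarrow> i + K * j < K * (L::nat)"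
proof -
  assume ij: "i < K" "j < L"
  then have "i + K * j < K * Suc j" by simp
  also have "\<dots> \<le> K * L" using ij by (intro mult_le_mono2) simp
  finally show ?thesis .
qed

lemma gasp_UL_eq: "gasp_UL K L r = {..<K * L}"
proof
  show "gasp_UL K L r \<subseteq> {..<K * L}"
    by (auto simp: gasp_UL_def entries_def gasp_PM_UL mixed_radix_less)
  show "{..<K * L} \<subseteq> gasp_UL K L r"
  proof
    fix e assume e: "e \<in> {..<K * L}"
    then have "0 < K" by (cases K) auto
    then have "e mod K < K" "e div K < L"
      using e by (auto simp: less_mult_imp_div_less mult.commute)
    moreover have "e = gasp_PM K L r (e mod K) (e div K)"
      using calculation by (simp add: gasp_PM_UL)
    ultimately show "e \<in> gasp_UL K L r"
      unfolding gasp_UL_def entries_def by blast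
  qed
qed

text \<open>No two terms collide at a desired exponent: entries outside the corner are at least
  \<open>K * L\<close>, and inside it i and j are remainder and quotient modulo
  \<open>K\<close>.\<close>

lemma gasp_PM_fibre:
  assumes "i < K" "j < L"
  shows "{p \<in> {..<K + T} \<times> {..<L + T}. case_prod (gasp_PM K L r) p = i + K * j} = {(i, j)}"
proof -
  have "i' = i \<and> j' = j" if "gasp_PM K L r i' j' = i + K * j" for i' j'
  proof -
    have lt: "i' < K \<and> j' < L"
      using gasp_PM_interference[of i' K j' L r] mixed_radix_less[OF assms] that by linarith
    then have "i' + K * j' = i + K * j" using that by (simp add: gasp_PM_UL)
    then show ?thesis
      using lt assms by (metis add.commute div_mult_self4 div_less add_0 mod_mult_self4 mod_less gr_implies_not0)
  qed
  then show ?thesis using assms by (auto simp: gasp_PM_UL)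
qed

section \<open>Generalized Vandermonde codes, their duals and interpolation\<close>

locale evaluation_code = field R for R (structure) +
  fixes x :: "nat \<Rightarrow> 'a" and N D :: nat
  assumes fin: "finite (carrier R)" and gen: "generic_points x N D"
begin

lemma x_closed: "n < N \<Longrightarrow> x n \<in> carrier R"
  using gen by (auto simp: generic_points_def)

lemma vandermonde_kernel:
  assumes "S \<subseteq> {..<N}" "E \<subseteq> {..D}" "card S = card E" "c \<in> E \<rightarrow> carrier R"
    and "\<And>i. i \<in> S \<Longrightarrow> (\<Oplus>e\<in>E. x i [^] e \<otimes> c e) = \<zero>" "e \<in> E"
  shows "c e = \<zero>"
  using assms by (rule generic_pointsD[OF gen])

lemma vandermonde_surj:
  assumes S: "S \<subseteq> {..<N}" and E: "E \<subseteq> {..D}" "card S = card E" and y: "y \<in> S \<rightarrow> carrier R"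
  obtains c where "c \<in> E \<rightarrow> carrier R" "\<And>i. i \<in> S \<Longrightarrow> (\<Oplus>e\<in>E. x i [^] e \<otimes> c e) = y i"
proof (rule square_matrix_surj[OF fin _ _ E(2) _ _ y, of "\<lambda>i e. x i [^] e"])
  show "finite S" "finite E" using S E finite_subset by blast+
  show "x i [^] e \<in> carrier R" if "i \<in> S" for i and e :: nat using that S x_closed by auto
qed (use vandermonde_kernel[OF S E] that in auto)

lemma vandermonde_transpose_kernel:
  assumes S: "S \<subseteq> {..<N}" and E: "E \<subseteq> {..D}" "card S = card E" and d: "d \<in> S \<rightarrow> carrier R"
    and ker: "\<And>e. e \<in> E \<Longrightarrow> (\<Oplus>i\<in>S. x i [^] e \<otimes> d i) = \<zero>" and j: "j \<in> S"
  shows "d j = \<zero>"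
proof (rule square_matrix_transpose_kernel[OF fin _ _ E(2) _ _ d ker j])
  show "finite S" "finite E" using S E finite_subset by blast+
  show "x i [^] e \<in> carrier R" if "i \<in> S" for i and e :: nat using that S x_closed by auto
qed (use vandermonde_kernel[OF S E] in auto)

text \<open>The \<open>N - 1\<close> equations determine \<open>v\<close> up to a scalar, and a zero coordinate would
  contradict genericity; \<open>v\<close> consists of the column multipliers of the dual code.\<close>

lemma dual_multipliers:
  assumes N: "0 < N" and D: "b + N \<le> Suc D"
  obtains v where "v \<in> {..<N} \<rightarrow> carrier R" "\<And>n. n < N \<Longrightarrow> v n \<noteq> \<zero>"
    "\<And>e. e \<in> {b..<b + (N - 1)} \<Longrightarrow> (\<Oplus>n\<in>{..<N}. x n [^] e \<otimes> v n) = \<zero>"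
proof -
  let ?E = "{b..<b + (N - 1)}" and ?S = "{..<N - 1}"
  have S: "?S \<subseteq> {..<N}" and E: "?E \<subseteq> {..D}" "card ?S = card ?E" using N D by auto
  have pw: "x i [^] e \<in> carrier R" if "i < N" for i and e :: nat using that x_closed by simp
  \<comment> \<open>Normalising the coordinate \<open>N - 1\<close> to \<open>\<one>\<close> leaves
    a square system with the transposed matrix in the other coordinates.\<close>
  obtain d where d: "d \<in> ?S \<rightarrow> carrier R"
    and eq: "\<And>e. e \<in> ?E \<Longrightarrow> (\<Oplus>i\<in>?S. x i [^] e \<otimes> d i) = \<ominus> (x (N - 1) [^] e)"
  proof (rule square_matrix_surj[of ?E ?S "\<lambda>e i. x i [^] e" "\<lambda>e. \<ominus> (x (N - 1) [^] e)"])
    show "(\<lambda>e. \<ominus> (x (N - 1) [^] e)) \<in> ?E \<rightarrow> carrier R" using N pw by auto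
  qed (use fin S E pw vandermonde_transpose_kernel[OF S E] that in auto)
  define v where "v = d(N - 1 := \<one>)"
  have v: "v \<in> {..<N} \<rightarrow> carrier R" using d by (auto simp: v_def Pi_def)
  have vc: "v n \<in> carrier R" if "n < N" for n using v that by auto
  have sum0: "(\<Oplus>n\<in>{..<N}. x n [^] e \<otimes> v n) = \<zero>" if e: "e \<in> ?E" for e
  proof -
    have "{..<N} = insert (N - 1) ?S" using N by auto
    then have "(\<Oplus>n\<in>{..<N}. x n [^] e \<otimes> v n)
      = x (N - 1) [^] e \<otimes> v (N - 1) \<oplus> (\<Oplus>n\<in>?S. x n [^] e \<otimes> v n)"
      using N pw vc by (simp only:) (subst finsum_insert, auto)
    also have "(\<Oplus>n\<in>?S. x n [^] e \<otimes> v n) = (\<Oplus>n\<in>?S. x n [^] e \<otimes> d n)"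
      using pw d by (intro finsum_cong') (auto simp: v_def Pi_def)
    also have "\<dots> = \<ominus> (x (N - 1) [^] e)" by (rule eq[OF e])
    finally show ?thesis using N pw by (simp add: v_def r_neg)
  qed
  have "v j \<noteq> \<zero>" if j: "j < N" for j
  proof
    assume vj: "v j = \<zero>"
    then have jN: "j \<noteq> N - 1" by (auto simp: v_def)
    have "v (N - 1) = \<zero>"
    proof (rule vandermonde_transpose_kernel[of "{..<N} - {j}" ?E v])
      fix e assume e: "e \<in> ?E"
      have "(\<Oplus>n\<in>{..<N} - {j}. x n [^] e \<otimes> v n) = (\<Oplus>n\<in>{..<N}. x n [^] e \<otimes> v n)"
        using pw vc vj j by (intro add.finprod_mono_neutral_cong_left) auto
      then show "(\<Oplus>n\<in>{..<N} - {j}. x n [^] e \<otimes> v n) = \<zero>" using sum0[OF e] by simp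
    qed (use E j jN N vc in auto)
    then show False by (simp add: v_def)
  qed
  then show thesis using v sum0 that by blast
qed

text \<open>A word \<open>w\<close> orthogonal to the code is divided by \<open>v\<close> and
  interpolated on the first \<open>N - k\<close> servers. The error \<open>b\<close> vanishes there,
  so it lives on the \<open>k\<close> remaining servers. It still satisfies the \<open>k\<close>
  orthogonality relations, because \<open>v\<close> times the interpolant does, and a square
  transposed Vandermonde system kills it.\<close>

lemma dual_code:
  assumes k: "k \<le> N" and D: "a + N \<le> Suc D" "2 * a + N \<le> Suc D"
    and v: "\<And>n. n < N \<Longrightarrow> v n \<in> carrier R" "\<And>n. n < N \<Longrightarrow> v n \<noteq> \<zero>"
    and dual: "\<And>e. e \<in> {2 * a..<2 * a + (N - 1)} \<Longrightarrow> (\<Oplus>n\<in>{..<N}. x n [^] e \<otimes> v n) = \<zero>"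
    and w: "\<And>n. n < N \<Longrightarrow> w n \<in> carrier R"
    and orth: "\<And>e. e \<in> {a..<a + k} \<Longrightarrow> (\<Oplus>n\<in>{..<N}. x n [^] e \<otimes> w n) = \<zero>"
  obtains c where "c \<in> {a..<a + (N - k)} \<rightarrow> carrier R"
    "\<And>n. n < N \<Longrightarrow> w n = v n \<otimes> (\<Oplus>e\<in>{a..<a + (N - k)}. x n [^] e \<otimes> c e)"
proof -
  let ?C = "{a..<a + (N - k)}" and ?S = "{..<N - k}"
  have pw: "x i [^] e \<in> carrier R" if "i < N" for i and e :: nat using that x_closed by simp
  have unit: "v n \<in> Units R" if "n < N" for n using v that field_Units by auto
  obtain c where c: "c \<in> ?C \<rightarrow> carrier R"
    and eq: "\<And>i. i \<in> ?S \<Longrightarrow> (\<Oplus>e\<in>?C. x i [^] e \<otimes> c e) = inv (v i) \<otimes> w i"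
    by (rule vandermonde_surj[of ?S ?C "\<lambda>i. inv (v i) \<otimes> w i"]) (use D unit w in auto)
  define f where "f n = (\<Oplus>e\<in>?C. x n [^] e \<otimes> c e)" for n
  have f: "f n \<in> carrier R" if "n < N" for n
    using pw[OF that] c unfolding f_def by (intro finsum_closed) auto
  define b where "b n = w n \<ominus> v n \<otimes> f n" for n
  have b: "b n \<in> carrier R" if "n < N" for n using that f v w by (simp add: b_def)
  have bS: "b n = \<zero>" if "n \<in> ?S" for n
  proof -
    have "v n \<otimes> f n = w n"
      using that eq[OF that] unit[of n] v w by (simp add: f_def m_assoc[symmetric])
    then show ?thesis using that w by (simp add: b_def)
  qed
  have vf: "(\<Oplus>n\<in>{..<N}. x n [^] e \<otimes> (v n \<otimes> f n)) = \<zero>" if e: "e \<in> {a..<a + k}" for e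
  proof -
    have "(\<Oplus>n\<in>{..<N}. x n [^] e \<otimes> (v n \<otimes> f n)) = (\<Oplus>n\<in>{..<N}. (x n [^] e \<otimes> v n) \<otimes> f n)"
      using pw v f by (intro finsum_cong') (auto simp: m_assoc)
    also have "\<dots> = (\<Oplus>e'\<in>?C. c e' \<otimes> (\<Oplus>n\<in>{..<N}. x n [^] e' \<otimes> (x n [^] e \<otimes> v n)))"
      unfolding f_def using pw v c by (intro matrix_swap) auto
    also have "\<dots> = (\<Oplus>e'\<in>?C. \<zero>)"
    proof (intro finsum_cong')
      fix e' assume e': "e' \<in> ?C"
      have "(\<Oplus>n\<in>{..<N}. x n [^] e' \<otimes> (x n [^] e \<otimes> v n)) = (\<Oplus>n\<in>{..<N}. x n [^] (e' + e) \<otimes> v n)"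
        using pw v x_closed by (intro finsum_cong') (auto simp: m_assoc[symmetric] nat_pow_mult)
      \<comment> \<open>The sum \<open>e' + e\<close> ranges from \<open>2 * a\<close> to
        \<open>2 * a + N - 2\<close>, exactly where \<open>v\<close> is orthogonal.\<close>
      also have "\<dots> = \<zero>" using e e' k by (intro dual) auto
      finally show "c e' \<otimes> (\<Oplus>n\<in>{..<N}. x n [^] e' \<otimes> (x n [^] e \<otimes> v n)) = \<zero>"
        using funcset_mem[OF c e'] by simp
    qed auto
    finally show ?thesis by simp
  qed
  have "b n = \<zero>" if n: "n < N" for n
  proof (cases "n \<in> ?S")
    case False
    show ?thesis
    proof (rule vandermonde_transpose_kernel[of "{N - k..<N}" "{a..<a + k}" b])
      fix e assume e: "e \<in> {a..<a + k}"
      have "(\<Oplus>n\<in>{N - k..<N}. x n [^] e \<otimes> b n) = (\<Oplus>n\<in>{..<N}. x n [^] e \<otimes> b n)"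
        using pw b bS by (intro add.finprod_mono_neutral_cong_left) auto
      also have "\<dots> = (\<Oplus>n\<in>{..<N}. x n [^] e \<otimes> w n) \<ominus> (\<Oplus>n\<in>{..<N}. x n [^] e \<otimes> (v n \<otimes> f n))"
        unfolding b_def using pw w v f by (intro matrix_apply_minus) auto
      also have "\<dots> = \<zero>" using orth[OF e] vf[OF e] by simp
      finally show "(\<Oplus>n\<in>{N - k..<N}. x n [^] e \<otimes> b n) = \<zero>" .
    qed (use n False k D b in auto)
  qed (rule bS)
  then have "w n = v n \<otimes> f n" if "n < N" for n
    using that w v f unfolding b_def by simp
  then show thesis using c that unfolding f_def by blast
qed

text \<open>The function space constrains \<open>c\<close> on \<open>J\<close> only; therefore
  uniqueness, and every statement about this choice, concerns exponents in \<open>J\<close>.\<close>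

definition interpolate :: "nat set \<Rightarrow> (nat \<Rightarrow> 'a) \<Rightarrow> (nat \<Rightarrow> 'a) \<Rightarrow> nat \<Rightarrow> 'a" where
  "interpolate J u y = (SOME c. c \<in> J \<rightarrow> carrier R \<and>
     (\<forall>n<N. u n \<otimes> (\<Oplus>e\<in>J. x n [^] e \<otimes> c e) = y n))"

lemma interpolate_eq:
  assumes J: "J \<subseteq> {..D}" "card J = N" and u: "\<And>n. n < N \<Longrightarrow> u n \<in> carrier R" "\<And>n. n < N \<Longrightarrow> u n \<noteq> \<zero>"
    and c: "c \<in> J \<rightarrow> carrier R" "\<And>n. n < N \<Longrightarrow> u n \<otimes> (\<Oplus>e\<in>J. x n [^] e \<otimes> c e) = y n" and e: "e \<in> J"
  shows "interpolate J u y e = c e"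
proof -
  let ?c = "interpolate J u y"
  have finJ: "finite J" using J finite_subset by blast
  have pw: "x i [^] e \<in> carrier R" if "i < N" for i and e :: nat using that x_closed by simp
  have ic: "?c \<in> J \<rightarrow> carrier R \<and> (\<forall>n<N. u n \<otimes> (\<Oplus>e\<in>J. x n [^] e \<otimes> ?c e) = y n)"
    unfolding interpolate_def by (rule someI[of _ c]) (use c in auto)
  have cl: "?c e \<in> carrier R" "c e \<in> carrier R" if "e \<in> J" for e using ic c that by auto
  have "?c e \<ominus> c e = \<zero>"
  proof (rule vandermonde_kernel[of "{..<N}" J "\<lambda>e. ?c e \<ominus> c e"])
    fix n assume n: "n \<in> {..<N}"
    have cl2: "(\<Oplus>e\<in>J. x n [^] e \<otimes> ?c e) \<in> carrier R" "(\<Oplus>e\<in>J. x n [^] e \<otimes> c e) \<in> carrier R"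
      using pw cl n by (auto intro!: finsum_closed)
    have "u n \<otimes> (\<Oplus>e\<in>J. x n [^] e \<otimes> ?c e) = u n \<otimes> (\<Oplus>e\<in>J. x n [^] e \<otimes> c e)"
      using ic c(2) n by auto
    then have "(\<Oplus>e\<in>J. x n [^] e \<otimes> ?c e) = (\<Oplus>e\<in>J. x n [^] e \<otimes> c e)"
      using cl2 u n m_lcancel by simp
    then show "(\<Oplus>e\<in>J. x n [^] e \<otimes> (?c e \<ominus> c e)) = \<zero>"
      using cl pw n finJ cl2 by (subst matrix_apply_minus) auto
  qed (use J cl e in auto)
  then show ?thesis using cl e by simp
qed

text \<open>Interpolation is linear, so data that change by \<open>u\<close> times a polynomial with
  exponents in \<open>C\<close> change the coefficients in \<open>C\<close> alone.\<close>

lemma interpolate_invariant: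
  assumes J: "J \<subseteq> {..D}" "card J = N" and u: "\<And>n. n < N \<Longrightarrow> u n \<in> carrier R" "\<And>n. n < N \<Longrightarrow> u n \<noteq> \<zero>"
    and C: "C \<subseteq> J" and c: "c \<in> C \<rightarrow> carrier R" and y: "\<And>n. n < N \<Longrightarrow> y' n \<in> carrier R"
    and eq: "\<And>n. n < N \<Longrightarrow> y n = u n \<otimes> (\<Oplus>e\<in>C. x n [^] e \<otimes> c e) \<oplus> y' n" and e: "e \<in> J - C"
  shows "interpolate J u y e = interpolate J u y' e"
proof -
  have finJ: "finite J" using J finite_subset by blast
  have pw: "x i [^] e \<in> carrier R" if "i < N" for i and e :: nat using that x_closed by simp
  have unit: "u n \<in> Units R" if "n < N" for n using u that field_Units by auto
  obtain c' where c': "c' \<in> J \<rightarrow> carrier R"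
    and eq': "\<And>n. n \<in> {..<N} \<Longrightarrow> (\<Oplus>e\<in>J. x n [^] e \<otimes> c' e) = inv (u n) \<otimes> y' n"
    by (rule vandermonde_surj[of "{..<N}" J "\<lambda>n. inv (u n) \<otimes> y' n"]) (use J unit y in auto)
  define c'' where "c'' e = (if e \<in> C then c e else \<zero>) \<oplus> c' e" for e
  have cl: "c e \<in> carrier R" if "e \<in> C" for e using c that by auto
  have cl': "c' e \<in> carrier R" if "e \<in> J" for e using c' that by auto
  have uy': "u n \<otimes> (\<Oplus>e\<in>J. x n [^] e \<otimes> c' e) = y' n" if "n < N" for n
    using eq'[of n] that unit[OF that] u y by (simp add: m_assoc[symmetric])
  have "u n \<otimes> (\<Oplus>e\<in>J. x n [^] e \<otimes> c'' e) = y n" if n: "n < N" for n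
  proof -
    have "(\<Oplus>e\<in>J. x n [^] e \<otimes> c'' e)
      = (\<Oplus>e\<in>J. x n [^] e \<otimes> (if e \<in> C then c e else \<zero>) \<oplus> x n [^] e \<otimes> c' e)"
      using pw[OF n] cl cl' by (intro finsum_cong') (auto simp: c''_def r_distr)
    also have "\<dots> = (\<Oplus>e\<in>J. x n [^] e \<otimes> (if e \<in> C then c e else \<zero>)) \<oplus> (\<Oplus>e\<in>J. x n [^] e \<otimes> c' e)"
      using pw[OF n] cl cl' by (intro finsum_addf) auto
    also have "(\<Oplus>e\<in>J. x n [^] e \<otimes> (if e \<in> C then c e else \<zero>)) = (\<Oplus>e\<in>C. x n [^] e \<otimes> c e)"
      using pw[OF n] cl finJ C by (intro add.finprod_mono_neutral_cong_right) auto
    finally have s: "(\<Oplus>e\<in>J. x n [^] e \<otimes> c'' e) = (\<Oplus>e\<in>C. x n [^] e \<otimes> c e) \<oplus> (\<Oplus>e\<in>J. x n [^] e \<otimes> c' e)" .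
    have "(\<Oplus>e\<in>C. x n [^] e \<otimes> c e) \<in> carrier R" "(\<Oplus>e\<in>J. x n [^] e \<otimes> c' e) \<in> carrier R"
      using pw[OF n] cl cl' by (auto intro!: finsum_closed)
    then show ?thesis using u n by (simp add: s r_distr uy' eq)
  qed
  then have "interpolate J u y e = c'' e"
    using e cl cl' C by (intro interpolate_eq[OF J u]) (auto simp: c''_def)
  moreover have "interpolate J u y' e = c' e"
    using e c' uy' by (intro interpolate_eq[OF J u]) auto
  ultimately show ?thesis using e cl' by (simp add: c''_def)
qed

end

section \<open>Weyl operators over a finite field\<close>

text \<open>An additive group in multiplicative dress, to serve as the \<open>G\<close> of
  \<open>phase_space\<close>. Results are restricted again so that the carrier is literally the set
  of basis labels of the composite system.\<close>

definition mat_group :: "'a ring \<Rightarrow> nat \<Rightarrow> nat \<Rightarrow> nat \<Rightarrow> (nat \<Rightarrow> 'a mtx) monoid" where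
  "mat_group F N s l = \<lparr>carrier = composite N (fmat F s l),
     mult = (\<lambda>X Y. \<lambda>n\<in>{..<N}. \<lambda>p\<in>{..<s} \<times> {..<l}. X n p \<oplus>\<^bsub>F\<^esub> Y n p),
     one = (\<lambda>n\<in>{..<N}. \<lambda>p\<in>{..<s} \<times> {..<l}. \<zero>\<^bsub>F\<^esub>)\<rparr>"

lemma carrier_mat_group [simp]: "carrier (mat_group F N s l) = composite N (fmat F s l)"
  by (simp add: mat_group_def)

lemma composite_entry:
  "X \<in> composite N (fmat F s l) \<Longrightarrow> n < N \<Longrightarrow> p \<in> {..<s} \<times> {..<l} \<Longrightarrow> X n p \<in> carrier F"
  unfolding composite_def fmat_def by (auto simp: PiE_def Pi_def)

lemma composite_comp: "X \<in> composite N B \<Longrightarrow> n < N \<Longrightarrow> X n \<in> B"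
  unfolding composite_def by auto

lemma composite_fmatI:
  assumes "\<And>n p. n < N \<Longrightarrow> p \<in> {..<s} \<times> {..<l} \<Longrightarrow> f n p \<in> carrier F"
  shows "(\<lambda>n\<in>{..<N}. \<lambda>p\<in>{..<s} \<times> {..<l}. f n p) \<in> composite N (fmat F s l)"
  using assms unfolding composite_def fmat_def by auto

lemma composite_fmat_ext:
  assumes "X \<in> composite N (fmat F s l)" "Y \<in> composite N (fmat F s l)"
    and "\<And>n p. n < N \<Longrightarrow> p \<in> {..<s} \<times> {..<l} \<Longrightarrow> X n p = Y n p"
  shows "X = Y"
proof (rule PiE_ext)
  show "X \<in> {..<N} \<rightarrow>\<^sub>E fmat F s l" "Y \<in> {..<N} \<rightarrow>\<^sub>E fmat F s l"
    using assms(1,2) by (auto simp: composite_def)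
  fix n assume n: "n \<in> {..<N}"
  show "X n = Y n"
    by (rule PiE_ext[of _ "{..<s} \<times> {..<l}" "\<lambda>_. carrier F"])
      (use assms(3) n composite_comp[OF assms(1)] composite_comp[OF assms(2)] in \<open>auto simp: fmat_def\<close>)
qed

lemma mat_group_mult_apply [simp]:
  "n < N \<Longrightarrow> p \<in> {..<s} \<times> {..<l} \<Longrightarrow> (X \<otimes>\<^bsub>mat_group F N s l\<^esub> Y) n p = X n p \<oplus>\<^bsub>F\<^esub> Y n p"
  by (simp add: mat_group_def)

lemma mat_group_one_apply [simp]:
  "n < N \<Longrightarrow> p \<in> {..<s} \<times> {..<l} \<Longrightarrow> \<one>\<^bsub>mat_group F N s l\<^esub> n p = \<zero>\<^bsub>F\<^esub>"
  by (simp add: mat_group_def)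

lemma mat_group_pair_apply [simp]:
  "n < N \<Longrightarrow> i < s \<Longrightarrow> j < l \<Longrightarrow>
    (X \<otimes>\<^bsub>mat_group F N s l\<^esub> Y) n (i, j) = X n (i, j) \<oplus>\<^bsub>F\<^esub> Y n (i, j)"
  "n < N \<Longrightarrow> i < s \<Longrightarrow> j < l \<Longrightarrow> \<one>\<^bsub>mat_group F N s l\<^esub> n (i, j) = \<zero>\<^bsub>F\<^esub>"
  by (simp_all add: mat_group_def)

lemma finite_fmat: "finite (carrier F) \<Longrightarrow> finite (fmat F s l)"
  unfolding fmat_def by (intro finite_PiE) auto

lemma finite_composite: "finite B \<Longrightarrow> finite (composite N B)"
  unfolding composite_def by (intro finite_PiE) auto

locale field_character = field R for R :: "'a ring" (structure) +
  fixes \<theta> :: "'a \<Rightarrow> complex"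
  assumes fin: "finite (carrier R)"
    and theta_add: "a \<in> carrier R \<Longrightarrow> b \<in> carrier R \<Longrightarrow> \<theta> (a \<oplus> b) = \<theta> a * \<theta> b"
    and theta_norm: "cmod (\<theta> a) = 1"
    and theta_nontriv: "\<exists>a\<in>carrier R. \<theta> a \<noteq> 1"
begin

lemma mat_group_closed:
  assumes "X \<in> composite N (fmat R s l)" "Y \<in> composite N (fmat R s l)"
  shows "X \<otimes>\<^bsub>mat_group R N s l\<^esub> Y \<in> composite N (fmat R s l)"
  using assms composite_entry[OF assms(1)] composite_entry[OF assms(2)]
  by (auto simp: mat_group_def intro!: composite_fmatI)

lemma mat_group_one_closed: "\<one>\<^bsub>mat_group R N s l\<^esub> \<in> composite N (fmat R s l)"
  by (auto simp: mat_group_def intro!: composite_fmatI)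

lemma comm_group_mat_group: "comm_group (mat_group R N s l)"
proof (rule comm_groupI)
  fix X assume X: "X \<in> carrier (mat_group R N s l)"
  let ?Y = "\<lambda>n\<in>{..<N}. \<lambda>p\<in>{..<s} \<times> {..<l}. \<ominus> X n p"
  have Y: "?Y \<in> composite N (fmat R s l)"
    using composite_entry[of X N R s l] X by (intro composite_fmatI) auto
  show "\<exists>Y\<in>carrier (mat_group R N s l). Y \<otimes>\<^bsub>mat_group R N s l\<^esub> X = \<one>\<^bsub>mat_group R N s l\<^esub>"
  proof (rule bexI[of _ ?Y])
    show "?Y \<otimes>\<^bsub>mat_group R N s l\<^esub> X = \<one>\<^bsub>mat_group R N s l\<^esub>"
      using X Y composite_entry[of X N R s l]
      by (intro composite_fmat_ext[of _ N R s l])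
        (simp_all add: mat_group_closed mat_group_one_closed l_neg del: mem_Sigma_iff)
  qed (use Y in simp)
qed (auto intro!: composite_fmat_ext[of _ N R s l] mat_group_closed mat_group_one_closed
    simp: a_ac composite_entry[of _ N R s l])

lemma mat_group_inv_apply:
  assumes X: "X \<in> composite N (fmat R s l)" and n: "n < N" and p: "p \<in> {..<s} \<times> {..<l}"
  shows "(inv\<^bsub>mat_group R N s l\<^esub> X) n p = \<ominus> X n p"
proof -
  interpret G: comm_group "mat_group R N s l" by (rule comm_group_mat_group)
  have iX: "inv\<^bsub>mat_group R N s l\<^esub> X \<in> composite N (fmat R s l)"
    using G.inv_closed X by simp
  have "(inv\<^bsub>mat_group R N s l\<^esub> X \<otimes>\<^bsub>mat_group R N s l\<^esub> X) n p = \<zero>"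
    using G.l_inv[of X] X n p by simp
  then have "(inv\<^bsub>mat_group R N s l\<^esub> X) n p \<oplus> X n p = \<zero>"
    using n p by simp
  then show ?thesis
    using composite_entry[OF X n p] composite_entry[OF iX n p] by (metis minus_equality)
qed

lemma theta_nonzero: "\<theta> a \<noteq> 0"
  using theta_norm[of a] by auto

lemma theta_zero: "\<theta> \<zero> = 1"
  using theta_add[of \<zero> \<zero>] theta_nonzero[of \<zero>] by simp

lemma theta_finsum:
  "finite A \<Longrightarrow> (\<And>i. i \<in> A \<Longrightarrow> f i \<in> carrier R) \<Longrightarrow> \<theta> (\<Oplus>i\<in>A. f i) = (\<Prod>i\<in>A. \<theta> (f i))"
proof (induction A rule: finite_induct)
  case (insert i A)
  then show ?case
    by (subst finsum_insert) (auto simp: theta_add intro!: finsum_closed)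
qed (simp add: theta_zero)

text \<open>If \<open>t\<close> and \<open>t'\<close> differ, the scalar
  \<open>a \<otimes> inv (t \<ominus> t')\<close> moves their difference to a point \<open>a\<close>
  where \<open>\<theta>\<close> is not 1.\<close>

lemma theta_separates:
  assumes t: "t \<in> carrier R" "t' \<in> carrier R"
    and eq: "\<And>g. g \<in> carrier R \<Longrightarrow> \<theta> (g \<otimes> t) = \<theta> (g \<otimes> t')"
  shows "t = t'"
proof (rule ccontr)
  assume "t \<noteq> t'"
  then have u: "t \<ominus> t' \<in> Units R" using t field_Units by auto
  obtain a where a: "a \<in> carrier R" "\<theta> a \<noteq> 1" using theta_nontriv by blast
  define g where "g = a \<otimes> inv (t \<ominus> t')"
  have g: "g \<in> carrier R" "g \<otimes> (t \<ominus> t') = a" using a u t by (auto simp: g_def m_assoc)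
  have "g \<otimes> t = g \<otimes> (t \<ominus> t') \<oplus> g \<otimes> t'"
    using g(1) t by (simp add: r_distr[symmetric] minus_eq a_assoc l_neg)
  then have "\<theta> (g \<otimes> t) = \<theta> a * \<theta> (g \<otimes> t')" using g t a by (simp add: theta_add)
  then show False using eq[OF g(1)] a theta_nonzero by simp
qed

text \<open>Translating the summation variable by \<open>g\<close> multiplies the sum by
  \<open>\<theta> (g \<otimes> c)\<close>, which is not 1.\<close>

lemma theta_sum_zero:
  assumes c: "c \<in> carrier R" "c \<noteq> \<zero>"
  shows "(\<Sum>a\<in>carrier R. \<theta> (a \<otimes> c)) = 0"
proof -
  obtain g where g: "g \<in> carrier R" "\<theta> (g \<otimes> c) \<noteq> 1"
    using theta_separates[OF c(1) zero_closed] c by (auto simp: theta_zero)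
  have "(\<Sum>a\<in>carrier R. \<theta> (a \<otimes> c)) = (\<Sum>a\<in>carrier R. \<theta> ((a \<oplus> g) \<otimes> c))"
  proof (rule sum.reindex_bij_betw[symmetric])
    show "bij_betw (\<lambda>a. a \<oplus> g) (carrier R) (carrier R)"
      using g by (intro bij_betw_byWitness[where f' = "\<lambda>b. b \<oplus> \<ominus> g"]) (auto simp: a_assoc r_neg l_neg)
  qed
  also have "\<dots> = \<theta> (g \<otimes> c) * (\<Sum>a\<in>carrier R. \<theta> (a \<otimes> c))"
    using g c by (simp add: l_distr theta_add sum_distrib_left mult.commute)
  finally show ?thesis using g(2) by simp
qed

text \<open>\<open>\<theta>\<close> of the bilinear pairing that sums the entrywise products;
  through it the matrices label the characters of their own additive group.\<close>

definition mchar :: "nat \<Rightarrow> nat \<Rightarrow> 'a mtx \<Rightarrow> 'a mtx \<Rightarrow> complex" where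
  "mchar s l z b = (\<Prod>p\<in>{..<s} \<times> {..<l}. \<theta> (z p \<otimes> b p))"

definition cchar :: "nat \<Rightarrow> nat \<Rightarrow> nat \<Rightarrow> (nat \<Rightarrow> 'a mtx) \<Rightarrow> (nat \<Rightarrow> 'a mtx) \<Rightarrow> complex" where
  "cchar N s l Z B = (\<Prod>n<N. mchar s l (Z n) (B n))"

lemma cmod_mchar: "cmod (mchar s l z b) = 1"
  by (simp add: mchar_def prod_norm[symmetric] theta_norm)

text \<open>For orthogonality, the sum over all tuples of matrices factors into one sum over the
  field for each server and entry. A nonzero entry of \<open>b\<close> makes its factor
  vanish.\<close>

lemma phase_space_mat_group:
  assumes V: "subgroup V (mat_group R N s l)"
  shows "phase_space (mat_group R N s l) (cchar N s l) V"
proof -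
  interpret G: comm_group "mat_group R N s l" by (rule comm_group_mat_group)
  let ?P = "{..<s} \<times> {..<l}"
  show ?thesis
  proof unfold_locales
    show "finite (carrier (mat_group R N s l))"
      using fin by (simp add: finite_composite finite_fmat)
    show "cmod (cchar N s l z b) = 1" for z b
      by (simp add: cchar_def prod_norm[symmetric] cmod_mchar)
    show "cchar N s l z (b \<otimes>\<^bsub>mat_group R N s l\<^esub> c) = cchar N s l z b * cchar N s l z c"
      if "z \<in> carrier (mat_group R N s l)" "b \<in> carrier (mat_group R N s l)" "c \<in> carrier (mat_group R N s l)"
      for z b c
      unfolding cchar_def mchar_def prod.distrib[symmetric]
    proof (intro prod.cong refl)
      fix n p assume "n \<in> {..<N}" and p: "p \<in> ?P"
      then have n: "n < N" by simp
      show "\<theta> (z n p \<otimes> (b \<otimes>\<^bsub>mat_group R N s l\<^esub> c) n p) = \<theta> (z n p \<otimes> b n p) * \<theta> (z n p \<otimes> c n p)"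
        using composite_entry[OF _ n p, of z] composite_entry[OF _ n p, of b] composite_entry[OF _ n p, of c]
          that n p by (simp add: r_distr theta_add del: mem_Sigma_iff)
    qed
    show "(\<Sum>z\<in>carrier (mat_group R N s l). cchar N s l z b) = 0"
      if b: "b \<in> carrier (mat_group R N s l)" "b \<noteq> \<one>\<^bsub>mat_group R N s l\<^esub>" for b
    proof -
      have "\<exists>n<N. \<exists>p\<in>?P. b n p \<noteq> \<zero>"
      proof (rule ccontr)
        assume "\<not> ?thesis"
        then have "b = \<one>\<^bsub>mat_group R N s l\<^esub>"
          using b(1) by (intro composite_fmat_ext[of _ N R s l])
            (auto simp: mat_group_one_closed simp del: mem_Sigma_iff)
        then show False using b(2) by simp
      qed
      then obtain n p where np: "n < N" "p \<in> ?P" "b n p \<noteq> \<zero>" by blast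
      have "(\<Sum>z\<in>carrier (mat_group R N s l). cchar N s l z b)
        = (\<Prod>n<N. \<Sum>z\<in>fmat R s l. mchar s l z (b n))"
        unfolding carrier_mat_group composite_def cchar_def
        using fin by (intro prod_sum_PiE[symmetric]) (auto simp: finite_fmat)
      also have "\<dots> = (\<Prod>n<N. \<Prod>p\<in>?P. \<Sum>a\<in>carrier R. \<theta> (a \<otimes> b n p))"
        unfolding fmat_def mchar_def
        using fin by (intro prod.cong refl prod_sum_PiE[symmetric]) auto
      also have "\<dots> = 0"
      proof (rule prod_zero)
        show "\<exists>n\<in>{..<N}. (\<Prod>p\<in>?P. \<Sum>a\<in>carrier R. \<theta> (a \<otimes> b n p)) = 0"
        proof (intro bexI[of _ n] prod_zero)
          show "\<exists>p\<in>?P. (\<Sum>a\<in>carrier R. \<theta> (a \<otimes> b n p)) = 0"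
            using np b composite_entry[of b N R s l n p] theta_sum_zero by (intro bexI[of _ p]) auto
        qed (use np in auto)
      qed simp
      finally show ?thesis .
    qed
  qed (use V in \<open>auto simp: subgroup_def\<close>)
qed

text \<open>The basis state \<open>b\<close> receives its phase first and is then shifted by
  \<open>x\<close>; this order agrees with \<open>psi\<close>.\<close>

definition weyl :: "nat \<Rightarrow> nat \<Rightarrow> 'a mtx \<Rightarrow> 'a mtx \<Rightarrow> 'a mtx qop" where
  "weyl s l x z = (\<lambda>u b. if u = (\<lambda>p\<in>{..<s} \<times> {..<l}. b p \<oplus> x p) then mchar s l z b else 0)"

text \<open>The matrix is a permutation matrix with entries scaled by numbers of modulus 1, hence
  unitary, and a single Kraus operator suffices.\<close>

lemma quantum_operation_weyl:
  assumes x: "x \<in> fmat R s l"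
  shows "quantum_operation (fmat R s l) [weyl s l x z]"
  unfolding quantum_operation_def qid_on_def
proof (intro ballI)
  fix a b assume ab: "a \<in> fmat R s l" "b \<in> fmat R s l"
  let ?P = "{..<s} \<times> {..<l}"
  let ?t = "\<lambda>b. \<lambda>p\<in>?P. b p \<oplus> x p"
  have cl: "x p \<in> carrier R" "a p \<in> carrier R" "b p \<in> carrier R" if "p \<in> ?P" for p
    using x ab that unfolding fmat_def by auto
  have t: "?t b \<in> fmat R s l" using cl unfolding fmat_def by auto
  have inj: "?t a = ?t b \<longleftrightarrow> a = b"
  proof
    assume eq: "?t a = ?t b"
    have "a p = b p" if p: "p \<in> ?P" for p
      using fun_cong[OF eq, of p] cl[OF p] p by (simp del: mem_Sigma_iff)
    then show "a = b" using ab unfolding fmat_def by (intro PiE_ext) auto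
  qed simp
  have W: "weyl s l x z u b = (if u = ?t b then mchar s l z b else 0)" for u
    by (simp add: weyl_def)
  have "(\<Sum>E\<leftarrow>[weyl s l x z]. qmult (fmat R s l) (qadj E) E a b)
    = (\<Sum>u\<in>fmat R s l. if u = ?t b then cnj (weyl s l x z (?t b) a) * mchar s l z b else 0)"
    by (auto simp: qmult_def qadj_def W intro!: sum.cong)
  also have "\<dots> = cnj (weyl s l x z (?t b) a) * mchar s l z b"
    using fin t by (simp add: finite_fmat)
  also have "\<dots> = (if a = b then 1 else 0)"
  proof (cases "a = b")
    case True
    have "cnj (mchar s l z b) * mchar s l z b = 1"
      by (metis cmod_mchar complex_norm_square mult.commute of_real_1 one_power2)
    then show ?thesis using True by (simp add: weyl_def)
  next
    case False
    then have "?t b \<noteq> ?t a" using inj by metis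
    then show ?thesis using False by (simp add: weyl_def)
  qed
  finally show "(\<Sum>E\<leftarrow>[weyl s l x z]. qmult (fmat R s l) (qadj E) E a b) = (if a = b then 1 else 0)" .
qed

text \<open>Independent operations of the servers act together as one Weyl operator of the joint
  group; this is what lets local answers displace the entangled state.\<close>

lemma qtensor_weyl:
  assumes X: "X \<in> composite N (fmat R s l)" and u: "u \<in> composite N (fmat R s l)" and b: "b \<in> composite N (fmat R s l)"
  shows "qtensor N (\<lambda>n. weyl s l (X n) (Z n)) u b
    = (if u = b \<otimes>\<^bsub>mat_group R N s l\<^esub> X then cchar N s l Z b else 0)"
proof (cases "u = b \<otimes>\<^bsub>mat_group R N s l\<^esub> X")
  case True
  then have "u n = (\<lambda>p\<in>{..<s} \<times> {..<l}. b n p \<oplus> X n p)" if "n < N" for n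
    using that by (simp add: mat_group_def)
  then show ?thesis using True by (simp add: qtensor_def weyl_def cchar_def)
next
  case False
  have "\<exists>n<N. u n \<noteq> (\<lambda>p\<in>{..<s} \<times> {..<l}. b n p \<oplus> X n p)"
  proof (rule ccontr)
    assume "\<not> ?thesis"
    then have "u = b \<otimes>\<^bsub>mat_group R N s l\<^esub> X"
      using u b X by (intro composite_fmat_ext[of _ N R s l]) (auto simp: mat_group_closed)
    then show False using False by simp
  qed
  then obtain n where "n < N" "weyl s l (X n) (Z n) (u n) (b n) = 0" by (auto simp: weyl_def)
  then have "qtensor N (\<lambda>n. weyl s l (X n) (Z n)) u b = 0"
    unfolding qtensor_def by (intro prod_zero) auto
  then show ?thesis using False by simp
qed

lemma cchar_one: "b \<in> composite N (fmat R s l) \<Longrightarrow> cchar N s l \<one>\<^bsub>mat_group R N s l\<^esub> b = 1"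
  unfolding cchar_def mchar_def
  by (intro prod.neutral ballI) (simp add: composite_entry theta_zero del: mem_Sigma_iff)

end

section \<open>Local unitaries acting on pure states\<close>

lemma qmult_pure_state:
  "qmult H (qmult H E (pure_state \<phi>)) (qadj E) = pure_state (\<lambda>u. \<Sum>b\<in>H. E u b * \<phi> b)"
  unfolding qmult_def qadj_def pure_state_def cnj_sum
  by (intro ext) (simp add: sum_distrib_left sum_distrib_right mult_ac)

lemma apply_local_unitary:
  "apply_local N B (\<lambda>n. [W n]) \<rho> =
    qmult (composite N B) (qmult (composite N B) (qtensor N W) \<rho>) (qadj (qtensor N W))"
proof -
  have "(\<Pi>\<^sub>E n\<in>{..<N}. {..<length [W n]}) = {\<lambda>n\<in>{..<N}. 0}"
    by (auto simp: PiE_def extensional_def fun_eq_iff)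
  moreover have "qtensor N (\<lambda>n. [W n] ! (\<lambda>n\<in>{..<N}. 0) n) = qtensor N W"
    by (auto simp: qtensor_def fun_eq_iff intro!: prod.cong)
  ultimately show ?thesis unfolding apply_local_def Let_def by simp
qed

context phase_space
begin

text \<open>\<open>psi \<one> \<one>\<close> is the uniform superposition over \<open>V\<close>,
  because the label \<open>\<one>\<close> carries the trivial character. Only the label
  \<open>u \<otimes> inv x\<close> contributes to the entry at \<open>u\<close>.\<close>

lemma displacement_psi:
  assumes E: "\<And>u b. u \<in> carrier G \<Longrightarrow> b \<in> carrier G \<Longrightarrow> E u b = (if u = b \<otimes> x then \<theta> z b else 0)"
    and x: "x \<in> carrier G" and u: "u \<in> carrier G" and one: "\<And>b. b \<in> carrier G \<Longrightarrow> \<theta> \<one> b = 1"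
  shows "(\<Sum>b\<in>carrier G. E u b * psi \<one> \<one> b) = psi x z u"
proof -
  have "(\<Sum>b\<in>carrier G. E u b * psi \<one> \<one> b)
    = (\<Sum>b\<in>carrier G. if b = u \<otimes> inv x then \<theta> z b * psi \<one> \<one> b else 0)"
  proof (intro sum.cong refl)
    fix b assume b: "b \<in> carrier G"
    have "u = b \<otimes> x \<longleftrightarrow> b = u \<otimes> inv x"
      using u b x by (metis inv_closed inv_inv inv_solve_right m_closed)
    then show "E u b * psi \<one> \<one> b = (if b = u \<otimes> inv x then \<theta> z b * psi \<one> \<one> b else 0)"
      using E[OF u b] by simp
  qed
  also have "\<dots> = \<theta> z (u \<otimes> inv x) * psi \<one> \<one> (u \<otimes> inv x)"
    using fin u x by simp
  also have "\<dots> = psi x z u"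
    using u x by (simp add: psi_def one)
  finally show ?thesis .
qed

end

section \<open>Secret sharing\<close>

lemma (in abelian_monoid) finsum_Times:
  assumes "finite A" "finite B" "\<And>i j. i \<in> A \<Longrightarrow> j \<in> B \<Longrightarrow> f i j \<in> carrier G"
  shows "(\<Oplus>i\<in>A. \<Oplus>j\<in>B. f i j) = (\<Oplus>p\<in>A \<times> B. f (fst p) (snd p))"
proof -
  have "(\<Oplus>p\<in>A \<times> B. f (fst p) (snd p)) = (\<Oplus>i\<in>A. \<Oplus>p\<in>{p \<in> A \<times> B. fst p = i}. f (fst p) (snd p))"
    using assms by (intro finsum_fibres) auto
  also have "\<dots> = (\<Oplus>i\<in>A. \<Oplus>j\<in>B. f i j)"
  proof (intro finsum_cong')
    fix i assume i: "i \<in> A"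
    have eq: "{p \<in> A \<times> B. fst p = i} = Pair i ` B" using i by auto
    show "(\<Oplus>p\<in>{p \<in> A \<times> B. fst p = i}. f (fst p) (snd p)) = (\<Oplus>j\<in>B. f i j)"
      unfolding eq using i assms(3) by (subst finsum_reindex) (auto simp: inj_on_def)
  qed (use assms in \<open>auto intro!: finsum_closed\<close>)
  finally show ?thesis by simp
qed

lemma (in abelian_monoid) finsum_lessThan_add:
  fixes a b :: nat
  assumes "\<And>t. t < a + b \<Longrightarrow> f t \<in> carrier G"
  shows "(\<Oplus>t\<in>{..<a + b}. f t) = (\<Oplus>t\<in>{..<a}. f t) \<oplus> (\<Oplus>t\<in>{..<b}. f (a + t))"
  using assms
proof (induction b)
  case 0
  then have "(\<Oplus>t\<in>{..<a}. f t) \<in> carrier G" by (intro finsum_closed) auto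
  then show ?case by simp
next
  case (Suc b)
  have cl: "(\<Oplus>t\<in>{..<a}. f t) \<in> carrier G" "(\<Oplus>t\<in>{..<b}. f (a + t)) \<in> carrier G" "f (a + b) \<in> carrier G"
    using Suc.prems by (auto intro!: finsum_closed)
  have "(\<Oplus>t\<in>{..<a + Suc b}. f t) = f (a + b) \<oplus> (\<Oplus>t\<in>{..<a + b}. f t)"
    using Suc.prems by (simp add: lessThan_Suc)
  also have "\<dots> = (\<Oplus>t\<in>{..<a}. f t) \<oplus> (f (a + b) \<oplus> (\<Oplus>t\<in>{..<b}. f (a + t)))"
    using cl Suc by (simp add: a_lcomm)
  also have "f (a + b) \<oplus> (\<Oplus>t\<in>{..<b}. f (a + t)) = (\<Oplus>t\<in>{..<Suc b}. f (a + t))"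
    using Suc.prems unfolding lessThan_Suc by (subst finsum_insert) auto
  finally show ?case .
qed

lemma (in cring) finsum_product:
  assumes "finite A" "finite B" "\<And>i. i \<in> A \<Longrightarrow> f i \<in> carrier R" "\<And>j. j \<in> B \<Longrightarrow> g j \<in> carrier R"
  shows "(\<Oplus>i\<in>A. f i) \<otimes> (\<Oplus>j\<in>B. g j) = (\<Oplus>p\<in>A \<times> B. f (fst p) \<otimes> g (snd p))"
proof -
  have gc: "(\<Oplus>j\<in>B. g j) \<in> carrier R" using assms(4) by (intro finsum_closed) auto
  have "(\<Oplus>i\<in>A. f i) \<otimes> (\<Oplus>j\<in>B. g j) = (\<Oplus>i\<in>A. f i \<otimes> (\<Oplus>j\<in>B. g j))"
    using assms gc by (intro finsum_ldistr) auto
  also have "\<dots> = (\<Oplus>i\<in>A. \<Oplus>j\<in>B. f i \<otimes> g j)"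
    using assms gc by (intro finsum_cong' finsum_rdistr) (auto intro!: finsum_closed)
  also have "\<dots> = (\<Oplus>p\<in>A \<times> B. f (fst p) \<otimes> g (snd p))"
    using assms by (intro finsum_Times) auto
  finally show ?thesis .
qed

section \<open>Shares: rerandomization and products\<close>

context evaluation_code
begin

text \<open>The value at the point of server \<open>n\<close> of a polynomial whose first
  \<open>K\<close> coefficients are data and whose last \<open>T\<close> are masks. The encodings of
  B use it too, with \<open>L\<close> in place of \<open>K\<close>.\<close>

definition share :: "(nat \<Rightarrow> nat) \<Rightarrow> nat \<Rightarrow> nat \<Rightarrow> (nat \<Rightarrow> 'a) \<Rightarrow> (nat \<Rightarrow> 'a) \<Rightarrow> nat \<Rightarrow> 'a" where
  "share \<alpha> K T d r n = (\<Oplus>t\<in>{..<K + T}. x n [^] \<alpha> t \<otimes> (if t < K then d t else r (t - K)))"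

lemma share_closed:
  assumes "n < N" "\<And>t. t < K \<Longrightarrow> d t \<in> carrier R" "\<And>t. t < T \<Longrightarrow> r t \<in> carrier R"
  shows "share \<alpha> K T d r n \<in> carrier R"
  unfolding share_def using assms x_closed by (intro finsum_closed) auto

lemma share_split:
  assumes "n < N" "\<And>t. t < K \<Longrightarrow> d t \<in> carrier R" "\<And>t. t < T \<Longrightarrow> r t \<in> carrier R"
  shows "share \<alpha> K T d r n
    = (\<Oplus>t\<in>{..<K}. x n [^] \<alpha> t \<otimes> d t) \<oplus> (\<Oplus>t\<in>{..<T}. x n [^] \<alpha> (K + t) \<otimes> r t)"
proof -
  have "share \<alpha> K T d r n = (\<Oplus>t\<in>{..<K}. x n [^] \<alpha> t \<otimes> (if t < K then d t else r (t - K)))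
    \<oplus> (\<Oplus>t\<in>{..<T}. x n [^] \<alpha> (K + t) \<otimes> (if K + t < K then d (K + t) else r (K + t - K)))"
    unfolding share_def using assms x_closed by (intro finsum_lessThan_add) auto
  also have "(\<Oplus>t\<in>{..<K}. x n [^] \<alpha> t \<otimes> (if t < K then d t else r (t - K)))
     = (\<Oplus>t\<in>{..<K}. x n [^] \<alpha> t \<otimes> d t)"
    using assms x_closed by (intro finsum_cong') auto
  finally show ?thesis by simp
qed

text \<open>The mask exponents are distinct, so the first \<open>card S\<close> of them form a
  square generalized Vandermonde system at the points of \<open>S\<close>; the masks beyond these
  are set to zero.\<close>

lemma mask_exists:
  assumes S: "S \<subseteq> {..<N}" "card S \<le> T" and inj: "inj_on \<alpha> {K..<K + T}" and D: "\<alpha> ` {K..<K + T} \<subseteq> {..D}"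
    and y: "\<And>n. n \<in> S \<Longrightarrow> y n \<in> carrier R"
  obtains r where "\<And>t. t < T \<Longrightarrow> r t \<in> carrier R"
    "\<And>n. n \<in> S \<Longrightarrow> (\<Oplus>t\<in>{..<T}. x n [^] \<alpha> (K + t) \<otimes> r t) = y n"
proof -
  let ?E = "\<alpha> ` (+) K ` {..<card S}"
  have img: "(+) K ` {..<card S} \<subseteq> {K..<K + T}" using S(2) by auto
  have injE: "inj_on \<alpha> ((+) K ` {..<card S})" using inj img by (rule inj_on_subset)
  have injE': "inj_on (\<lambda>t. \<alpha> (K + t)) {..<card S}"
    using comp_inj_on[OF _ injE] by (simp add: comp_def)
  have card: "card S = card ?E"
    using injE' by (simp add: image_image card_image)
  have E: "?E \<subseteq> {..D}" using D img by blast
  obtain c where c: "c \<in> ?E \<rightarrow> carrier R" and eq: "\<And>n. n \<in> S \<Longrightarrow> (\<Oplus>e\<in>?E. x n [^] e \<otimes> c e) = y n"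
    by (rule vandermonde_surj[OF S(1) E card, of y]) (use y in auto)
  have cc: "c (\<alpha> (K + t)) \<in> carrier R" if "t < card S" for t using c that by auto
  define r where "r t = (if t < card S then c (\<alpha> (K + t)) else \<zero>)" for t
  have "(\<Oplus>t\<in>{..<T}. x n [^] \<alpha> (K + t) \<otimes> r t) = y n" if n: "n \<in> S" for n
  proof -
    have xn: "x n \<in> carrier R" using n S x_closed by auto
    have "(\<Oplus>t\<in>{..<T}. x n [^] \<alpha> (K + t) \<otimes> r t) = (\<Oplus>t\<in>{..<card S}. x n [^] \<alpha> (K + t) \<otimes> c (\<alpha> (K + t)))"
      using S xn cc by (intro add.finprod_mono_neutral_cong_right) (auto simp: r_def)
    also have "\<dots> = (\<Oplus>e\<in>(\<lambda>t. \<alpha> (K + t)) ` {..<card S}. x n [^] e \<otimes> c e)"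
      using injE' xn cc by (intro finsum_reindex[symmetric]) auto
    also have "\<dots> = y n" using eq[OF n] by (simp add: image_image)
    finally show ?thesis .
  qed
  moreover have "r t \<in> carrier R" if "t < T" for t using cc by (simp add: r_def)
  ultimately show thesis using that by blast
qed

text \<open>A translation \<open>\<delta>\<close> of the masks compensates the change of data in
  everything that \<open>S\<close> sees. One \<open>\<delta>\<close> works for all masks
  \<open>r\<close> and all servers in \<open>S\<close>, which makes it a bijection of keys.\<close>

lemma share_rerandomize:
  assumes S: "S \<subseteq> {..<N}" "card S \<le> T" and inj: "inj_on \<alpha> {K..<K + T}" and D: "\<alpha> ` {K..<K + T} \<subseteq> {..D}"
    and d: "\<And>t. t < K \<Longrightarrow> d t \<in> carrier R" "\<And>t. t < K \<Longrightarrow> d' t \<in> carrier R"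
  shows "\<exists>\<delta>. (\<forall>t<T. \<delta> t \<in> carrier R) \<and> (\<forall>r n. (\<forall>t<T. r t \<in> carrier R) \<longrightarrow> n \<in> S \<longrightarrow>
      share \<alpha> K T d r n = share \<alpha> K T d' (\<lambda>t. r t \<oplus> \<delta> t) n)"
proof -
  define g where "g d n = (\<Oplus>t\<in>{..<K}. x n [^] \<alpha> t \<otimes> d t)" for d n
  have xn: "x n \<in> carrier R" if "n \<in> S" for n using that S x_closed by auto
  have g: "g d n \<in> carrier R" "g d' n \<in> carrier R" if "n \<in> S" for n
    using xn[OF that] d unfolding g_def by (auto intro!: finsum_closed)
  obtain \<delta> where \<delta>: "\<And>t. t < T \<Longrightarrow> \<delta> t \<in> carrier R"
    "\<And>n. n \<in> S \<Longrightarrow> (\<Oplus>t\<in>{..<T}. x n [^] \<alpha> (K + t) \<otimes> \<delta> t) = g d n \<ominus> g d' n"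
    by (rule mask_exists[OF S inj D, of "\<lambda>n. g d n \<ominus> g d' n"]) (use g in auto)
  have "share \<alpha> K T d r n = share \<alpha> K T d' (\<lambda>t. r t \<oplus> \<delta> t) n"
    if r: "\<And>t. t < T \<Longrightarrow> r t \<in> carrier R" and n: "n \<in> S" for r n
  proof -
    let ?h = "\<lambda>r. \<Oplus>t\<in>{..<T}. x n [^] \<alpha> (K + t) \<otimes> r t"
    have nN: "n < N" using n S by auto
    have hr: "?h r \<in> carrier R" using r xn[OF n] by (intro finsum_closed) auto
    have "share \<alpha> K T d' (\<lambda>t. r t \<oplus> \<delta> t) n = g d' n \<oplus> ?h (\<lambda>t. r t \<oplus> \<delta> t)"
      unfolding g_def using r \<delta> d nN by (intro share_split) auto
    also have "?h (\<lambda>t. r t \<oplus> \<delta> t) = (\<Oplus>t\<in>{..<T}. x n [^] \<alpha> (K + t) \<otimes> r t \<oplus> x n [^] \<alpha> (K + t) \<otimes> \<delta> t)"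
      using r \<delta>(1) xn[OF n] by (intro finsum_cong') (auto simp: r_distr)
    also have "\<dots> = ?h r \<oplus> ?h \<delta>"
      using r \<delta>(1) xn[OF n] by (intro finsum_addf) auto
    also have "g d' n \<oplus> (?h r \<oplus> ?h \<delta>) = g d n \<oplus> ?h r"
      using hr g[OF n] by (simp add: \<delta>(2)[OF n] minus_eq a_lcomm[of _ "g d n"] r_neg2) (simp add: a_comm r_neg2)
    also have "\<dots> = share \<alpha> K T d r n"
      unfolding g_def using r d nN by (intro share_split[symmetric]) auto
    finally show ?thesis by simp
  qed
  then show ?thesis using \<delta>(1) by (intro exI[of _ \<delta>]) simp
qed

lemma bij_betw_translate:
  assumes I: "finite I" and \<delta>: "\<And>i. i \<in> I \<Longrightarrow> \<delta> i \<in> carrier R"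
  shows "bij_betw (\<lambda>r. \<lambda>i\<in>I. r i \<oplus> \<delta> i) (I \<rightarrow>\<^sub>E carrier R) (I \<rightarrow>\<^sub>E carrier R)"
proof -
  let ?f = "\<lambda>r. \<lambda>i\<in>I. r i \<oplus> \<delta> i" and ?X = "I \<rightarrow>\<^sub>E carrier R"
  have "inj_on ?f ?X"
  proof (intro inj_onI PiE_ext)
    fix r r' i assume r: "r \<in> ?X" "r' \<in> ?X" "?f r = ?f r'" and i: "i \<in> I"
    have "r i \<in> carrier R" "r' i \<in> carrier R" using r i by auto
    then show "r i = r' i" using fun_cong[OF r(3), of i] i \<delta> by simp
  qed auto
  moreover have "?f ` ?X \<subseteq> ?X" using \<delta> by (auto dest: PiE_mem)
  moreover have "finite ?X" using I fin by (intro finite_PiE) auto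
  ultimately show ?thesis by (simp add: bij_betw_def endo_inj_surj)
qed

lemma shares_rerandomize:
  assumes S: "S \<subseteq> {..<N}" "card S \<le> T" and inj: "inj_on \<alpha> {K..<K + T}" and D: "\<alpha> ` {K..<K + T} \<subseteq> {..D}"
    and Q: "finite Q" and d: "\<And>q t. q \<in> Q \<Longrightarrow> t < K \<Longrightarrow> d q t \<in> carrier R"
      "\<And>q t. q \<in> Q \<Longrightarrow> t < K \<Longrightarrow> d' q t \<in> carrier R"
  obtains \<phi> where "bij_betw \<phi> (Q \<times> {..<T} \<rightarrow>\<^sub>E carrier R) (Q \<times> {..<T} \<rightarrow>\<^sub>E carrier R)"
    "\<And>r n q. r \<in> Q \<times> {..<T} \<rightarrow>\<^sub>E carrier R \<Longrightarrow> n \<in> S \<Longrightarrow> q \<in> Q \<Longrightarrow>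
      share \<alpha> K T (d q) (\<lambda>t. r (q, t)) n = share \<alpha> K T (d' q) (\<lambda>t. \<phi> r (q, t)) n"
proof -
  let ?P = "\<lambda>q \<delta>. (\<forall>t<T. \<delta> t \<in> carrier R) \<and> (\<forall>r n. (\<forall>t<T. r t \<in> carrier R) \<longrightarrow> n \<in> S \<longrightarrow>
      share \<alpha> K T (d q) r n = share \<alpha> K T (d' q) (\<lambda>t. r t \<oplus> \<delta> t) n)"
  have "\<forall>q\<in>Q. \<exists>\<delta>. ?P q \<delta>"
    using share_rerandomize[OF S inj D d] by simp
  from bchoice[OF this] obtain \<delta> where \<delta>: "\<forall>q\<in>Q. ?P q (\<delta> q)" ..
  define \<phi> where "\<phi> r = (\<lambda>i\<in>Q \<times> {..<T}. r i \<oplus> \<delta> (fst i) (snd i))" for r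
  show thesis
  proof
    show "bij_betw \<phi> (Q \<times> {..<T} \<rightarrow>\<^sub>E carrier R) (Q \<times> {..<T} \<rightarrow>\<^sub>E carrier R)"
      unfolding \<phi>_def using Q \<delta> by (intro bij_betw_translate) auto
    fix r n q assume r: "r \<in> Q \<times> {..<T} \<rightarrow>\<^sub>E carrier R" and n: "n \<in> S" and q: "q \<in> Q"
    have "\<forall>t<T. r (q, t) \<in> carrier R" using r q by auto
    then have "share \<alpha> K T (d q) (\<lambda>t. r (q, t)) n = share \<alpha> K T (d' q) (\<lambda>t. r (q, t) \<oplus> \<delta> q t) n"
      using bspec[OF \<delta> q] n by simp
    also have "\<dots> = share \<alpha> K T (d' q) (\<lambda>t. \<phi> r (q, t)) n"
      unfolding share_def
    proof (intro finsum_cong')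
      fix t assume t: "t \<in> {..<K + T}"
      then show "x n [^] \<alpha> t \<otimes> (if t < K then d' q t else r (q, t - K) \<oplus> \<delta> q (t - K)) =
          x n [^] \<alpha> t \<otimes> (if t < K then d' q t else \<phi> r (q, t - K))"
        using q by (auto simp: \<phi>_def)
    next
      have "\<phi> r (q, t) \<in> carrier R" if "t < T" for t
        using that q r bspec[OF \<delta> q] by (auto simp: \<phi>_def dest: PiE_mem)
      then show "(\<lambda>t. x n [^] \<alpha> t \<otimes> (if t < K then d' q t else \<phi> r (q, t - K))) \<in> {..<K + T} \<rightarrow> carrier R"
        using n S x_closed d(2)[OF q] by auto
    qed simp
    finally show "share \<alpha> K T (d q) (\<lambda>t. r (q, t)) n = share \<alpha> K T (d' q) (\<lambda>t. \<phi> r (q, t)) n" .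
  qed
qed

text \<open>The sum over \<open>z\<close> is one entry of a matrix product. Expanding both shares
  and grouping by exponent exhibits it as a polynomial with exponents in \<open>J\<close>.\<close>

lemma shares_product:
  fixes k :: nat
  assumes n: "n < N" and J: "finite J" "\<And>i j. i < K + T \<Longrightarrow> j < L + T \<Longrightarrow> \<alpha> i + \<beta> j \<in> J"
    and A: "\<And>z t. z < k \<Longrightarrow> t < K \<Longrightarrow> dA z t \<in> carrier R" "\<And>z t. z < k \<Longrightarrow> t < T \<Longrightarrow> rA z t \<in> carrier R"
    and B: "\<And>z t. z < k \<Longrightarrow> t < L \<Longrightarrow> dB z t \<in> carrier R" "\<And>z t. z < k \<Longrightarrow> t < T \<Longrightarrow> rB z t \<in> carrier R"
  shows "(\<Oplus>z\<in>{..<k}. share \<alpha> K T (dA z) (rA z) n \<otimes> share \<beta> L T (dB z) (rB z) n)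
    = (\<Oplus>e\<in>J. x n [^] e \<otimes>
        (\<Oplus>p\<in>{p \<in> {..<K + T} \<times> {..<L + T}. \<alpha> (fst p) + \<beta> (snd p) = e}. \<Oplus>z\<in>{..<k}.
          (if fst p < K then dA z (fst p) else rA z (fst p - K)) \<otimes>
          (if snd p < L then dB z (snd p) else rB z (snd p - L))))"
proof -
  define a where "a z t = (if t < K then dA z t else rA z (t - K))" for z t
  define b where "b z t = (if t < L then dB z t else rB z (t - L))" for z t
  let ?I = "{..<K + T} \<times> {..<L + T}"
  have a: "a z t \<in> carrier R" if "z < k" "t < K + T" for z t
    using that A by (auto simp: a_def)
  have b: "b z t \<in> carrier R" if "z < k" "t < L + T" for z t
    using that B by (auto simp: b_def)
  have xn: "x n \<in> carrier R" using n by (rule x_closed)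
  define q where "q p = (\<Oplus>z\<in>{..<k}. a z (fst p) \<otimes> b z (snd p))" for p
  have q: "q p \<in> carrier R" if "p \<in> ?I" for p
    using that a b unfolding q_def by (intro finsum_closed) auto
  have "(\<Oplus>z\<in>{..<k}. share \<alpha> K T (dA z) (rA z) n \<otimes> share \<beta> L T (dB z) (rB z) n)
    = (\<Oplus>z\<in>{..<k}. \<Oplus>p\<in>?I. x n [^] (\<alpha> (fst p) + \<beta> (snd p)) \<otimes> (a z (fst p) \<otimes> b z (snd p)))"
  proof (intro finsum_cong')
    fix z assume "z \<in> {..<k}"
    then have z: "z < k" by simp
    have "share \<alpha> K T (dA z) (rA z) n \<otimes> share \<beta> L T (dB z) (rB z) n
      = (\<Oplus>t\<in>{..<K + T}. x n [^] \<alpha> t \<otimes> a z t) \<otimes> (\<Oplus>t\<in>{..<L + T}. x n [^] \<beta> t \<otimes> b z t)"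
      by (simp add: share_def a_def b_def)
    also have "\<dots> = (\<Oplus>p\<in>?I. (x n [^] \<alpha> (fst p) \<otimes> a z (fst p)) \<otimes> (x n [^] \<beta> (snd p) \<otimes> b z (snd p)))"
      using a[OF z] b[OF z] xn by (intro finsum_product) auto
    also have "\<dots> = (\<Oplus>p\<in>?I. x n [^] (\<alpha> (fst p) + \<beta> (snd p)) \<otimes> (a z (fst p) \<otimes> b z (snd p)))"
      using a[OF z] b[OF z] xn by (intro finsum_cong') (auto simp: nat_pow_mult[symmetric] m_ac)
    finally show "share \<alpha> K T (dA z) (rA z) n \<otimes> share \<beta> L T (dB z) (rB z) n
      = (\<Oplus>p\<in>?I. x n [^] (\<alpha> (fst p) + \<beta> (snd p)) \<otimes> (a z (fst p) \<otimes> b z (snd p)))" .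
  qed (use a b xn in \<open>auto intro!: finsum_closed\<close>)
  also have "\<dots> = (\<Oplus>p\<in>?I. \<Oplus>z\<in>{..<k}. x n [^] (\<alpha> (fst p) + \<beta> (snd p)) \<otimes> (a z (fst p) \<otimes> b z (snd p)))"
    using a b xn by (intro finsum_swap) auto
  also have "\<dots> = (\<Oplus>p\<in>?I. x n [^] (\<alpha> (fst p) + \<beta> (snd p)) \<otimes> q p)"
    unfolding q_def using a b xn
    by (intro finsum_cong' finsum_rdistr[symmetric]) (auto intro!: finsum_closed)
  also have "\<dots> = (\<Oplus>e\<in>J. \<Oplus>p\<in>{p \<in> ?I. \<alpha> (fst p) + \<beta> (snd p) = e}. x n [^] (\<alpha> (fst p) + \<beta> (snd p)) \<otimes> q p)"
    using J xn q by (intro finsum_fibres) auto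
  also have "\<dots> = (\<Oplus>e\<in>J. x n [^] e \<otimes> (\<Oplus>p\<in>{p \<in> ?I. \<alpha> (fst p) + \<beta> (snd p) = e}. q p))"
  proof (intro finsum_cong')
    fix e assume "e \<in> J"
    have "(\<Oplus>p\<in>{p \<in> ?I. \<alpha> (fst p) + \<beta> (snd p) = e}. x n [^] (\<alpha> (fst p) + \<beta> (snd p)) \<otimes> q p)
      = (\<Oplus>p\<in>{p \<in> ?I. \<alpha> (fst p) + \<beta> (snd p) = e}. x n [^] e \<otimes> q p)"
      using xn q by (intro finsum_cong') auto
    also have "\<dots> = x n [^] e \<otimes> (\<Oplus>p\<in>{p \<in> ?I. \<alpha> (fst p) + \<beta> (snd p) = e}. q p)"
      using xn q by (intro finsum_rdistr[symmetric]) auto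
    finally show "(\<Oplus>p\<in>{p \<in> ?I. \<alpha> (fst p) + \<beta> (snd p) = e}. x n [^] (\<alpha> (fst p) + \<beta> (snd p)) \<otimes> q p)
      = x n [^] e \<otimes> (\<Oplus>p\<in>{p \<in> ?I. \<alpha> (fst p) + \<beta> (snd p) = e}. q p)" .
  qed (use xn q in \<open>auto intro!: finsum_closed\<close>)
  finally show ?thesis unfolding q_def a_def b_def .
qed

text \<open>At a desired exponent only one pair of coefficients contributes, by
  \<open>gasp_PM_fibre\<close>, and both are data.\<close>

lemma interpolate_shares_product:
  fixes k :: nat
  assumes J: "J = entries (gasp_PM K L r) (K + T) (L + T)" "J \<subseteq> {..D}" "card J = N"
    and u: "\<And>n. n < N \<Longrightarrow> u n \<in> carrier R" "\<And>n. n < N \<Longrightarrow> u n \<noteq> \<zero>"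
    and A: "\<And>z t. z < k \<Longrightarrow> t < K \<Longrightarrow> dA z t \<in> carrier R" "\<And>z t. z < k \<Longrightarrow> t < T \<Longrightarrow> rA z t \<in> carrier R"
    and B: "\<And>z t. z < k \<Longrightarrow> t < L \<Longrightarrow> dB z t \<in> carrier R" "\<And>z t. z < k \<Longrightarrow> t < T \<Longrightarrow> rB z t \<in> carrier R"
    and y: "\<And>n. n < N \<Longrightarrow> y n = u n \<otimes> (\<Oplus>z\<in>{..<k}. share (gasp_alpha K L r) K T (dA z) (rA z) n
              \<otimes> share (gasp_beta K L) L T (dB z) (rB z) n)"
    and ij: "i < K" "j < L"
  shows "interpolate J u y (i + K * j) = (\<Oplus>z\<in>{..<k}. dA z i \<otimes> dB z j)"
proof -
  let ?I = "{..<K + T} \<times> {..<L + T}"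
  let ?q = "\<lambda>p. \<Oplus>z\<in>{..<k}. (if fst p < K then dA z (fst p) else rA z (fst p - K)) \<otimes>
          (if snd p < L then dB z (snd p) else rB z (snd p - L))"
  let ?c = "\<lambda>e. \<Oplus>p\<in>{p \<in> ?I. gasp_alpha K L r (fst p) + gasp_beta K L (snd p) = e}. ?q p"
  have q: "?q p \<in> carrier R" if "p \<in> ?I" for p
    using that A B by (intro finsum_closed) auto
  have finJ: "finite J" using J finite_subset by blast
  have "interpolate J u y (i + K * j) = ?c (i + K * j)"
  proof (rule interpolate_eq[OF J(2,3) u])
    show "?c \<in> J \<rightarrow> carrier R" using q by (auto intro!: finsum_closed)
    show "u n \<otimes> (\<Oplus>e\<in>J. x n [^] e \<otimes> ?c e) = y n" if n: "n < N" for n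
      unfolding y[OF n]
      by (subst shares_product[OF n finJ _ A B])
        (auto simp: J(1) entries_def gasp_PM_def)
    show "i + K * j \<in> J"
      unfolding J(1) entries_def gasp_PM_UL[OF ij, symmetric, of r]
      by (intro CollectI exI[of _ i] exI[of _ j] conjI refl) (use ij in simp_all)
  qed
  also have "{p \<in> ?I. gasp_alpha K L r (fst p) + gasp_beta K L (snd p) = i + K * j} = {(i, j)}"
    using gasp_PM_fibre[OF ij, of T r] by (simp add: gasp_PM_def case_prod_unfold)
  also have "(\<Oplus>p\<in>{(i, j)}. ?q p) = ?q (i, j)"
    using q[of "(i, j)"] ij by (simp add: finsum_insert)
  also have "\<dots> = (\<Oplus>z\<in>{..<k}. dA z i \<otimes> dB z j)" using ij by simp
  finally show ?thesis .
qed

end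

section \<open>Schemes with a deterministic outcome\<close>

lemma born_cong:
  assumes "\<And>u v. u \<in> B \<Longrightarrow> v \<in> B \<Longrightarrow> \<rho> u v = \<rho>' u v"
  shows "born B M \<rho> = born B M \<rho>'"
  unfolding born_def qtrace_def qmult_def using assms by (simp cong: sum.cong)

definition outcome_law ::
    "'p set \<Rightarrow> 'q set \<Rightarrow> 'w set \<Rightarrow> ('p \<Rightarrow> 'q \<Rightarrow> 'w \<Rightarrow> nat) \<Rightarrow> 'p \<times> 'q \<times> 'w \<times> nat \<Rightarrow> real" where
  "outcome_law DA DB W f = (\<lambda>(A, B, w, y).
     1 / real (card DA) * (1 / real (card DB)) * (1 / real (card W)) * (if y = f A B w then 1 else 0))"

text \<open>Data and key are uniform and the outcome is a function of them, so every probability is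
  a normalised count of triples (A, B, w).\<close>

locale deterministic_outcome =
  fixes DA :: "'p set" and DB :: "'q set" and W :: "'w set" and f :: "'p \<Rightarrow> 'q \<Rightarrow> 'w \<Rightarrow> nat" and m :: nat
  assumes finite: "finite DA" "finite DB" "finite W"
    and nonempty: "DA \<noteq> {}" "DB \<noteq> {}" "W \<noteq> {}"
    and f: "\<And>A B w. A \<in> DA \<Longrightarrow> B \<in> DB \<Longrightarrow> w \<in> W \<Longrightarrow> f A B w < m"
begin

abbreviation "\<Omega> \<equiv> DA \<times> DB \<times> W \<times> {..<m}"
abbreviation "law \<equiv> outcome_law DA DB W f"
abbreviation "c \<equiv> 1 / real (card DA) * (1 / real (card DB)) * (1 / real (card W))"

lemma cards_pos: "card DA > 0" "card DB > 0" "card W > 0"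
  using finite nonempty by (auto simp: card_gt_0_iff)

lemma law_nonneg: "0 \<le> law \<omega>"
  by (auto simp: outcome_law_def split: prod.split)

text \<open>The law is supported on the graph of \<open>f\<close>, which projects bijectively onto
  the triples.\<close>

lemma law_marginal:
  "(\<Sum>\<omega> | \<omega> \<in> \<Omega> \<and> (case \<omega> of (A, B, w, y) \<Rightarrow> Q A B w). law \<omega>)
    = c * card {(A, B, w). A \<in> DA \<and> B \<in> DB \<and> w \<in> W \<and> Q A B w}"
proof -
  let ?S = "{(A, B, w). A \<in> DA \<and> B \<in> DB \<and> w \<in> W \<and> Q A B w}"
  let ?g = "\<lambda>(A, B, w). (A, B, w, f A B w)"
  have finO: "finite {\<omega>. \<omega> \<in> \<Omega> \<and> (case \<omega> of (A, B, w, y) \<Rightarrow> Q A B w)}"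
    by (rule finite_subset[of _ \<Omega>]) (use finite in auto)
  have "(\<Sum>\<omega> | \<omega> \<in> \<Omega> \<and> (case \<omega> of (A, B, w, y) \<Rightarrow> Q A B w). law \<omega>) = (\<Sum>\<omega>\<in>?g ` ?S. law \<omega>)"
  proof (rule sum.mono_neutral_right[OF finO])
    show "?g ` ?S \<subseteq> {\<omega>. \<omega> \<in> \<Omega> \<and> (case \<omega> of (A, B, w, y) \<Rightarrow> Q A B w)}"
      using f by auto
    show "\<forall>\<omega>\<in>{\<omega>. \<omega> \<in> \<Omega> \<and> (case \<omega> of (A, B, w, y) \<Rightarrow> Q A B w)} - ?g ` ?S. law \<omega> = 0"
    proof
      fix \<omega> assume w: "\<omega> \<in> {\<omega>. \<omega> \<in> \<Omega> \<and> (case \<omega> of (A, B, w, y) \<Rightarrow> Q A B w)} - ?g ` ?S"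
      obtain A B v y where 1: "\<omega> = (A, B, v, y)" by (cases \<omega>)
      have "(A, B, v) \<in> ?S" using w by (simp add: 1)
      then have "(A, B, v, f A B v) \<in> ?g ` ?S"
        using imageI[of "(A, B, v)" ?S ?g] by (simp only: prod.case)
      then have "y \<noteq> f A B v" using DiffD2[OF w] unfolding 1 by blast
      then show "law \<omega> = 0" by (simp add: 1 outcome_law_def)
    qed
  qed
  also have "\<dots> = (\<Sum>t\<in>?S. law (?g t))"
    by (subst sum.reindex) (auto simp: inj_on_def)
  also have "\<dots> = (\<Sum>t\<in>?S. c)"
    by (intro sum.cong) (auto simp: outcome_law_def)
  finally show ?thesis by simp
qed

lemma law_sum: "(\<Sum>\<omega>\<in>\<Omega>. law \<omega>) = 1"
proof -
  have "{\<omega>. \<omega> \<in> \<Omega> \<and> (case \<omega> of (A, B, w, y) \<Rightarrow> True)} = \<Omega>"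
    "{(A, B, w). A \<in> DA \<and> B \<in> DB \<and> w \<in> W \<and> True} = DA \<times> DB \<times> W" by auto
  with law_marginal[of "\<lambda>_ _ _. True"] have "(\<Sum>\<omega>\<in>\<Omega>. law \<omega>) = c * card (DA \<times> DB \<times> W)"
    by (simp only:)
  then show ?thesis using cards_pos by (simp add: card_cartesian_product)
qed

text \<open>A bijection of keys that carries the view of one data pair to that of another makes the
  number of keys behind a view independent of the data; \<open>q\<close> is that number, taken at a
  reference pair.\<close>

lemma mutual_info_eq_0:
  fixes E :: "'p \<Rightarrow> 'q \<Rightarrow> 'w \<Rightarrow> 'e"
  assumes rerandomize: "\<And>A B A' B'. A \<in> DA \<Longrightarrow> B \<in> DB \<Longrightarrow> A' \<in> DA \<Longrightarrow> B' \<in> DB \<Longrightarrow>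
    \<exists>\<phi>. bij_betw \<phi> W W \<and> (\<forall>w\<in>W. E A B w = E A' B' (\<phi> w))"
  shows "mutual_info (point_measure \<Omega> (\<lambda>\<omega>. ennreal (law \<omega>)))
    (\<lambda>(A, B, w, y). E A B w) (\<lambda>(A, B, w, y). (A, B)) = 0"
proof (rule mutual_info_point_measure_eq_0)
  obtain A0 B0 where AB0: "A0 \<in> DA" "B0 \<in> DB" using nonempty by blast
  define q where "q e = card {w \<in> W. E A0 B0 w = e}" for e
  have q: "card {w \<in> W. E A B w = e} = q e" if AB: "A \<in> DA" "B \<in> DB" for A B e
  proof -
    obtain \<phi> where \<phi>: "bij_betw \<phi> W W" "\<forall>w\<in>W. E A B w = E A0 B0 (\<phi> w)"
      using rerandomize[OF AB AB0] by blast
    have "\<phi> ` {w \<in> W. E A B w = e} = {w \<in> W. E A0 B0 w = e}"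
    proof (intro equalityI subsetI)
      fix w assume w: "w \<in> {w \<in> W. E A0 B0 w = e}"
      then obtain w' where "w' \<in> W" "w = \<phi> w'" using \<phi>(1) by (auto simp: bij_betw_def)
      then show "w \<in> \<phi> ` {w \<in> W. E A B w = e}" using w \<phi>(2) by auto
    qed (use \<phi> bij_betwE[OF \<phi>(1)] in auto)
    then have "bij_betw \<phi> {w \<in> W. E A B w = e} {w \<in> W. E A0 B0 w = e}"
      using \<phi>(1) by (auto simp: bij_betw_def intro: inj_on_subset)
    then show ?thesis unfolding q_def by (rule bij_betw_same_card)
  qed
  fix e :: 'e and ab :: "'p \<times> 'q"
  obtain a b where ab: "ab = (a, b)" by (cases ab)
  have both: "(\<Sum>\<omega> | \<omega> \<in> \<Omega> \<and> (case \<omega> of (A, B, w, y) \<Rightarrow> E A B w) = e \<and> (case \<omega> of (A, B, w, y) \<Rightarrow> (A, B)) = ab. law \<omega>)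
    = c * card {(A, B, w). A \<in> DA \<and> B \<in> DB \<and> w \<in> W \<and> E A B w = e \<and> (A, B) = ab}"
    by (rule trans[OF sum.cong[OF _ refl] law_marginal[of "\<lambda>A B w. E A B w = e \<and> (A, B) = ab"]]) (auto simp del: Pair_inject)
  have left: "(\<Sum>\<omega> | \<omega> \<in> \<Omega> \<and> (case \<omega> of (A, B, w, y) \<Rightarrow> E A B w) = e. law \<omega>)
    = c * card {(A, B, w). A \<in> DA \<and> B \<in> DB \<and> w \<in> W \<and> E A B w = e}"
    by (rule trans[OF sum.cong[OF _ refl] law_marginal[of "\<lambda>A B w. E A B w = e"]]) (auto simp del: Pair_inject)
  have right: "(\<Sum>\<omega> | \<omega> \<in> \<Omega> \<and> (case \<omega> of (A, B, w, y) \<Rightarrow> (A, B)) = ab. law \<omega>)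
    = c * card {(A, B, w). A \<in> DA \<and> B \<in> DB \<and> w \<in> W \<and> (A, B) = ab}"
    by (rule trans[OF sum.cong[OF _ refl] law_marginal[of "\<lambda>A B w. (A, B) = ab"]]) (auto simp del: Pair_inject)
  have card_left: "card {(A, B, w). A \<in> DA \<and> B \<in> DB \<and> w \<in> W \<and> E A B w = e} = card DA * card DB * q e"
  proof -
    have "{(A, B, w). A \<in> DA \<and> B \<in> DB \<and> w \<in> W \<and> E A B w = e}
      = Sigma DA (\<lambda>A. Sigma DB (\<lambda>B. {w \<in> W. E A B w = e}))" by auto
    then show ?thesis
      using finite by (simp add: card_SigmaI q mult.assoc)
  qed
  show "(\<Sum>\<omega> | \<omega> \<in> \<Omega> \<and> (case \<omega> of (A, B, w, y) \<Rightarrow> E A B w) = e \<and> (case \<omega> of (A, B, w, y) \<Rightarrow> (A, B)) = ab. law \<omega>)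
    = (\<Sum>\<omega> | \<omega> \<in> \<Omega> \<and> (case \<omega> of (A, B, w, y) \<Rightarrow> E A B w) = e. law \<omega>)
      * (\<Sum>\<omega> | \<omega> \<in> \<Omega> \<and> (case \<omega> of (A, B, w, y) \<Rightarrow> (A, B)) = ab. law \<omega>)"
  proof (cases "a \<in> DA \<and> b \<in> DB")
    case True
    have "{(A, B, w). A \<in> DA \<and> B \<in> DB \<and> w \<in> W \<and> E A B w = e \<and> (A, B) = ab}
      = (\<lambda>w. (a, b, w)) ` {w \<in> W. E a b w = e}" using True by (auto simp: ab)
    then have 1: "card {(A, B, w). A \<in> DA \<and> B \<in> DB \<and> w \<in> W \<and> E A B w = e \<and> (A, B) = ab} = q e"
      using True q by (simp add: card_image inj_on_def)
    have "{(A, B, w). A \<in> DA \<and> B \<in> DB \<and> w \<in> W \<and> (A, B) = ab} = (\<lambda>w. (a, b, w)) ` W"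
      using True by (auto simp: ab)
    then have 2: "card {(A, B, w). A \<in> DA \<and> B \<in> DB \<and> w \<in> W \<and> (A, B) = ab} = card W"
      by (simp add: card_image inj_on_def)
    show ?thesis unfolding both left right 1 2 card_left using cards_pos by simp
  next
    case False
    then have 3: "{(A, B, w). A \<in> DA \<and> B \<in> DB \<and> w \<in> W \<and> E A B w = e \<and> (A, B) = ab} = {}"
      and 4: "{(A, B, w). A \<in> DA \<and> B \<in> DB \<and> w \<in> W \<and> (A, B) = ab} = {}" by (auto simp: ab)
    show ?thesis unfolding both right 3 4 by simp
  qed
qed (use finite law_nonneg law_sum in auto)

lemma cond_entropy_eq_0:
  assumes "\<And>A B w A' B' w'. A \<in> DA \<Longrightarrow> B \<in> DB \<Longrightarrow> w \<in> W \<Longrightarrow> A' \<in> DA \<Longrightarrow> B' \<in> DB \<Longrightarrow> w' \<in> W \<Longrightarrow>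
    f A B w = f A' B' w' \<Longrightarrow> g A B = g A' B'"
  shows "cond_entropy (point_measure \<Omega> (\<lambda>\<omega>. ennreal (law \<omega>)))
    (\<lambda>(A, B, w, y). g A B) (\<lambda>(A, B, w, y). y) = 0"
proof (rule cond_entropy_point_measure_eq_0)
  fix \<omega> \<omega>' assume w: "\<omega> \<in> \<Omega>" "\<omega>' \<in> \<Omega>" "0 < law \<omega>" "0 < law \<omega>'"
    and eq: "(case \<omega> of (A, B, w, y) \<Rightarrow> y) = (case \<omega>' of (A, B, w, y) \<Rightarrow> y)"
  obtain A B v y where 1: "\<omega> = (A, B, v, y)" by (cases \<omega>)
  obtain A' B' v' y' where 2: "\<omega>' = (A', B', v', y')" by (cases \<omega>')
  have "y = f A B v" "y' = f A' B' v'"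
    using w(3,4) by (auto simp: 1 2 outcome_law_def split: if_splits)
  then show "(case \<omega> of (A, B, w, y) \<Rightarrow> g A B) = (case \<omega>' of (A, B, w, y) \<Rightarrow> g A B)"
    using assms[of A B v A' B' v'] w(1,2) eq by (simp add: 1 2)
qed (use finite law_nonneg law_sum in auto)

end

section \<open>The quantum GASP scheme\<close>

lemma point_measure_cong:
  "(\<And>x. x \<in> A \<Longrightarrow> f x = g x) \<Longrightarrow> point_measure A f = point_measure A g"
  unfolding point_measure_def by (rule density_cong) (auto simp: AE_count_space)

text \<open>The choices of points, run and multipliers are fixed as parameters. \<open>s\<close>,
  \<open>k\<close> and \<open>l\<close> are block dimensions, and \<open>D\<close> bounds the
  exponents both of the code and of the duality relations.\<close>

locale gasp_scheme = evaluation_code R x N D + field_character R \<theta>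
  for R :: "'a ring" (structure) and x N D \<theta> +
  fixes K L T r s k l a k1 :: nat and v :: "nat \<Rightarrow> 'a"
  assumes pos: "1 \<le> K" "1 \<le> s" "1 \<le> l" "1 \<le> T" and r: "1 \<le> r" "r \<le> K"
    and J_D: "entries (gasp_PM K L r) (K + T) (L + T) \<subseteq> {..D}"
    and card_J: "card (entries (gasp_PM K L r) (K + T) (L + T)) = N"
    and run: "{a..<a + k1} \<subseteq> gasp_IS K L T r"
    and k1: "k1 \<le> N" "N - k1 \<le> k1"
    and D: "a + N \<le> Suc D" "2 * a + N \<le> Suc D"
    and v: "\<And>n. n < N \<Longrightarrow> v n \<in> carrier R" "\<And>n. n < N \<Longrightarrow> v n \<noteq> \<zero>"
    and dual: "\<And>e. e \<in> {2 * a..<2 * a + (N - 1)} \<Longrightarrow> (\<Oplus>n\<in>{..<N}. x n [^] e \<otimes> v n) = \<zero>"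
begin

abbreviation "J \<equiv> entries (gasp_PM K L r) (K + T) (L + T)"
abbreviation "P \<equiv> {..<s} \<times> {..<l}"
abbreviation "H \<equiv> composite N (fmat R s l)"
abbreviation "G \<equiv> mat_group R N s l"
abbreviation "run_exps \<equiv> {a..<a + k1}"
abbreviation "rand_A \<equiv> (({..<2::nat} \<times> ({..<s} \<times> {..<k})) \<times> {..<T}) \<rightarrow>\<^sub>E carrier R"
abbreviation "rand_B \<equiv> (({..<2::nat} \<times> ({..<k} \<times> {..<l})) \<times> {..<T}) \<rightarrow>\<^sub>E carrier R"

definition u :: "nat \<Rightarrow> nat \<Rightarrow> 'a" where
  "u i n = (if i = 0 then \<one> else v n)"

text \<open>Row \<open>t * s + fst p\<close> is row \<open>fst p\<close> of block \<open>t\<close>.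
  Every instance and every position in a block is shared separately, with its own \<open>T\<close>
  masks.\<close>

definition enc_A :: "nat \<Rightarrow> 'a insts \<Rightarrow> ((nat \<times> nat \<times> nat) \<times> nat \<Rightarrow> 'a) \<Rightarrow> 'a insts" where
  "enc_A n A w = (\<lambda>i\<in>{..<2}. \<lambda>p\<in>{..<s} \<times> {..<k}.
     share (gasp_alpha K L r) K T (\<lambda>t. A i (t * s + fst p, snd p)) (\<lambda>t. w ((i, p), t)) n)"

definition enc_B :: "nat \<Rightarrow> 'a insts \<Rightarrow> ((nat \<times> nat \<times> nat) \<times> nat \<Rightarrow> 'a) \<Rightarrow> 'a insts" where
  "enc_B n B w = (\<lambda>i\<in>{..<2}. \<lambda>p\<in>{..<k} \<times> {..<l}.
     share (gasp_beta K L) L T (\<lambda>t. B i (fst p, t * l + snd p)) (\<lambda>t. w ((i, p), t)) n)"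

definition respond :: "nat \<Rightarrow> nat \<Rightarrow> 'a insts \<Rightarrow> 'a insts \<Rightarrow> 'a mtx" where
  "respond i n f g = (\<lambda>p\<in>P. u i n \<otimes> fmat_mult R s k l (f i) (g i) p)"

definition answers :: "'a insts \<Rightarrow> 'a insts \<Rightarrow> ((nat \<times> nat \<times> nat) \<times> nat \<Rightarrow> 'a) \<times> ((nat \<times> nat \<times> nat) \<times> nat \<Rightarrow> 'a)
    \<Rightarrow> nat \<Rightarrow> nat \<Rightarrow> 'a mtx" where
  "answers A B w i = (\<lambda>n\<in>{..<N}. respond i n (enc_A n A (fst w)) (enc_B n B (snd w)))"

text \<open>The code is imposed at each entry position separately: one copy for each of the qudits
  that a server holds.\<close>

definition V :: "(nat \<Rightarrow> 'a mtx) set" where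
  "V = {X \<in> H. \<forall>p\<in>P. \<exists>c\<in>run_exps \<rightarrow> carrier R. \<forall>n<N. X n p = (\<Oplus>e\<in>run_exps. x n [^] e \<otimes> c e)}"

text \<open>The desired block \<open>(i, j)\<close> of each product is the coefficient of exponent \<open>i + K * j\<close>.
  Instance 0 sits in the shifts \<open>X\<close>, instance 1 in the phases \<open>Z\<close>.\<close>

definition decode :: "(nat \<Rightarrow> 'a mtx) \<Rightarrow> (nat \<Rightarrow> 'a mtx) \<Rightarrow> 'a insts" where
  "decode X Z = (\<lambda>i\<in>{..<2}. \<lambda>p\<in>{..<K * s} \<times> {..<l * L}.
     interpolate J (u i) (\<lambda>n. (if i = 0 then X else Z) n (fst p mod s, snd p mod l))
       (fst p div s + K * (snd p div l)))"

lemma pw: "n < N \<Longrightarrow> x n [^] (e::nat) \<in> carrier R"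
  using x_closed by simp

lemma u: "n < N \<Longrightarrow> u i n \<in> carrier R" "n < N \<Longrightarrow> u i n \<noteq> \<zero>"
  using v by (auto simp: u_def)

lemma UL_exponent:
  assumes "i < K" "j < L"
  shows "i + K * j \<in> J - run_exps"
proof -
  have "i + K * j \<in> J"
    unfolding entries_def gasp_PM_UL[OF assms, symmetric, of r]
    by (intro CollectI exI[of _ i] exI[of _ j] conjI refl) (use assms in simp_all)
  moreover have "i + K * j \<notin> gasp_IS K L T r"
    using mixed_radix_less[OF assms] by (simp add: gasp_IS_def gasp_UL_eq)
  ultimately show ?thesis using run by blast
qed

lemma run_J: "run_exps \<subseteq> J"
  using run by (auto simp: gasp_IS_def)

lemma V_H: "X \<in> V \<Longrightarrow> X \<in> H"
  by (simp add: V_def)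

lemma V_subgroup: "subgroup V G"
proof -
  interpret G: comm_group G by (rule comm_group_mat_group)
  have one: "\<one>\<^bsub>G\<^esub> \<in> V"
    unfolding V_def
  proof (intro CollectI conjI ballI)
    fix p assume p: "p \<in> P"
    show "\<exists>c\<in>run_exps \<rightarrow> carrier R. \<forall>n<N. \<one>\<^bsub>G\<^esub> n p = (\<Oplus>e\<in>run_exps. x n [^] e \<otimes> c e)"
    proof (intro bexI[of _ "\<lambda>_. \<zero>"] allI impI)
      fix n assume n: "n < N"
      have "(\<Oplus>e\<in>run_exps. x n [^] e \<otimes> \<zero>) = (\<Oplus>e\<in>run_exps. \<zero>)"
        using pw[OF n] by (intro finsum_cong') auto
      then show "\<one>\<^bsub>G\<^esub> n p = (\<Oplus>e\<in>run_exps. x n [^] e \<otimes> \<zero>)" using n p by simp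
    qed auto
  qed (rule mat_group_one_closed)
  have diff: "X \<otimes>\<^bsub>G\<^esub> inv\<^bsub>G\<^esub> Y \<in> V" if X: "X \<in> V" and Y: "Y \<in> V" for X Y
    unfolding V_def
  proof (intro CollectI conjI ballI)
    show "X \<otimes>\<^bsub>G\<^esub> inv\<^bsub>G\<^esub> Y \<in> H"
      using G.m_closed[of X "inv\<^bsub>G\<^esub> Y"] G.inv_closed[of Y] V_H[OF X] V_H[OF Y] by simp
    fix p assume p: "p \<in> P"
    obtain c where c: "c \<in> run_exps \<rightarrow> carrier R" "\<And>n. n < N \<Longrightarrow> X n p = (\<Oplus>e\<in>run_exps. x n [^] e \<otimes> c e)"
      using X p unfolding V_def by blast
    obtain c' where c': "c' \<in> run_exps \<rightarrow> carrier R" "\<And>n. n < N \<Longrightarrow> Y n p = (\<Oplus>e\<in>run_exps. x n [^] e \<otimes> c' e)"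
      using Y p unfolding V_def by blast
    show "\<exists>c\<in>run_exps \<rightarrow> carrier R. \<forall>n<N. (X \<otimes>\<^bsub>G\<^esub> inv\<^bsub>G\<^esub> Y) n p = (\<Oplus>e\<in>run_exps. x n [^] e \<otimes> c e)"
    proof (intro bexI[of _ "\<lambda>e. c e \<ominus> c' e"] allI impI)
      fix n assume n: "n < N"
      have "(X \<otimes>\<^bsub>G\<^esub> inv\<^bsub>G\<^esub> Y) n p = X n p \<ominus> Y n p"
        using mat_group_inv_apply[OF V_H[OF Y] n p] n p by (simp add: minus_eq)
      also have "\<dots> = (\<Oplus>e\<in>run_exps. x n [^] e \<otimes> (c e \<ominus> c' e))"
        unfolding c(2)[OF n] c'(2)[OF n] using pw[OF n] c(1) c'(1)
        by (intro matrix_apply_minus[symmetric]) auto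
      finally show "(X \<otimes>\<^bsub>G\<^esub> inv\<^bsub>G\<^esub> Y) n p = (\<Oplus>e\<in>run_exps. x n [^] e \<otimes> (c e \<ominus> c' e))" .
    qed (use c(1) c'(1) in auto)
  qed
  have inv: "inv\<^bsub>G\<^esub> Y \<in> V" if "Y \<in> V" for Y
    using diff[OF one that] G.inv_closed[of Y] V_H[OF that] by simp
  show ?thesis
  proof (rule G.subgroupI)
    show "V \<subseteq> carrier G" using V_H by auto
    show "V \<noteq> {}" using one by blast
    show "X \<otimes>\<^bsub>G\<^esub> Y \<in> V" if "X \<in> V" "Y \<in> V" for X Y
      using diff[OF that(1) inv[OF that(2)]] V_H[OF that(2)] by simp
  qed (rule inv)
qed

sublocale Q: phase_space G "cchar N s l" V
  by (rule phase_space_mat_group[OF V_subgroup])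

text \<open>The probe is the codeword \<open>g \<otimes> x n [^] e\<close>, placed at the position
  \<open>p\<close> alone. Its character value turns a statement about phases on \<open>V\<close>
  into one about a linear functional of \<open>Z\<close>.\<close>

lemma cchar_probe:
  assumes Z: "Z \<in> H" and p: "p \<in> P" and e: "e \<in> run_exps" and g: "g \<in> carrier R"
  defines "c \<equiv> (\<lambda>n\<in>{..<N}. \<lambda>p'\<in>P. if p' = p then g \<otimes> x n [^] e else \<zero>)"
  shows "c \<in> V" and "cchar N s l Z c = \<theta> (g \<otimes> (\<Oplus>n\<in>{..<N}. x n [^] e \<otimes> Z n p))"
proof -
  have Zc: "Z n p' \<in> carrier R" if "n < N" "p' \<in> P" for n p'
    using composite_entry[OF Z that] .
  show "c \<in> V"
    unfolding V_def
  proof (intro CollectI conjI ballI)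
    show "c \<in> H" unfolding c_def using g pw by (intro composite_fmatI) auto
    fix p' assume p': "p' \<in> P"
    show "\<exists>d\<in>run_exps \<rightarrow> carrier R. \<forall>n<N. c n p' = (\<Oplus>e'\<in>run_exps. x n [^] e' \<otimes> d e')"
    proof (intro bexI[of _ "\<lambda>e'. if e' = e \<and> p' = p then g else \<zero>"] allI impI)
      fix n assume n: "n < N"
      have "(\<Oplus>e'\<in>run_exps. x n [^] e' \<otimes> (if e' = e \<and> p' = p then g else \<zero>))
        = (\<Oplus>e'\<in>run_exps. if e = e' then (if p' = p then x n [^] e' \<otimes> g else \<zero>) else \<zero>)"
        using pw[OF n] g by (intro finsum_cong') auto
      also have "\<dots> = (if p' = p then x n [^] e \<otimes> g else \<zero>)"
        using pw[OF n] g e by (subst add.finprod_singleton) auto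
      finally show "c n p' = (\<Oplus>e'\<in>run_exps. x n [^] e' \<otimes> (if e' = e \<and> p' = p then g else \<zero>))"
        using n p' g pw[OF n] by (simp add: c_def m_comm del: mem_Sigma_iff)
    qed (use g in auto)
  qed
  have "cchar N s l Z c = (\<Prod>n<N. \<theta> (Z n p \<otimes> (g \<otimes> x n [^] e)))"
    unfolding cchar_def
  proof (intro prod.cong refl)
    fix n assume "n \<in> {..<N}"
    then have n: "n < N" by simp
    have "mchar s l (Z n) (c n) = (\<Prod>p'\<in>P. if p' = p then \<theta> (Z n p \<otimes> (g \<otimes> x n [^] e)) else 1)"
      unfolding mchar_def
      by (intro prod.cong refl)
        (use n Zc[OF n] in \<open>simp add: c_def theta_zero del: mem_Sigma_iff\<close>)
    also have "\<dots> = \<theta> (Z n p \<otimes> (g \<otimes> x n [^] e))"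
      using p by (simp del: mem_Sigma_iff)
    finally show "mchar s l (Z n) (c n) = \<theta> (Z n p \<otimes> (g \<otimes> x n [^] e))" .
  qed
  also have "\<dots> = \<theta> (\<Oplus>n\<in>{..<N}. Z n p \<otimes> (g \<otimes> x n [^] e))"
    using Zc p g pw by (intro theta_finsum[symmetric]) auto
  also have "(\<Oplus>n\<in>{..<N}. Z n p \<otimes> (g \<otimes> x n [^] e)) = (\<Oplus>n\<in>{..<N}. g \<otimes> (x n [^] e \<otimes> Z n p))"
    using Zc p g pw by (intro finsum_cong') (auto simp: m_ac)
  also have "\<dots> = g \<otimes> (\<Oplus>n\<in>{..<N}. x n [^] e \<otimes> Z n p)"
    using Zc p g pw by (intro finsum_rdistr[symmetric]) auto
  finally show "cchar N s l Z c = \<theta> (g \<otimes> (\<Oplus>n\<in>{..<N}. x n [^] e \<otimes> Z n p))" .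
qed

text \<open>Shifts that agree modulo \<open>V\<close> differ by polynomials on the run. Phases that
  agree on \<open>V\<close> differ by a word of the dual code, which is \<open>v\<close> times a
  polynomial on part of the run. In both cases the coefficients at desired exponents are
  untouched.\<close>

lemma decode_invariant:
  assumes H: "X \<in> H" "Z \<in> H" "X' \<in> H" "Z' \<in> H"
    and X: "X \<otimes>\<^bsub>G\<^esub> inv\<^bsub>G\<^esub> X' \<in> V"
    and Z: "\<And>c. c \<in> V \<Longrightarrow> cchar N s l Z c = cchar N s l Z' c"
  shows "decode X Z = decode X' Z'"
  unfolding decode_def
proof (intro restrict_ext)
  fix i p assume i: "i \<in> {..<2::nat}" and p: "p \<in> {..<K * s} \<times> {..<l * L}"
  let ?p = "(fst p mod s, snd p mod l)"
  let ?e = "fst p div s + K * (snd p div l)"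
  have pP: "?p \<in> P" using pos by auto
  have ij: "fst p div s < K" "snd p div l < L"
    using p by (auto simp: less_mult_imp_div_less mult.commute)
  have e: "?e \<in> J - run_exps" by (rule UL_exponent[OF ij])
  have cl: "X n ?p \<in> carrier R" "Z n ?p \<in> carrier R" "X' n ?p \<in> carrier R" "Z' n ?p \<in> carrier R" if "n < N" for n
    using composite_entry[OF _ that pP] H by auto
  show "interpolate J (u i) (\<lambda>n. (if i = 0 then X else Z) n ?p) ?e
    = interpolate J (u i) (\<lambda>n. (if i = 0 then X' else Z') n ?p) ?e"
  proof (cases "i = 0")
    case True
    obtain c where c: "c \<in> run_exps \<rightarrow> carrier R"
      and eq: "\<And>n. n < N \<Longrightarrow> (X \<otimes>\<^bsub>G\<^esub> inv\<^bsub>G\<^esub> X') n ?p = (\<Oplus>e\<in>run_exps. x n [^] e \<otimes> c e)"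
      using X pP unfolding V_def by blast
    have "X n ?p = u i n \<otimes> (\<Oplus>e\<in>run_exps. x n [^] e \<otimes> c e) \<oplus> X' n ?p" if n: "n < N" for n
    proof -
      have "(\<Oplus>e\<in>run_exps. x n [^] e \<otimes> c e) = X n ?p \<oplus> \<ominus> X' n ?p"
        using eq[OF n] mat_group_inv_apply[OF H(3) n pP] n pP by (simp del: mem_Sigma_iff)
      then show ?thesis using cl[OF n] True by (simp add: u_def a_assoc l_neg)
    qed
    then have "interpolate J (u i) (\<lambda>n. X n ?p) ?e = interpolate J (u i) (\<lambda>n. X' n ?p) ?e"
      using cl e by (intro interpolate_invariant[OF J_D card_J u run_J c]) auto
    then show ?thesis using True by simp
  next
    case False
    then have i1: "i = 1" using i by auto
    define w where "w n = Z n ?p \<ominus> Z' n ?p" for n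
    have w: "w n \<in> carrier R" if "n < N" for n using cl[OF that] by (simp add: w_def)
    have orth: "(\<Oplus>n\<in>{..<N}. x n [^] e' \<otimes> w n) = \<zero>" if e': "e' \<in> run_exps" for e'
    proof -
      let ?S = "\<lambda>Z. \<Oplus>n\<in>{..<N}. x n [^] e' \<otimes> Z n ?p"
      have S: "?S Z \<in> carrier R" "?S Z' \<in> carrier R"
        using cl pw by (auto intro!: finsum_closed)
      \<comment> \<open>One character value does not determine a field element, but the values for
        all multiples \<open>g\<close> of the probe do.\<close>
      have "?S Z = ?S Z'"
      proof (rule theta_separates[OF S])
        fix g assume g: "g \<in> carrier R"
        show "\<theta> (g \<otimes> ?S Z) = \<theta> (g \<otimes> ?S Z')"
          using Z[OF cchar_probe(1)[OF H(2) pP e' g]] cchar_probe(2)[OF H(2) pP e' g]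
            cchar_probe(2)[OF H(4) pP e' g] by simp
      qed
      moreover have "(\<Oplus>n\<in>{..<N}. x n [^] e' \<otimes> w n) = ?S Z \<ominus> ?S Z'"
        unfolding w_def using cl pw by (intro matrix_apply_minus) auto
      ultimately show ?thesis using S by simp
    qed
    obtain c where c: "c \<in> {a..<a + (N - k1)} \<rightarrow> carrier R"
      and eq: "\<And>n. n < N \<Longrightarrow> w n = v n \<otimes> (\<Oplus>e\<in>{a..<a + (N - k1)}. x n [^] e \<otimes> c e)"
      using dual_code[OF k1(1) D v dual w orth] by blast
    \<comment> \<open>The point at which the run must cover at least half of the \<open>N\<close>
      exponents.\<close>
    have sub: "{a..<a + (N - k1)} \<subseteq> run_exps" using k1(2) by auto
    have "Z n ?p = u i n \<otimes> (\<Oplus>e\<in>{a..<a + (N - k1)}. x n [^] e \<otimes> c e) \<oplus> Z' n ?p" if n: "n < N" for n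
    proof -
      have "u i n \<otimes> (\<Oplus>e\<in>{a..<a + (N - k1)}. x n [^] e \<otimes> c e) = Z n ?p \<oplus> \<ominus> Z' n ?p"
        using eq[OF n] by (simp add: i1 u_def w_def minus_eq)
      then show ?thesis using cl[OF n] by (simp add: a_assoc l_neg)
    qed
    then have "interpolate J (u i) (\<lambda>n. Z n ?p) ?e = interpolate J (u i) (\<lambda>n. Z' n ?p) ?e"
      using cl e sub run_J by (intro interpolate_invariant[OF J_D card_J u _ c]) auto
    then show ?thesis using False by simp
  qed
qed

lemma insts_entry:
  "A \<in> fmats R 2 m n \<Longrightarrow> i < 2 \<Longrightarrow> p \<in> {..<m} \<times> {..<n} \<Longrightarrow> A i p \<in> carrier R"
  unfolding fmats_def fmat_def by (auto simp: PiE_def Pi_def)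

lemma block_row: "t < K \<Longrightarrow> b < s \<Longrightarrow> t * s + b < K * s"
  using mixed_radix_less[of b s t K] by (simp add: mult.commute add.commute)

lemma block_col: "t < L \<Longrightarrow> b < l \<Longrightarrow> t * l + b < l * L"
  using mixed_radix_less[of b l t L] by (simp add: mult.commute add.commute)

lemma enc_A_closed:
  assumes n: "n < N" and A: "A \<in> fmats R 2 (K * s) k" and w: "w \<in> rand_A"
  shows "enc_A n A w \<in> fmats R 2 s k"
proof -
  have "share (gasp_alpha K L r) K T (\<lambda>t. A i (t * s + fst p, snd p)) (\<lambda>t. w ((i, p), t)) n \<in> carrier R"
    if i: "i < 2" and p: "p \<in> {..<s} \<times> {..<k}" for i p
  proof (rule share_closed[OF n])
    show "A i (t * s + fst p, snd p) \<in> carrier R" if "t < K" for t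
      using p block_row[OF that] by (intro insts_entry[OF A i]) auto
    show "w ((i, p), t) \<in> carrier R" if "t < T" for t
      using w i p that by (auto dest: PiE_mem)
  qed
  then show ?thesis unfolding enc_A_def fmats_def fmat_def by auto
qed

lemma enc_B_closed:
  assumes n: "n < N" and B: "B \<in> fmats R 2 k (l * L)" and w: "w \<in> rand_B"
  shows "enc_B n B w \<in> fmats R 2 k l"
proof -
  have "share (gasp_beta K L) L T (\<lambda>t. B i (fst p, t * l + snd p)) (\<lambda>t. w ((i, p), t)) n \<in> carrier R"
    if i: "i < 2" and p: "p \<in> {..<k} \<times> {..<l}" for i p
  proof (rule share_closed[OF n])
    show "B i (fst p, t * l + snd p) \<in> carrier R" if "t < L" for t
      using p block_col[OF that] by (intro insts_entry[OF B i]) auto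
    show "w ((i, p), t) \<in> carrier R" if "t < T" for t
      using w i p that by (auto dest: PiE_mem)
  qed
  then show ?thesis unfolding enc_B_def fmats_def fmat_def by auto
qed

lemma respond_closed:
  assumes n: "n < N" and i: "i < 2" and f: "f \<in> fmats R 2 s k" and g: "g \<in> fmats R 2 k l"
  shows "respond i n f g \<in> fmat R s l"
proof -
  have "fmat_mult R s k l (f i) (g i) p \<in> carrier R" if p: "p \<in> P" for p
  proof -
    have "(\<Oplus>z\<in>{..<k}. f i (fst p, z) \<otimes> g i (z, snd p)) \<in> carrier R"
      using p insts_entry[OF f i] insts_entry[OF g i] by (intro finsum_closed) auto
    then show ?thesis using p by (simp add: fmat_mult_def case_prod_unfold)
  qed
  then show ?thesis
    unfolding respond_def fmat_def using u[OF n] by auto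
qed

lemma answers_closed:
  assumes "i < 2" "A \<in> fmats R 2 (K * s) k" "B \<in> fmats R 2 k (l * L)" "w \<in> rand_A \<times> rand_B"
  shows "answers A B w i \<in> H"
proof -
  have w: "fst w \<in> rand_A" "snd w \<in> rand_B"
    using assms(4) unfolding mem_Times_iff by blast+
  have "respond i n (enc_A n A (fst w)) (enc_B n B (snd w)) \<in> fmat R s l" if "n < N" for n
    by (rule respond_closed[OF that assms(1) enc_A_closed[OF that assms(2) w(1)] enc_B_closed[OF that assms(3) w(2)]])
  then show ?thesis unfolding answers_def composite_def by simp
qed

text \<open>Quotient and remainder by \<open>s\<close> and \<open>l\<close> split a position of the
  full product into its block and its place in the block, inverting the indexing of the encodings.
  The multiplier \<open>u\<close> in the answers is the one with which \<open>interpolate\<close>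
  divides.\<close>

lemma decode_answers:
  assumes A: "A \<in> fmats R 2 (K * s) k" and B: "B \<in> fmats R 2 k (l * L)" and w: "w \<in> rand_A \<times> rand_B"
  shows "decode (answers A B w 0) (answers A B w 1)
    = (\<lambda>i\<in>{..<2}. fmat_mult R (K * s) k (l * L) (A i) (B i))"
  unfolding decode_def
proof (intro restrict_ext)
  fix i assume "i \<in> {..<2::nat}"
  then have i: "i < 2" and ans: "(if i = 0 then answers A B w 0 else answers A B w 1) = answers A B w i"
    by (auto simp: less_2_cases_iff)
  show "(\<lambda>p\<in>{..<K * s} \<times> {..<l * L}.
       interpolate J (u i) (\<lambda>n. (if i = 0 then answers A B w 0 else answers A B w 1) n (fst p mod s, snd p mod l))
        (fst p div s + K * (snd p div l)))
    = fmat_mult R (K * s) k (l * L) (A i) (B i)"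
    unfolding ans fmat_mult_def
  proof (intro restrict_ext)
    fix p assume p: "p \<in> {..<K * s} \<times> {..<l * L}"
    let ?p = "(fst p mod s, snd p mod l)"
    have pP: "fst p mod s < s" "snd p mod l < l" using pos by auto
    have ij: "fst p div s < K" "snd p div l < L"
      using p by (auto simp: less_mult_imp_div_less mult.commute)
    have wA: "fst w ((i, (b, z)), t) \<in> carrier R" if "b < s" "z < k" "t < T" for b z t
      using w i that by (auto dest: PiE_mem)
    have wB: "snd w ((i, (z, b)), t) \<in> carrier R" if "z < k" "b < l" "t < T" for b z t
      using w i that by (auto dest: PiE_mem)
    have "interpolate J (u i) (\<lambda>n. answers A B w i n ?p) (fst p div s + K * (snd p div l))
      = (\<Oplus>z\<in>{..<k}. A i (fst p div s * s + fst p mod s, z) \<otimes> B i (z, snd p div l * l + snd p mod l))"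
    proof (rule interpolate_shares_product[OF refl J_D card_J u _ _ _ _ _ ij,
          where dA = "\<lambda>z t. A i (t * s + fst p mod s, z)" and rA = "\<lambda>z t. fst w ((i, (fst p mod s, z)), t)"
            and dB = "\<lambda>z t. B i (z, t * l + snd p mod l)" and rB = "\<lambda>z t. snd w ((i, (z, snd p mod l)), t)"])
      show "A i (t * s + fst p mod s, z) \<in> carrier R" if "z < k" "t < K" for z t
        using that block_row[OF that(2) pP(1)] by (intro insts_entry[OF A i]) auto
      show "B i (z, t * l + snd p mod l) \<in> carrier R" if "z < k" "t < L" for z t
        using that block_col[OF that(2) pP(2)] by (intro insts_entry[OF B i]) auto
      show "answers A B w i n ?p = u i n \<otimes> (\<Oplus>z\<in>{..<k}.
          share (gasp_alpha K L r) K T (\<lambda>t. A i (t * s + fst p mod s, z)) (\<lambda>t. fst w ((i, (fst p mod s, z)), t)) n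
          \<otimes> share (gasp_beta K L) L T (\<lambda>t. B i (z, t * l + snd p mod l)) (\<lambda>t. snd w ((i, (z, snd p mod l)), t)) n)"
        if n: "n < N" for n
      proof -
        have "answers A B w i n ?p = u i n \<otimes> (\<Oplus>z\<in>{..<k}.
            enc_A n A (fst w) i (fst p mod s, z) \<otimes> enc_B n B (snd w) i (z, snd p mod l))"
          using n pP by (simp add: answers_def respond_def fmat_mult_def)
        also have "(\<Oplus>z\<in>{..<k}. enc_A n A (fst w) i (fst p mod s, z) \<otimes> enc_B n B (snd w) i (z, snd p mod l))
          = (\<Oplus>z\<in>{..<k}.
          share (gasp_alpha K L r) K T (\<lambda>t. A i (t * s + fst p mod s, z)) (\<lambda>t. fst w ((i, (fst p mod s, z)), t)) n
          \<otimes> share (gasp_beta K L) L T (\<lambda>t. B i (z, t * l + snd p mod l)) (\<lambda>t. snd w ((i, (z, snd p mod l)), t)) n)"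
        proof (intro finsum_cong' refl)
          fix z assume z: "z \<in> {..<k}"
          show "enc_A n A (fst w) i (fst p mod s, z) \<otimes> enc_B n B (snd w) i (z, snd p mod l) =
            share (gasp_alpha K L r) K T (\<lambda>t. A i (t * s + fst p mod s, z)) (\<lambda>t. fst w ((i, (fst p mod s, z)), t)) n
          \<otimes> share (gasp_beta K L) L T (\<lambda>t. B i (z, t * l + snd p mod l)) (\<lambda>t. snd w ((i, (z, snd p mod l)), t)) n"
            using i z pP by (simp add: enc_A_def enc_B_def)
        next
          show "(\<lambda>z. share (gasp_alpha K L r) K T (\<lambda>t. A i (t * s + fst p mod s, z)) (\<lambda>t. fst w ((i, (fst p mod s, z)), t)) n
            \<otimes> share (gasp_beta K L) L T (\<lambda>t. B i (z, t * l + snd p mod l)) (\<lambda>t. snd w ((i, (z, snd p mod l)), t)) n)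
            \<in> {..<k} \<rightarrow> carrier R"
            using pP block_row[OF _ pP(1)] block_col[OF _ pP(2)] wA wB
            by (intro funcsetI m_closed share_closed[OF n] insts_entry[OF A i] insts_entry[OF B i]) auto
        qed
        finally show ?thesis .
      qed
    qed (use wA wB pP in auto)
    then show "interpolate J (u i) (\<lambda>n. answers A B w i n ?p) (fst p div s + K * (snd p div l))
      = (case p of (i', j) \<Rightarrow> \<Oplus>z\<in>{..<k}. A i (i', z) \<otimes> B i (z, j))"
      by (simp add: case_prod_unfold)
  qed
qed

end

text \<open>As \<open>r \<le> K\<close>, offset and block number are the base-K digits of the
  exponent above \<open>K * L\<close>. Distinctness is what privacy needs of the masks.\<close>

lemma inj_gasp_alpha:
  assumes "1 \<le> r" "r \<le> K"
  shows "inj_on (gasp_alpha K L r) {K..<K + T}"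
proof (rule inj_onI)
  fix i j assume i: "i \<in> {K..<K + T}" and j: "j \<in> {K..<K + T}"
    and eq: "gasp_alpha K L r i = gasp_alpha K L r j"
  have lt: "(t - K) mod r < K" for t
    using assms by (meson less_le_trans mod_less_divisor less_one linorder_not_le not_gr_zero)
  have e: "(i - K) mod r + K * ((i - K) div r) = (j - K) mod r + K * ((j - K) div r)"
    using i j eq by (simp add: gasp_alpha_def algebra_simps)
  have "(i - K) mod r = (j - K) mod r"
    using arg_cong[OF e, of "\<lambda>t. t mod K"] lt by simp
  moreover have "(i - K) div r = (j - K) div r"
    using arg_cong[OF e, of "\<lambda>t. t div K"] lt assms by simp
  ultimately have "i - K = j - K" by (metis div_mult_mod_eq)
  then show "i = j" using i j by auto
qed

lemma inj_gasp_beta: "inj_on (gasp_beta K L) {L..<L + T}"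
  by (rule inj_onI) (auto simp: gasp_beta_def)

lemma finite_entries: "finite (entries P m n)"
proof -
  have "entries P m n = case_prod P ` ({..<m} \<times> {..<n})"
    by (auto simp: entries_def image_iff)
  then show ?thesis by simp
qed

section \<open>The scheme and its verification\<close>

context gasp_scheme
begin

text \<open>The randomness of a scheme is a natural number, so the key pairs are enumerated.\<close>

definition draw :: "nat \<Rightarrow> ((nat \<times> nat \<times> nat) \<times> nat \<Rightarrow> 'a) \<times> ((nat \<times> nat \<times> nat) \<times> nat \<Rightarrow> 'a)" where
  "draw = (SOME f. bij_betw f {..<card (rand_A \<times> rand_B)} (rand_A \<times> rand_B))"

definition outputs :: "'a insts set" where
  "outputs = case_prod decode ` (H \<times> H)"

text \<open>Measurement outcomes are numbers, so the possible decoded tuples are enumerated.\<close>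

definition label :: "'a insts \<Rightarrow> nat" where
  "label = (SOME h. bij_betw h outputs {..<card outputs})"

definition scheme :: "'a qscheme" where
  "scheme = \<lparr>servers = N, instances = 2, rnd = pmf_of_set {..<card (rand_A \<times> rand_B)},
     encA = (\<lambda>n A w. enc_A n A (fst (draw w))),
     encB = (\<lambda>n B w. enc_B n B (snd (draw w))),
     shared_state = pure_state (Q.psi \<one>\<^bsub>G\<^esub> \<one>\<^bsub>G\<^esub>),
     server_op = (\<lambda>n f g. [weyl s l (respond 0 n f g) (respond 1 n f g)]),
     outcomes = card outputs,
     user_meas = Q.meas (\<lambda>X Z. label (decode X Z))\<rparr>"

lemma scheme_simps [simp]:
  "servers scheme = N" "instances scheme = 2"
  "rnd scheme = pmf_of_set {..<card (rand_A \<times> rand_B)}"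
  "encA scheme n A w = enc_A n A (fst (draw w))" "encB scheme n B w = enc_B n B (snd (draw w))"
  "shared_state scheme = pure_state (Q.psi \<one>\<^bsub>G\<^esub> \<one>\<^bsub>G\<^esub>)"
  "server_op scheme n f g = [weyl s l (respond 0 n f g) (respond 1 n f g)]"
  "outcomes scheme = card outputs" "user_meas scheme = Q.meas (\<lambda>X Z. label (decode X Z))"
  by (simp_all add: scheme_def)

abbreviation "M \<equiv> card (rand_A \<times> rand_B)"
abbreviation "DA \<equiv> fmats R 2 (K * s) k"
abbreviation "DB \<equiv> fmats R 2 k (l * L)"
abbreviation "products A B \<equiv> \<lambda>i\<in>{..<2::nat}. fmat_mult R (K * s) k (l * L) (A i) (B i)"

lemma finite_rand: "finite (rand_A \<times> rand_B)"
  using fin by (intro finite_cartesian_product finite_PiE) auto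

lemma draw_bij: "bij_betw draw {..<M} (rand_A \<times> rand_B)"
  unfolding draw_def
  using ex_bij_betw_nat_finite[OF finite_rand] by (metis (mono_tags, lifting) atLeast0LessThan someI_ex)

lemma draw: "w < M \<Longrightarrow> draw w \<in> rand_A \<times> rand_B"
  using bij_betwE[OF draw_bij] by simp

lemma M_pos: "0 < M"
proof -
  have "carrier R \<noteq> {}" using zero_closed by blast
  then have "rand_A \<times> rand_B \<noteq> {}" by (simp add: PiE_eq_empty_iff)
  then show ?thesis using finite_rand by (simp only: card_gt_0_iff) simp
qed

lemma finite_H: "finite H"
  using fin by (simp add: finite_composite finite_fmat)

lemma label_bij: "bij_betw label outputs {..<card outputs}"
proof -
  have "finite outputs" unfolding outputs_def using finite_H by simp
  from ex_bij_betw_finite_nat[OF this] show ?thesis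
    unfolding label_def by (metis (mono_tags, lifting) atLeast0LessThan someI_ex)
qed

lemma label_decode: "X \<in> H \<Longrightarrow> Z \<in> H \<Longrightarrow> label (decode X Z) < card outputs"
  using bij_betwE[OF label_bij] by (force simp: outputs_def)

lemma products_output:
  assumes "A \<in> DA" "B \<in> DB"
  shows "products A B \<in> outputs"
proof -
  have w: "draw 0 \<in> rand_A \<times> rand_B" by (rule draw[OF M_pos])
  have "products A B = decode (answers A B (draw 0) 0) (answers A B (draw 0) 1)"
    by (rule decode_answers[OF assms w, symmetric])
  moreover have "(answers A B (draw 0) 0, answers A B (draw 0) 1) \<in> H \<times> H"
    using answers_closed[OF _ assms w] by simp
  ultimately show ?thesis
    using imageI[of "(answers A B (draw 0) 0, answers A B (draw 0) 1)" "H \<times> H" "case_prod decode"] by (simp only: outputs_def prod.case)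
qed

lemma label_products: "A \<in> DA \<Longrightarrow> B \<in> DB \<Longrightarrow> label (products A B) < card outputs"
  using bij_betwE[OF label_bij] products_output by blast

text \<open>Equality is claimed on \<open>H\<close> only, since entries outside the basis labels
  carry no meaning.\<close>

lemma received_state_scheme:
  assumes A: "A \<in> DA" and B: "B \<in> DB" and w: "w < M" and ab: "a' \<in> H" "b' \<in> H"
  shows "received_state R s l scheme A B w a' b'
    = pure_state (Q.psi (answers A B (draw w) 0) (answers A B (draw w) 1)) a' b'"
proof -
  let ?X = "answers A B (draw w) 0" and ?Z = "answers A B (draw w) 1"
  let ?W = "\<lambda>n. weyl s l (respond 0 n (enc_A n A (fst (draw w))) (enc_B n B (snd (draw w))))
     (respond 1 n (enc_A n A (fst (draw w))) (enc_B n B (snd (draw w))))"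
  have X: "?X \<in> H" by (rule answers_closed[OF _ A B draw[OF w]]) simp
  have W: "qtensor N ?W = qtensor N (\<lambda>n. weyl s l (?X n) (?Z n))"
    by (auto simp: qtensor_def answers_def intro!: ext prod.cong)
  have E: "qtensor N ?W u' b = (if u' = b \<otimes>\<^bsub>G\<^esub> ?X then cchar N s l ?Z b else 0)"
    if "u' \<in> carrier G" "b \<in> carrier G" for u' b
    unfolding W using that by (intro qtensor_weyl X) auto
  define \<Phi> where "\<Phi> u' = (\<Sum>b\<in>H. qtensor N ?W u' b * Q.psi \<one>\<^bsub>G\<^esub> \<one>\<^bsub>G\<^esub> b)" for u'
  have "received_state R s l scheme A B w = pure_state \<Phi>"
    unfolding \<Phi>_def by (simp add: received_state_def apply_local_unitary qmult_pure_state)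
  moreover have "\<Phi> u' = Q.psi ?X ?Z u'" if "u' \<in> H" for u'
    using Q.displacement_psi[of "qtensor N ?W" ?X ?Z u', OF E] X that cchar_one by (simp add: \<Phi>_def)
  ultimately show ?thesis using ab by (simp add: pure_state_def)
qed

lemma born_scheme:
  assumes A: "A \<in> DA" and B: "B \<in> DB" and w: "w < M" and y: "y < card outputs"
  shows "born H (user_meas scheme y) (received_state R s l scheme A B w)
    = (if y = label (products A B) then 1 else 0)"
proof -
  let ?X = "answers A B (draw w) 0" and ?Z = "answers A B (draw w) 1"
  have XZ: "?X \<in> carrier G" "?Z \<in> carrier G"
    using answers_closed[OF _ A B draw[OF w]] by auto
  have "born H (user_meas scheme y) (received_state R s l scheme A B w)
    = born H (user_meas scheme y) (pure_state (Q.psi ?X ?Z))"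
    by (rule born_cong) (rule received_state_scheme[OF A B w])
  also have "\<dots> = (if y = label (decode ?X ?Z) then 1 else 0)"
  proof -
    have "born (carrier G) (Q.meas (\<lambda>X Z. label (decode X Z)) y) (pure_state (Q.psi ?X ?Z))
      = (if y = label (decode ?X ?Z) then 1 else 0)"
    proof (rule Q.born_meas[where m = "card outputs"])
      show "label (decode X Z) = label (decode X' Z')"
        if "X \<in> carrier G" "Z \<in> carrier G" "X' \<in> carrier G" "Z' \<in> carrier G"
          "X \<otimes>\<^bsub>G\<^esub> inv\<^bsub>G\<^esub> X' \<in> V" "\<And>c. c \<in> V \<Longrightarrow> cchar N s l Z c = cchar N s l Z' c" for X Z X' Z'
        using that by (intro arg_cong[where f = label] decode_invariant) auto
    qed (use label_decode XZ y in auto)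
    then show ?thesis by simp
  qed
  also have "decode ?X ?Z = products A B" by (rule decode_answers[OF A B draw[OF w]])
  finally show ?thesis .
qed

lemma wf_scheme: "wf_scheme R s k l K L scheme"
  unfolding wf_scheme_def data_A_def data_B_def
proof (intro conjI allI impI ballI)
  have sp: "set_pmf (rnd scheme) = {..<M}"
    using M_pos by (simp add: set_pmf_of_set lessThan_empty_iff)
  show "finite (set_pmf (rnd scheme))" unfolding sp by simp
  fix n w assume n: "n < servers scheme" and "w \<in> set_pmf (rnd scheme)"
  then have w: "draw w \<in> rand_A \<times> rand_B" unfolding sp by (simp only: lessThan_iff draw)
  then have w': "fst (draw w) \<in> rand_A" "snd (draw w) \<in> rand_B" unfolding mem_Times_iff by blast+
  show "encA scheme n A w \<in> fmats R (instances scheme) s k" if "A \<in> fmats R (instances scheme) (K * s) k" for A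
    using enc_A_closed[of n A "fst (draw w)"] n that w'(1) by simp
  show "encB scheme n B w \<in> fmats R (instances scheme) k l" if "B \<in> fmats R (instances scheme) k (l * L)" for B
    using enc_B_closed[of n B "snd (draw w)"] n that w'(2) by simp
next
  show "density_operator (composite (servers scheme) (fmat R s l)) (shared_state scheme)"
    using Q.density_operator_psi[of "\<one>\<^bsub>G\<^esub>" "\<one>\<^bsub>G\<^esub>"] mat_group_one_closed by simp
next
  fix n f g assume "n < servers scheme" "f \<in> fmats R (instances scheme) s k" "g \<in> fmats R (instances scheme) k l"
  then show "quantum_operation (fmat R s l) (server_op scheme n f g)"
    using quantum_operation_weyl[OF respond_closed[of n 0 f g]] by simp
next
  show "measurement (composite (servers scheme) (fmat R s l)) (outcomes scheme) (user_meas scheme)"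
    using Q.measurement_meas[of "\<lambda>X Z. label (decode X Z)" "card outputs"] label_decode by simp
qed

sublocale O: deterministic_outcome DA DB "{..<M}" "\<lambda>A B w. label (products A B)" "card outputs"
proof
  have ne: "fmats R 2 m n \<noteq> {}" for m n
    using zero_closed by (auto simp: fmats_def fmat_def PiE_eq_empty_iff)
  show "DA \<noteq> {}" "DB \<noteq> {}" by (rule ne)+
  have "finite (fmats R 2 m n)" for m n
    unfolding fmats_def using fin by (intro finite_PiE finite_fmat) auto
  then show "finite DA" "finite DB" by blast+
  show "{..<M} \<noteq> {}" using M_pos by (simp only: lessThan_empty_iff)
qed (use label_products in auto)

text \<open>The Born factor is 0 or 1, so the measurement adds no randomness of its own.\<close>

lemma scheme_space_eq:
  "scheme_space R s k l K L scheme = point_measure (DA \<times> DB \<times> {..<M} \<times> {..<card outputs})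
     (\<lambda>\<omega>. ennreal (outcome_law DA DB {..<M} (\<lambda>A B w. label (products A B)) \<omega>))"
proof -
  have ne: "{..<M} \<noteq> {}" using M_pos by (simp only: lessThan_empty_iff)
  have sp: "set_pmf (rnd scheme) = {..<M}"
    using ne by (simp add: set_pmf_of_set)
  have "pmf (rnd scheme) w = 1 / card {..<M}" if "w < M" for w
    using that ne by (simp only: scheme_simps) (subst pmf_of_set, auto)
  then show ?thesis
    unfolding scheme_space_def sp data_A_def data_B_def outcome_law_def
    by (simp only: scheme_simps, intro point_measure_cong)
      (clarsimp simp: born_scheme[unfolded scheme_simps])
qed

lemma enc_A_rerandomize:
  assumes S: "S \<subseteq> {..<N}" "card S \<le> T" and A: "A \<in> DA" "A' \<in> DA"
  obtains \<phi> where "bij_betw \<phi> rand_A rand_A"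
    "\<And>w n. w \<in> rand_A \<Longrightarrow> n \<in> S \<Longrightarrow> enc_A n A w = enc_A n A' (\<phi> w)"
proof -
  \<comment> \<open>Column 0 of the exponent matrix adds 0, so the mask exponents occur in
    \<open>J\<close> and obey its bound.\<close>
  have "gasp_alpha K L r ` {K..<K + T} \<subseteq> J"
  proof
    fix e assume "e \<in> gasp_alpha K L r ` {K..<K + T}"
    then obtain i where "i < K + T" "e = gasp_PM K L r i 0"
      by (auto simp: gasp_PM_def gasp_beta_def split: if_splits)
    then show "e \<in> J" using pos unfolding entries_def by force
  qed
  then have D': "gasp_alpha K L r ` {K..<K + T} \<subseteq> {..D}" using J_D by blast
  let ?d = "\<lambda>A q t. A (fst q) (t * s + fst (snd q), snd (snd q))"
  have d: "?d A q t \<in> carrier R" if "A \<in> DA" "q \<in> {..<2} \<times> ({..<s} \<times> {..<k})" "t < K" for A q t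
    using that block_row[OF that(3)] by (intro insts_entry[OF that(1)]) auto
  obtain \<phi> where \<phi>: "bij_betw \<phi> rand_A rand_A"
    "\<And>w n q. w \<in> rand_A \<Longrightarrow> n \<in> S \<Longrightarrow> q \<in> {..<2} \<times> ({..<s} \<times> {..<k}) \<Longrightarrow>
      share (gasp_alpha K L r) K T (?d A q) (\<lambda>t. w (q, t)) n = share (gasp_alpha K L r) K T (?d A' q) (\<lambda>t. \<phi> w (q, t)) n"
    by (rule shares_rerandomize[OF S inj_gasp_alpha[OF r] D', where Q = "{..<2} \<times> ({..<s} \<times> {..<k})" and d = "?d A" and d' = "?d A'"])
      (use d A in auto)
  have "enc_A n A w = enc_A n A' (\<phi> w)" if "w \<in> rand_A" "n \<in> S" for w n
    unfolding enc_A_def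
  proof (intro restrict_ext)
    fix i p assume ip: "i \<in> {..<2::nat}" "p \<in> {..<s} \<times> {..<k}"
    show "share (gasp_alpha K L r) K T (\<lambda>t. A i (t * s + fst p, snd p)) (\<lambda>t. w ((i, p), t)) n
      = share (gasp_alpha K L r) K T (\<lambda>t. A' i (t * s + fst p, snd p)) (\<lambda>t. \<phi> w ((i, p), t)) n"
      using \<phi>(2)[OF that, of "(i, p)"] ip by simp
  qed
  then show thesis using \<phi>(1) that by blast
qed

lemma enc_B_rerandomize:
  assumes S: "S \<subseteq> {..<N}" "card S \<le> T" and B: "B \<in> DB" "B' \<in> DB"
  obtains \<phi> where "bij_betw \<phi> rand_B rand_B"
    "\<And>w n. w \<in> rand_B \<Longrightarrow> n \<in> S \<Longrightarrow> enc_B n B w = enc_B n B' (\<phi> w)"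
proof -
  have "gasp_beta K L ` {L..<L + T} \<subseteq> J"
  proof
    fix e assume "e \<in> gasp_beta K L ` {L..<L + T}"
    then obtain j where "j < L + T" "e = gasp_PM K L r 0 j"
      using pos by (auto simp: gasp_PM_def gasp_alpha_def)
    then show "e \<in> J" using pos unfolding entries_def by force
  qed
  then have D': "gasp_beta K L ` {L..<L + T} \<subseteq> {..D}" using J_D by blast
  let ?d = "\<lambda>B q t. B (fst q) (fst (snd q), t * l + snd (snd q))"
  have d: "?d B q t \<in> carrier R" if "B \<in> DB" "q \<in> {..<2} \<times> ({..<k} \<times> {..<l})" "t < L" for B q t
    using that block_col[OF that(3)] by (intro insts_entry[OF that(1)]) auto
  obtain \<phi> where \<phi>: "bij_betw \<phi> rand_B rand_B"
    "\<And>w n q. w \<in> rand_B \<Longrightarrow> n \<in> S \<Longrightarrow> q \<in> {..<2} \<times> ({..<k} \<times> {..<l}) \<Longrightarrow>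
      share (gasp_beta K L) L T (?d B q) (\<lambda>t. w (q, t)) n = share (gasp_beta K L) L T (?d B' q) (\<lambda>t. \<phi> w (q, t)) n"
    by (rule shares_rerandomize[OF S inj_gasp_beta D', where Q = "{..<2} \<times> ({..<k} \<times> {..<l})" and d = "?d B" and d' = "?d B'"])
      (use d B in auto)
  have "enc_B n B w = enc_B n B' (\<phi> w)" if "w \<in> rand_B" "n \<in> S" for w n
    unfolding enc_B_def
  proof (intro restrict_ext)
    fix i p assume ip: "i \<in> {..<2::nat}" "p \<in> {..<k} \<times> {..<l}"
    show "share (gasp_beta K L) L T (\<lambda>t. B i (fst p, t * l + snd p)) (\<lambda>t. w ((i, p), t)) n
      = share (gasp_beta K L) L T (\<lambda>t. B' i (fst p, t * l + snd p)) (\<lambda>t. \<phi> w ((i, p), t)) n"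
      using \<phi>(2)[OF that, of "(i, p)"] ip by simp
  qed
  then show thesis using \<phi>(1) that by blast
qed

lemma T_private_scheme: "T_private R s k l K L T scheme"
  unfolding T_private_def scheme_space_eq scheme_simps
proof (intro allI impI)
  fix S1 S2 assume S: "S1 \<subseteq> {..<N} \<and> S2 \<subseteq> {..<N} \<and> card S1 \<le> T \<and> card S2 \<le> T"
  show "mutual_info (point_measure (DA \<times> DB \<times> {..<M} \<times> {..<card outputs})
     (\<lambda>\<omega>. ennreal (outcome_law DA DB {..<M} (\<lambda>A B w. label (products A B)) \<omega>)))
     (\<lambda>(A, B, w, y). (\<lambda>n\<in>S1. enc_A n A (fst (draw w)), \<lambda>n\<in>S2. enc_B n B (snd (draw w))))
     (\<lambda>(A, B, w, y). (A, B)) = 0"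
  proof (rule O.mutual_info_eq_0)
    fix A B A' B' assume AB: "A \<in> DA" "B \<in> DB" "A' \<in> DA" "B' \<in> DB"
    obtain f where f: "bij_betw f rand_A rand_A"
      "\<And>w n. w \<in> rand_A \<Longrightarrow> n \<in> S1 \<Longrightarrow> enc_A n A w = enc_A n A' (f w)"
      by (rule enc_A_rerandomize[of S1 A A']) (use S AB in auto)
    obtain g where g: "bij_betw g rand_B rand_B"
      "\<And>w n. w \<in> rand_B \<Longrightarrow> n \<in> S2 \<Longrightarrow> enc_B n B w = enc_B n B' (g w)"
      by (rule enc_B_rerandomize[of S2 B B']) (use S AB in auto)
    \<comment> \<open>The keys for A and B are independent, so the two bijections combine even when
      the two sets of servers differ; conjugation by \<open>draw\<close> carries them over to key
      numbers.\<close>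
    define \<phi> where "\<phi> = inv_into {..<M} draw \<circ> map_prod f g \<circ> draw"
    have fg: "bij_betw (map_prod f g) (rand_A \<times> rand_B) (rand_A \<times> rand_B)"
      using f(1) g(1) by (rule bij_betw_map_prod)
    have "bij_betw \<phi> {..<M} {..<M}"
      unfolding \<phi>_def by (intro bij_betw_trans[OF draw_bij] bij_betw_trans[OF fg] bij_betw_inv_into draw_bij)
    moreover have "((\<lambda>n\<in>S1. enc_A n A (fst (draw w))), (\<lambda>n\<in>S2. enc_B n B (snd (draw w))))
        = ((\<lambda>n\<in>S1. enc_A n A' (fst (draw (\<phi> w)))), (\<lambda>n\<in>S2. enc_B n B' (snd (draw (\<phi> w)))))"
      if w: "w \<in> {..<M}" for w
    proof -
      have dw: "draw w \<in> rand_A \<times> rand_B" using w draw by (simp only: lessThan_iff)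
      then have d1: "fst (draw w) \<in> rand_A" and d2: "snd (draw w) \<in> rand_B" unfolding mem_Times_iff by blast+
      have "map_prod f g (draw w) \<in> rand_A \<times> rand_B" by (rule bspec[OF bij_betwE[OF fg] dw])
      then have "draw (\<phi> w) = map_prod f g (draw w)"
        unfolding \<phi>_def comp_def by (rule bij_betw_inv_into_right[OF draw_bij])
      then show ?thesis using f(2)[OF d1] g(2)[OF d2] by (simp cong: restrict_cong)
    qed
    ultimately show "\<exists>\<phi>. bij_betw \<phi> {..<M} {..<M} \<and>
        (\<forall>w\<in>{..<M}. (\<lambda>n\<in>S1. enc_A n A (fst (draw w)), \<lambda>n\<in>S2. enc_B n B (snd (draw w)))
          = (\<lambda>n\<in>S1. enc_A n A' (fst (draw (\<phi> w))), \<lambda>n\<in>S2. enc_B n B' (snd (draw (\<phi> w)))))"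
      by blast
  qed
qed

lemma decodable_scheme: "decodable R s k l K L scheme"
  unfolding decodable_def scheme_space_eq scheme_simps
proof (rule O.cond_entropy_eq_0)
  fix A B w A' B' w'
  assume AB: "A \<in> DA" "B \<in> DB" "A' \<in> DA" "B' \<in> DB" and eq: "label (products A B) = label (products A' B')"
  show "products A B = products A' B'"
    using bij_betw_imp_inj_on[OF label_bij] eq products_output AB by (meson inj_onD)
qed

lemma qpdmm_scheme: "qpdmm_scheme R s k l K L T scheme"
  unfolding qpdmm_scheme_def using wf_scheme T_private_scheme decodable_scheme by blast

end

theorem theorem6:
  fixes K L T r :: nat
  assumes "K \<ge> 1" and "L \<ge> 1" and "T \<ge> 1"
    and "r \<in> {1..min K T}" and "gasp_servers K L T r = gasp_opt K L T"
    and "int (card (LCC (gasp_IS K L T r))) \<ge> \<lceil>real (gasp_opt K L T) / 2\<rceil>"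
  shows "\<exists>q0. \<forall>F :: 'a ring. field F \<and> finite (carrier F) \<and> card (carrier F) \<ge> q0 \<longrightarrow>
    (\<forall>s k l. s \<ge> 1 \<and> k \<ge> 1 \<and> l \<ge> 1 \<longrightarrow>
      (\<exists>S. qpdmm_scheme F s k l K L T S \<and>
           servers S = gasp_opt K L T \<and> instances S = 2 \<and>
           scheme_rate K L S = real (2 * K * L) / real (gasp_opt K L T) \<and>
           scheme_rate K L S = 2 * classical_rate K L T))"
proof -
  define J where "J = entries (gasp_PM K L r) (K + T) (L + T)"
  define N where "N = card J"
  have opt: "gasp_opt K L T = N"
    using assms(5) by (simp add: gasp_servers_def N_def J_def)
  have finJ: "finite J" unfolding J_def by (rule finite_entries)
  have "gasp_PM K L r 0 0 \<in> J" using assms(1,2) unfolding J_def entries_def by force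
  then have N0: "0 < N" using finJ by (auto simp: N_def card_gt_0_iff)
  have "finite (gasp_IS K L T r)" using finJ by (simp add: gasp_IS_def J_def)
  then obtain a k0 where run: "LCC (gasp_IS K L T r) = {a..<a + k0}" "{a..<a + k0} \<subseteq> gasp_IS K L T r"
    by (rule LCC_interval)
  \<comment> \<open>The ceiling of N / 2; the run is cut down to this length.\<close>
  define k1 where "k1 = (N + 1) div 2"
  have "k1 \<le> k0" using assms(6) unfolding opt run(1) k1_def by (simp add: ceiling_le_iff)
  then have run1: "{a..<a + k1} \<subseteq> gasp_IS K L T r" using run(2) by auto
  have k1: "k1 \<le> N" "N - k1 \<le> k1" using N0 by (auto simp: k1_def)
  \<comment> \<open>\<open>Max J\<close> covers interpolation and masks, \<open>2 * a + N\<close>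
    the exponents to which the multipliers are orthogonal.\<close>
  define D where "D = Max J + 2 * a + N"
  have J_D: "J \<subseteq> {..D}" using finJ by (auto simp: D_def intro: Max_ge trans_le_add1)
  have main: "\<exists>S. qpdmm_scheme F s k l K L T S \<and> servers S = N \<and> instances S = 2"
    if F: "field F" "finite (carrier F)" "card (carrier F) \<ge> Suc (2 ^ N * 2 ^ Suc D * D)"
      and pos: "s \<ge> 1" "l \<ge> 1" for F :: "'a ring" and s k l
  proof -
    interpret F: field F by fact
    obtain x where "F.generic_points x N D"
      using F.generic_points_exist[OF F(2), of N D] F(3) by auto
    then interpret E: evaluation_code F x N D using F(2) by unfold_locales
    obtain v where v: "v \<in> {..<N} \<rightarrow> carrier F" "\<And>n. n < N \<Longrightarrow> v n \<noteq> \<zero>\<^bsub>F\<^esub>"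
      "\<And>e. e \<in> {2 * a..<2 * a + (N - 1)} \<Longrightarrow> (\<Oplus>\<^bsub>F\<^esub>n\<in>{..<N}. x n [^]\<^bsub>F\<^esub> e \<otimes>\<^bsub>F\<^esub> v n) = \<zero>\<^bsub>F\<^esub>"
      by (rule E.dual_multipliers[OF N0, of "2 * a"]) (auto simp: D_def)
    obtain \<theta> b where \<theta>: "\<And>a b. a \<in> carrier F \<Longrightarrow> b \<in> carrier F \<Longrightarrow> \<theta> (a \<oplus>\<^bsub>F\<^esub> b) = \<theta> a * \<theta> b"
      "\<And>a. cmod (\<theta> a) = 1" "b \<in> carrier F" "\<theta> b \<noteq> 1"
      using F.exists_additive_character[OF F(2)] by blast
    interpret S: gasp_scheme F x N D \<theta> K L T r s k l a k1 v
    proof unfold_locales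
      show "entries (gasp_PM K L r) (K + T) (L + T) \<subseteq> {..D}" using J_D by (simp add: J_def)
      show "card (entries (gasp_PM K L r) (K + T) (L + T)) = N" by (simp add: N_def J_def)
    qed (use F(2) assms pos run1 k1 v \<theta> in \<open>auto simp: D_def\<close>)
    show ?thesis using S.qpdmm_scheme by (intro exI[of _ S.scheme]) simp
  qed
  show ?thesis
    unfolding opt
  \<comment> \<open>The threshold comes from the greedy choice of points. It depends on
    \<open>N\<close> and \<open>D\<close> only, hence serves all block dimensions at once.\<close>
  proof (intro exI[of _ "Suc (2 ^ N * 2 ^ Suc D * D)"] allI impI, elim conjE)
    fix F :: "'a ring" and s k l :: nat
    assume "field F" "finite (carrier F)" "card (carrier F) \<ge> Suc (2 ^ N * 2 ^ Suc D * D)"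
      and "1 \<le> s" "1 \<le> k" "1 \<le> l"
    then obtain S where S: "qpdmm_scheme F s k l K L T S" "servers S = N" "instances S = 2"
      using main by blast
    then show "\<exists>S. qpdmm_scheme F s k l K L T S \<and> servers S = N \<and> instances S = 2 \<and>
      scheme_rate K L S = real (2 * K * L) / real N \<and> scheme_rate K L S = 2 * classical_rate K L T"
      by (intro exI[of _ S]) (simp add: scheme_rate_def classical_rate_def opt)
  qed
qed

end
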